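(* Let $k\ne l$ be such that $\rho_k\le\rho_l$ and let $c>0$. Then among the elements $a\in\mathcal A$ of type $(k,l)$ such that $\varphi_k(aa^* )\le c$, the maximizers of $\chi^{\mathcal D}$ are those for which the distribution of $aa^*$ in $(\mathcal A_{kk},\varphi_k)$ is the push-forward, by $t\mapsto\frac{c\rho_k}{\rho_l}t$, of the Marchenko–Pastur distribution with parameter $\frac{\rho_l}{\rho_k}$. That is: if $b\in\mathcal A$ has type $(k,l)$ and $bb^*$ has this distribution in $(\mathcal A_{kk},\varphi_k)$, then for every $a\in\mathcal A$ of type $(k,l)$ with $\varphi_k(aa^* )\le c$ one has $\chi^{\mathcal D}(a)\le\chi^{\mathcal D}(b)$, with equality if and only if $aa^*$ has this distribution in $(\mathcal A_{kk},\varphi_k)$.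
   Context: $(\mathcal A,\varphi)$ is a tracial $W^*$-probability space with nonzero self-adjoint pairwise orthogonal projections $p_1,\dots,p_d$ with sum $1$; $\rho_i=\varphi(p_i)$; $\mathcal D=\mathrm{Span}\{p_1,\dots,p_d\}$; $\mathcal A_{ij}=p_i\mathcal Ap_j$; $\varphi_i=\rho_i^{-1}\varphi|_{\mathcal A_{ii}}$; $E(x)=\sum_i\varphi_i(p_ixp_i)p_i$. Simple elements are the nonzero elements of $\bigcup_{i,j}\mathcal A_{ij}$; $a$ has type $(k,l)$ if $a$ is a nonzero element of $\mathcal A_{kl}$. Let $q_k(n)$ be the integer part of $\rho_kn$, and let $p_1(n),\dots,p_d(n)$ be the diagonal projections of the $n\times n$ complex matrices $\mathfrak M_n$ onto consecutive disjoint blocks of coordinates of sizes $q_1(n),\dots,q_d(n)$. For matrices, $E(A)=\sum_k\frac{1}{q_k(n)}\mathrm{Tr}(p_k(n)Ap_k(n))\,p_k\in\mathcal D$. Put $\mathfrak M_n(k,l)=p_k(n)\mathfrak M_np_l(n)$, with Lebesgue measure $\Lambda$ from the Euclidean structure $\langle M,N\rangle=\mathrm{Re}\,\mathrm{Tr}(M^*N)$. $\|\cdot\|$ is the operator norm (on $\mathcal D$ too). For $a$ of type $(k,l)$, $k\ne l$, positive integers $n,r$ and $\varepsilon,R>0$, $\Gamma_R(a;n,r,\varepsilon)$ is the set of $A\in\mathfrak M_n(k,l)$ with $\|A\|\le R$ and $\|E(A^{\varepsilon_1}\cdots A^{\varepsilon_p})-E(a^{\varepsilon_1}\cdots a^{\varepsilon_p})\|\le\varepsilon$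 for all $1\le p\le r$ and $\varepsilon_1,\dots,\varepsilon_p\in\{1,*\}$. The free entropy is $\chi^{\mathcal D}(a)=\sup_{R}\inf_{r,\varepsilon}\limsup_{n\to\infty}\big[\frac1{n^2}\log\Lambda(\Gamma_R(a;n,r,\varepsilon))+\rho_k\rho_l\log n\big]$ (with $\log0=-\infty$). The Marchenko–Pastur distribution with parameter $\lambda\ge1$ has density $\frac{\sqrt{4\lambda-(x-1-\lambda)^2}}{2\pi x}$ on $[(1-\sqrt\lambda)^2,(1+\sqrt\lambda)^2]$. *)

theory Defs
  imports "HOL-Probability.Probability" "Jordan_Normal_Form.Schur_Decomposition"
begin

section \<open>Complex Hilbert spaces and bounded operators\<close>

text \<open>The norm, topology and real scalar multiplication are inherited from the underlying real
  Hilbert space; the complex structure is tied to them by the axioms \<open>scaleC_of_real\<close> and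
  \<open>Re_cinner\<close>. The inner product is antilinear in its first argument.\<close>

class chilbert_space = real_inner + complete_space +
  fixes scaleC :: "complex \<Rightarrow> 'a \<Rightarrow> 'a"
    and cinner :: "'a \<Rightarrow> 'a \<Rightarrow> complex"
  assumes scaleC_add_right: "scaleC c (x + y) = scaleC c x + scaleC c y"
    and scaleC_add_left: "scaleC (c + c') x = scaleC c x + scaleC c' x"
    and scaleC_scaleC: "scaleC c (scaleC c' x) = scaleC (c * c') x"
    and scaleC_of_real: "scaleC (complex_of_real r) x = scaleR r x"
    and cinner_commute: "cinner x y = cnj (cinner y x)"
    and cinner_add_right: "cinner x (y + z) = cinner x y + cinner x z"
    and cinner_scaleC_right: "cinner x (scaleC c y) = c * cinner x y"
    and Re_cinner: "Re (cinner x y) = inner x y"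

lemma norm_scaleC: "norm (scaleC c x) = cmod c * norm (x :: 'h :: chilbert_space)"
proof -
  have left: "cinner (scaleC c x) y = cnj c * cinner x y" for y
    by (metis cinner_commute cinner_scaleC_right complex_cnj_mult)
  have im: "Im (cinner x x) = 0"
    using arg_cong[OF cinner_commute[of x x], of Im] by simp
  have "cinner (scaleC c x) (scaleC c x) = (c * cnj c) * cinner x x"
    by (simp add: left cinner_scaleC_right)
  also have "c * cnj c = complex_of_real ((cmod c)\<^sup>2)"
    by (rule complex_norm_square[symmetric])
  finally have "inner (scaleC c x) (scaleC c x) = (cmod c)\<^sup>2 * inner x x"
    by (simp flip: Re_cinner add: im)
  then show ?thesis
    by (simp add: norm_eq_sqrt_inner real_sqrt_mult)
qed

type_synonym 'h bop = "'h \<Rightarrow>\<^sub>L 'h"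

text \<open>The type \<^typ>\<open>'h bop\<close> consists of all real-linear bounded operators, with the operator norm;
  complex linearity is imposed separately.\<close>

definition clinear_op :: "('h :: chilbert_space) bop \<Rightarrow> bool" where
  "clinear_op T \<longleftrightarrow> (\<forall>c v. blinfun_apply T (scaleC c v) = scaleC c (blinfun_apply T v))"

lift_definition op_scale :: "complex \<Rightarrow> ('h :: chilbert_space) bop \<Rightarrow> 'h bop" is
  "\<lambda>c T v. scaleC c (T v)"
proof -
  fix c :: complex and T :: "'h \<Rightarrow> 'h"
  assume T: "bounded_linear T"
  have "bounded_linear (\<lambda>x :: 'h. scaleC c x)"
  proof (rule bounded_linear_intro[where K = "cmod c"])
    fix r and x :: 'h
    have "scaleC c (scaleR r x) = scaleC (c * complex_of_real r) x"
      by (simp flip: scaleC_of_real add: scaleC_scaleC)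
    also have "\<dots> = scaleR r (scaleC c x)"
      by (simp flip: scaleC_of_real add: scaleC_scaleC mult.commute)
    finally show "scaleC c (scaleR r x) = scaleR r (scaleC c x)" .
  qed (simp_all add: scaleC_add_right norm_scaleC mult.commute)
  from bounded_linear_compose[OF this T] show "bounded_linear (\<lambda>v. scaleC c (T v))" .
qed

text \<open>For complex-linear bounded operators on a Hilbert space the adjoint exists and is unique.\<close>

definition op_adj :: "('h :: chilbert_space) bop \<Rightarrow> 'h bop" where
  "op_adj T = (THE S. \<forall>x y. cinner (blinfun_apply S x) y = cinner x (blinfun_apply T y))"

definition op_nonneg :: "('h :: chilbert_space) bop \<Rightarrow> bool" where
  "op_nonneg T \<longleftrightarrow> (\<forall>v. Im (cinner v (blinfun_apply T v)) = 0 \<and> Re (cinner v (blinfun_apply T v)) \<ge> 0)"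

definition op_le :: "('h :: chilbert_space) bop \<Rightarrow> 'h bop \<Rightarrow> bool" where
  "op_le S T \<longleftrightarrow> op_nonneg (T - S)"

section \<open>Tracial W*-probability spaces\<close>

definition commutant :: "('h :: chilbert_space) bop set \<Rightarrow> 'h bop set" where
  "commutant S = {T. clinear_op T \<and> (\<forall>s\<in>S. T o\<^sub>L s = s o\<^sub>L T)}"

definition von_neumann_algebra :: "('h :: chilbert_space) bop set \<Rightarrow> bool" where
  "von_neumann_algebra A \<longleftrightarrow>
     (\<forall>x\<in>A. clinear_op x \<and> op_adj x \<in> A) \<and> commutant (commutant A) = A"

definition directed_ops :: "('h :: chilbert_space) bop set \<Rightarrow> bool" where
  "directed_ops S \<longleftrightarrow> S \<noteq> {} \<and> (\<forall>s\<in>S. \<forall>t\<in>S. \<exists>u\<in>S. op_le s u \<and> op_le t u)"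

definition is_sup_in :: "('h :: chilbert_space) bop set \<Rightarrow> 'h bop set \<Rightarrow> 'h bop \<Rightarrow> bool" where
  "is_sup_in A S x \<longleftrightarrow> x \<in> A \<and> op_adj x = x \<and> (\<forall>s\<in>S. op_le s x) \<and>
     (\<forall>y\<in>A. op_adj y = y \<and> (\<forall>s\<in>S. op_le s y) \<longrightarrow> op_le x y)"

definition normal_functional :: "('h :: chilbert_space) bop set \<Rightarrow> ('h bop \<Rightarrow> complex) \<Rightarrow> bool" where
  "normal_functional A \<phi> \<longleftrightarrow>
     (\<forall>S x. S \<subseteq> A \<and> (\<forall>s\<in>S. op_adj s = s) \<and> directed_ops S \<and> is_sup_in A S x \<longrightarrow>
        Re (\<phi> x) = (SUP s\<in>S. Re (\<phi> s)))"

definition tracial_wstar_prob_space :: "('h :: chilbert_space) bop set \<Rightarrow> ('h bop \<Rightarrow> complex) \<Rightarrow> bool" where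
  "tracial_wstar_prob_space A \<phi> \<longleftrightarrow>
     von_neumann_algebra A \<and>
     (\<forall>x\<in>A. \<forall>y\<in>A. \<phi> (x + y) = \<phi> x + \<phi> y) \<and>
     (\<forall>c. \<forall>x\<in>A. \<phi> (op_scale c x) = c * \<phi> x) \<and>
     \<phi> id_blinfun = 1 \<and>
     (\<forall>x\<in>A. Im (\<phi> (op_adj x o\<^sub>L x)) = 0 \<and> Re (\<phi> (op_adj x o\<^sub>L x)) \<ge> 0) \<and>
     (\<forall>x\<in>A. \<phi> (op_adj x o\<^sub>L x) = 0 \<longrightarrow> x = 0) \<and>
     normal_functional A \<phi> \<and>
     (\<forall>x\<in>A. \<forall>y\<in>A. \<phi> (x o\<^sub>L y) = \<phi> (y o\<^sub>L x))"

definition rectangular_prob_space ::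
  "('h :: chilbert_space) bop set \<Rightarrow> ('h bop \<Rightarrow> complex) \<Rightarrow> nat \<Rightarrow> (nat \<Rightarrow> 'h bop) \<Rightarrow> bool" where
  "rectangular_prob_space A \<phi> d p \<longleftrightarrow>
     tracial_wstar_prob_space A \<phi> \<and>
     (\<forall>i\<in>{1..d}. p i \<in> A \<and> p i \<noteq> 0 \<and> op_adj (p i) = p i \<and> p i o\<^sub>L p i = p i) \<and>
     (\<forall>i\<in>{1..d}. \<forall>j\<in>{1..d}. i \<noteq> j \<longrightarrow> p i o\<^sub>L p j = 0) \<and>
     (\<Sum>i=1..d. p i) = id_blinfun"

definition rho :: "('h :: chilbert_space bop \<Rightarrow> complex) \<Rightarrow> (nat \<Rightarrow> 'h bop) \<Rightarrow> nat \<Rightarrow> real" where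
  "rho \<phi> p i = Re (\<phi> (p i))"

definition corner :: "('h :: chilbert_space) bop set \<Rightarrow> (nat \<Rightarrow> 'h bop) \<Rightarrow> nat \<Rightarrow> nat \<Rightarrow> 'h bop set" where
  "corner A p k l = (\<lambda>x. p k o\<^sub>L x o\<^sub>L p l) ` A"

definition has_type ::
  "('h :: chilbert_space) bop set \<Rightarrow> (nat \<Rightarrow> 'h bop) \<Rightarrow> nat \<Rightarrow> nat \<Rightarrow> 'h bop \<Rightarrow> bool" where
  "has_type A p k l a \<longleftrightarrow> a \<in> corner A p k l \<and> a \<noteq> 0"

definition corner_state ::
  "('h :: chilbert_space bop \<Rightarrow> complex) \<Rightarrow> (nat \<Rightarrow> 'h bop) \<Rightarrow> nat \<Rightarrow> 'h bop \<Rightarrow> complex" where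
  "corner_state \<phi> p i x = \<phi> x / complex_of_real (rho \<phi> p i)"

definition cond_exp_D ::
  "('h :: chilbert_space bop \<Rightarrow> complex) \<Rightarrow> nat \<Rightarrow> (nat \<Rightarrow> 'h bop) \<Rightarrow> 'h bop \<Rightarrow> 'h bop" where
  "cond_exp_D \<phi> d p x = (\<Sum>i=1..d. op_scale (corner_state \<phi> p i (p i o\<^sub>L x o\<^sub>L p i)) (p i))"

text \<open>Words in \<open>a\<close> and \<open>a\<^sup>*\<close> are encoded as lists of Booleans, where \<^const>\<open>True\<close> stands for \<open>*\<close>.\<close>

definition op_word :: "('h :: chilbert_space) bop \<Rightarrow> bool list \<Rightarrow> 'h bop" where
  "op_word a es = foldr (\<lambda>e x. (if e then op_adj a else a) o\<^sub>L x) es id_blinfun"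

text \<open>Distribution of a self-adjoint \<open>x\<close> in a corner with unit \<open>e\<close> and state \<open>\<psi>\<close>: the compactly
  supported probability measure on the line with the moments of \<open>x\<close>. The zeroth power of \<open>x\<close>
  is the unit \<open>e\<close> of the corner.\<close>

definition has_distribution ::
  "('h :: chilbert_space bop \<Rightarrow> complex) \<Rightarrow> 'h bop \<Rightarrow> 'h bop \<Rightarrow> real measure \<Rightarrow> bool" where
  "has_distribution \<psi> e x \<mu> \<longleftrightarrow>
     prob_space \<mu> \<and> sets \<mu> = sets borel \<and>
     (\<exists>K. compact K \<and> (AE t in \<mu>. t \<in> K)) \<and>
     (\<forall>m. \<psi> (((\<lambda>y. x o\<^sub>L y) ^^ m) e) = complex_of_real (\<integral>t. t ^ m \<partial>\<mu>))"

section \<open>Block matrices\<close>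

definition qdim :: "('h :: chilbert_space bop \<Rightarrow> complex) \<Rightarrow> (nat \<Rightarrow> 'h bop) \<Rightarrow> nat \<Rightarrow> nat \<Rightarrow> nat" where
  "qdim \<phi> p n k = nat \<lfloor>rho \<phi> p k * real n\<rfloor>"

text \<open>Matrix coordinates start at 0, block numbers at 1.\<close>

definition block :: "('h :: chilbert_space bop \<Rightarrow> complex) \<Rightarrow> (nat \<Rightarrow> 'h bop) \<Rightarrow> nat \<Rightarrow> nat \<Rightarrow> nat set" where
  "block \<phi> p n k = {(\<Sum>i\<in>{1..<k}. qdim \<phi> p n i) ..< (\<Sum>i\<in>{1..k}. qdim \<phi> p n i)}"

definition proj_mat ::
  "('h :: chilbert_space bop \<Rightarrow> complex) \<Rightarrow> (nat \<Rightarrow> 'h bop) \<Rightarrow> nat \<Rightarrow> nat \<Rightarrow> complex mat" where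
  "proj_mat \<phi> p n k = Matrix.mat n n (\<lambda>(i, j). if i = j \<and> i \<in> block \<phi> p n k then 1 else 0)"

definition mat_Tr :: "complex mat \<Rightarrow> complex" where
  "mat_Tr M = (\<Sum>i<dim_row M. M $$ (i, i))"

definition cvec_norm :: "complex Matrix.vec \<Rightarrow> real" where
  "cvec_norm v = sqrt (Re (v \<bullet>c v))"

definition mat_opnorm :: "complex mat \<Rightarrow> real" where
  "mat_opnorm M = (SUP v \<in> {v \<in> carrier_vec (dim_col M). cvec_norm v \<le> 1}. cvec_norm (M *\<^sub>v v))"

definition mat_word :: "complex mat \<Rightarrow> bool list \<Rightarrow> complex mat" where
  "mat_word M es = foldr (\<lambda>e X. (if e then mat_adjoint M else M) * X) es (1\<^sub>m (dim_row M))"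

text \<open>This takes values in \<open>\<D>\<close>, hence the last factor is the projection \<open>p k\<close> of the algebra.\<close>

definition mat_cond_exp ::
  "('h :: chilbert_space bop \<Rightarrow> complex) \<Rightarrow> nat \<Rightarrow> (nat \<Rightarrow> 'h bop) \<Rightarrow> nat \<Rightarrow> complex mat \<Rightarrow> 'h bop" where
  "mat_cond_exp \<phi> d p n M =
     (\<Sum>k=1..d. op_scale (1 / of_nat (qdim \<phi> p n k) *
        mat_Tr (proj_mat \<phi> p n k * M * proj_mat \<phi> p n k)) (p k))"

definition block_mats ::
  "('h :: chilbert_space bop \<Rightarrow> complex) \<Rightarrow> (nat \<Rightarrow> 'h bop) \<Rightarrow> nat \<Rightarrow> nat \<Rightarrow> nat \<Rightarrow> complex mat set" where
  "block_mats \<phi> p n k l = (\<lambda>M. proj_mat \<phi> p n k * M * proj_mat \<phi> p n l) ` carrier_mat n n"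

text \<open>Lebesgue measure on \<^term>\<open>block_mats \<phi> p n k l\<close> for the inner product \<open>Re Tr(M\<^sup>* N)\<close>: this is the
  sum over the entries \<open>(i, j)\<close> in the block of \<open>Re (cnj M\<^sub>i\<^sub>j N\<^sub>i\<^sub>j)\<close>, the standard inner product of
  \<^typ>\<open>complex\<close> as a Euclidean space, so the measure is the product over these entries of \<^const>\<open>lborel\<close>.\<close>

definition block_volume ::
  "('h :: chilbert_space bop \<Rightarrow> complex) \<Rightarrow> (nat \<Rightarrow> 'h bop) \<Rightarrow> nat \<Rightarrow> nat \<Rightarrow> nat \<Rightarrow> complex mat set \<Rightarrow> ennreal" where
  "block_volume \<phi> p n k l S =
     (let B = block \<phi> p n k \<times> block \<phi> p n l;
          L = PiM B (\<lambda>_. lborel :: complex measure)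
      in emeasure L {f \<in> space L. Matrix.mat n n (\<lambda>ij. if ij \<in> B then f ij else 0) \<in> S})"

section \<open>Free entropy\<close>

definition microstates ::
  "('h :: chilbert_space bop \<Rightarrow> complex) \<Rightarrow> nat \<Rightarrow> (nat \<Rightarrow> 'h bop) \<Rightarrow> nat \<Rightarrow> nat \<Rightarrow> real \<Rightarrow> 'h bop
     \<Rightarrow> nat \<Rightarrow> nat \<Rightarrow> real \<Rightarrow> complex mat set" where
  "microstates \<phi> d p k l R a n r \<epsilon> =
     {M \<in> block_mats \<phi> p n k l. mat_opnorm M \<le> R \<and>
        (\<forall>es. 1 \<le> length es \<and> length es \<le> r \<longrightarrow>
           norm (mat_cond_exp \<phi> d p n (mat_word M es) - cond_exp_D \<phi> d p (op_word a es)) \<le> \<epsilon>)}"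

definition ln_ennreal :: "ennreal \<Rightarrow> ereal" where
  "ln_ennreal x = (if x = 0 then -\<infinity> else if x = \<infinity> then \<infinity> else ereal (ln (enn2real x)))"

definition free_entropy_D ::
  "('h :: chilbert_space bop \<Rightarrow> complex) \<Rightarrow> nat \<Rightarrow> (nat \<Rightarrow> 'h bop) \<Rightarrow> nat \<Rightarrow> nat \<Rightarrow> 'h bop \<Rightarrow> ereal" where
  "free_entropy_D \<phi> d p k l a =
     (SUP R\<in>{0<..}. INF r\<in>{1..}. INF \<epsilon>\<in>{0<..}.
        limsup (\<lambda>n. ereal (1 / (real n)\<^sup>2) *
            ln_ennreal (block_volume \<phi> p n k l (microstates \<phi> d p k l R a n r \<epsilon>))
          + ereal (rho \<phi> p k * rho \<phi> p l * ln (real n))))"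

definition marchenko_pastur :: "real \<Rightarrow> real measure" where
  "marchenko_pastur r = density lborel (\<lambda>x. ennreal
     (indicator {(1 - sqrt r)\<^sup>2 .. (1 + sqrt r)\<^sup>2} x * (sqrt (4 * r - (x - 1 - r)\<^sup>2) / (2 * pi * x))))"

end

theory Submission
  imports Defs "HOL-Real_Asymp.Real_Asymp"
begin

text \<open>
  The upper bound is the Gaussian trick. On a microstate the density of a complex Gaussian matrix
  with entries of variance \<open>\<tau> = s / n\<close> is almost constant, because its exponent only involves
  \<open>\<phi>\<^sub>k (a a\<^sup>*) \<le> c\<close>; so the volume of the microstates is at most the reciprocal of that density, and
  \<open>s = c / \<rho>\<^sub>l\<close> is the optimal choice. For this \<open>s\<close> the Wishart moments concentrate: Gaussian integration
  by parts gives a recursion for the expected products of traces whose large \<open>n\<close> limit is the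
  quadratic recursion of the rescaled Marchenko--Pastur moments. Hence Gaussian matrices are
  microstates of \<open>b\<close> with probability bounded below, and the upper bound is attained at \<open>b\<close>.

  For strictness, suppose that \<open>a a\<^sup>*\<close> has a different moment. Microstates of \<open>a\<close> and of \<open>b\<close> are then
  at Hilbert--Schmidt distance at least \<open>const * sqrt n\<close>, so by the parallelogram law their midpoints have
  a definitely smaller Hilbert--Schmidt norm and fill an exponentially smaller Gaussian volume.
  Brunn--Minkowski, in the form of the midpoint Prekopa--Leindler inequality, bounds the geometric mean
  of the two volumes by the volume of the midpoints, and the volume for \<open>b\<close> is maximal. This avoids
  large deviations of the eigenvalue density.
\<close>

section \<open>The midpoint Prekopa--Leindler inequality\<close>

text \<open>Taking logarithms and dividing by n^2 makes bounded factors free, so a Gaussian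
  probability of 1/2 is as good as 1. What is not free is the operator norm cutoff: the microstates
  of \<open>b\<close> must be found below one R that is independent of n, and convergence of each
  fixed moment says nothing about the largest singular value. The cutoff is therefore read off a
  trace moment whose degree grows with n, for which the moment recursion is also bounded uniformly
  in the degree (\<open>moments_growth\<close>). The opposite care shapes the strictness part: the
  deficit must not depend on R, so the separation of microstates is estimated by finitely many trace
  moments and not by norms. Microstates constrain all words in M and its adjoint; as k differs from
  l, only alternating words of even length can have a nonzero conditional expectation, and by
  traciality these carry just the moments of the element times its adjoint. Distributions are
  compared through moments as well, so a different distribution means a different moment.\<close>

lemma one_dim_sumset_halfline:
  fixes A B C :: "real set"
  assumes [measurable]: "A \<in> sets borel" "B \<in> sets borel" "C \<in> sets borel"
    and mid: "\<And>x y. x \<in> A \<Longrightarrow> y \<in> B \<Longrightarrow> (x + y) / 2 \<in> C"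
    and a: "a \<in> A" and b: "b \<in> B"
  shows "emeasure lborel (A \<inter> {..a}) + emeasure lborel (B \<inter> {b..}) \<le> 2 * emeasure lborel C"
proof -
  \<comment> \<open>These are the midpoints of b with points of A to the left of a, and of a with
    points of B to the right of b. They lie on either side of (a + b) / 2, so they overlap at most
    in that point, and passing to midpoints halves the length.\<close>
  let ?L = "(\<lambda>x. 2 * x - b) -` (A \<inter> {..a})" and ?R = "(\<lambda>x. 2 * x - a) -` (B \<inter> {b..})"
  have vim: "(\<lambda>x. 2 * x - u) -` X \<in> sets borel" if "X \<in> sets borel" for X and u :: real
    using that by (intro measurable_sets_borel[of _ borel]) auto
  have scale: "2 * emeasure lborel ((\<lambda>x. 2 * x - u) -` X) = emeasure lborel X" if [measurable]: "X \<in> sets borel" for X and u :: real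
  proof -
    have "emeasure lborel X = \<integral>\<^sup>+x. indicator X x \<partial>lborel" by simp
    also have "\<dots> = 2 * (\<integral>\<^sup>+x. indicator X (- u + 2 * x) \<partial>lborel)"
      by (subst nn_integral_real_affine[where c = 2 and t = "-u"]) auto
    also have "(\<lambda>x. indicator X (- u + 2 * x) :: ennreal) = indicator ((\<lambda>x. 2 * x - u) -` X)"
      by (auto simp: indicator_def fun_eq_iff)
    also have "(\<integral>\<^sup>+x. indicator ((\<lambda>x. 2 * x - u) -` X) x \<partial>lborel) = emeasure lborel ((\<lambda>x. 2 * x - u) -` X)"
      by (subst nn_integral_indicator) (auto intro!: vim that)
    finally show ?thesis by simp
  qed
  have [measurable]: "?L \<in> sets borel" "?R \<in> sets borel"
    by (intro vim; measurable)+
  have sub: "?L \<union> ?R \<subseteq> C"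
    using mid[OF _ b] mid[OF a] by fastforce
  have "emeasure lborel (A \<inter> {..a}) + emeasure lborel (B \<inter> {b..}) = 2 * (emeasure lborel ?L + emeasure lborel ?R)"
    by (simp only: distrib_left scale sets.Int assms(1,2) atMost_borel atLeast_borel)
  also have "emeasure lborel ?L = emeasure lborel (?L - {(a+b)/2})"
    by (subst emeasure_Diff_null_set) (auto simp: finite_imp_null_set_lborel)
  also have "emeasure lborel (?L - {(a+b)/2}) + emeasure lborel ?R = emeasure lborel ((?L - {(a+b)/2}) \<union> ?R)"
    by (rule plus_emeasure) (auto simp: field_simps)
  also have "\<dots> \<le> emeasure lborel C"
    using sub by (intro emeasure_mono) auto
  finally show ?thesis by (simp add: mult_left_mono)
qed

text \<open>If A has a largest element, one half-line already contains A. Otherwise every point of A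
  lies below a rational that is itself below a point of A; the running maxima \<open>g\<close> of an
  enumeration of these rationals turn the countable cover into an increasing one, so that continuity
  from below applies.\<close>

lemma exhaust_halflines:
  fixes A :: "real set"
  assumes [measurable]: "A \<in> sets borel" and "A \<noteq> {}"
    and bd: "\<And>a. a \<in> A \<Longrightarrow> emeasure lborel (A \<inter> {..a}) \<le> K"
  shows "emeasure lborel A \<le> K"
proof (cases "\<exists>m\<in>A. \<forall>x\<in>A. x \<le> m")
  case True
  then obtain m where "m \<in> A" "\<forall>x\<in>A. x \<le> m" by blast
  then have "A \<inter> {..m} = A" by auto
  with bd[OF \<open>m \<in> A\<close>] show ?thesis by simp
next
  case False
  let ?U = "{q \<in> \<rat>. \<exists>x\<in>A. q \<le> x}"
  have cov: "A = (\<Union>q\<in>?U. A \<inter> {..q})"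
  proof -
    { fix x assume x: "x \<in> A"
      with False obtain y where "y \<in> A" "x < y" by force
      then obtain q where "q \<in> \<rat>" "x < q" "q < y" using Rats_dense_in_real by blast
      with \<open>y \<in> A\<close> have "q \<in> ?U" "x \<le> q" by (auto intro!: bexI[of _ y])
      with x have "x \<in> (\<Union>q\<in>?U. A \<inter> {..q})" by blast }
    then show ?thesis by blast
  qed
  have cU: "countable ?U" using countable_rat by (rule countable_subset[rotated]) auto
  from \<open>A \<noteq> {}\<close> cov have "?U \<noteq> {}" by blast
  define e where "e = from_nat_into ?U"
  have eU: "e i \<in> ?U" for i unfolding e_def using from_nat_into[OF \<open>?U \<noteq> {}\<close>] by blast
  define g where "g n = (MAX i\<in>{..n}. e i)" for n :: nat
  have gU: "g n \<in> ?U" for n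
  proof -
    have "g n \<in> e ` {..n}" unfolding g_def by (intro Max_in) auto
    then obtain i where "g n = e i" by auto
    with eU[of i] show ?thesis by simp
  qed
  have inc: "incseq (\<lambda>n. A \<inter> {..g n})"
  proof (rule incseq_SucI)
    fix n
    have "g n \<le> g (Suc n)" unfolding g_def by (intro Max_mono) auto
    then show "A \<inter> {..g n} \<subseteq> A \<inter> {..g (Suc n)}" by auto
  qed
  have "A = (\<Union>n. A \<inter> {..g n})"
  proof -
    have "x \<in> (\<Union>n. A \<inter> {..g n})" if x: "x \<in> A" for x
    proof -
      from x cov obtain q where q: "q \<in> ?U" "x \<le> q" by blast
      from q(1) obtain n where "e n = q" unfolding e_def using from_nat_into_surj[OF cU] by blast
      then have "q \<le> g n" unfolding g_def by (intro Max_ge) auto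
      with q x show ?thesis by (auto intro!: exI[of _ n])
    qed
    then show ?thesis by blast
  qed
  then have "emeasure lborel A = emeasure lborel (\<Union>n. A \<inter> {..g n})" by simp
  also have "\<dots> = (SUP n. emeasure lborel (A \<inter> {..g n}))"
    by (rule SUP_emeasure_incseq[symmetric]) (use inc in auto)
  also have "\<dots> \<le> K"
  proof (rule SUP_least)
    fix n
    from gU[of n] obtain x where "x \<in> A" "g n \<le> x" by blast
    then have "emeasure lborel (A \<inter> {..g n}) \<le> emeasure lborel (A \<inter> {..x})"
      by (intro emeasure_mono) auto
    also have "\<dots> \<le> K" using bd \<open>x \<in> A\<close> .
    finally show "emeasure lborel (A \<inter> {..g n}) \<le> K" .
  qed
  finally show ?thesis .
qed

lemma exhaust_halflines_add:
  fixes A :: "real set"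
  assumes [measurable]: "A \<in> sets borel" and ne: "A \<noteq> {}"
    and bd: "\<And>a. a \<in> A \<Longrightarrow> emeasure lborel (A \<inter> {..a}) + w \<le> K"
  shows "emeasure lborel A + w \<le> K"
proof -
  from ne obtain a where a: "a \<in> A" by blast
  have wK: "w \<le> K" using order_trans[OF _ bd[OF a], of w] by simp
  have "emeasure lborel (A \<inter> {..a}) \<le> K - w" if "a \<in> A" for a
    using bd[OF that] by (cases "w = \<infinity>") (auto simp: ennreal_le_minus_iff)
  then have "emeasure lborel A \<le> K - w" by (rule exhaust_halflines[OF assms(1) ne])
  then have "emeasure lborel A + w \<le> K - w + w" by (rule add_right_mono)
  with wK show ?thesis by (simp add: diff_add_cancel_ennreal)
qed

text \<open>Reflecting B turns its upper half-lines into lower ones, so the same exhaustion serves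
  both sets: first B' is exhausted with a point of A fixed, then A. Without nonemptiness there would
  be no midpoints and the claim would fail.\<close>

lemma one_dim_brunn_minkowski:
  fixes A B C :: "real set"
  assumes [measurable]: "A \<in> sets borel" "B \<in> sets borel" "C \<in> sets borel"
    and mid: "\<And>x y. x \<in> A \<Longrightarrow> y \<in> B \<Longrightarrow> (x + y) / 2 \<in> C"
    and neA: "A \<noteq> {}" and neB: "B \<noteq> {}"
  shows "emeasure lborel A + emeasure lborel B \<le> 2 * emeasure lborel C"
proof -
  have uB: "emeasure lborel (uminus -` X) = emeasure lborel X" if [measurable]: "X \<in> sets borel" for X :: "real set"
    by (subst (2) lborel_distr_uminus[symmetric], subst emeasure_distr) auto
  define B' where "B' = uminus -` B"
  have B'm[measurable]: "B' \<in> sets borel" unfolding B'_def using measurable_sets_borel[of uminus borel B] by measurable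
  obtain y where "y \<in> B" using neB by blast
  then have "-y \<in> B'" by (simp add: B'_def)
  then have B': "B' \<noteq> {}" by blast
  have half: "emeasure lborel (A \<inter> {..a}) + emeasure lborel (B' \<inter> {..b}) \<le> 2 * emeasure lborel C" if "a \<in> A" "b \<in> B'" for a b
  proof -
    have "B' \<inter> {..b} = uminus -` (B \<inter> {-b..})" by (auto simp: B'_def)
    then show ?thesis
      using one_dim_sumset_halfline[OF assms(1-4), of a "-b"] that uB[of "B \<inter> {-b..}"] by (simp add: B'_def del: vimage_Int)
  qed
  have "emeasure lborel (A \<inter> {..a}) + emeasure lborel B' \<le> 2 * emeasure lborel C" if "a \<in> A" for a
    using exhaust_halflines_add[OF B'm B', of "emeasure lborel (A \<inter> {..a})"] half[OF that]
    by (simp add: add.commute)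
  from exhaust_halflines_add[OF assms(1) neA this] show ?thesis
    by (simp add: B'_def uB)
qed

text \<open>Tonelli on the region under the graph. The levels are cut at the bound \<open>a\<close>
  so that functions with different suprema can be rescaled to the common level interval from 0 to
  1.\<close>

lemma layer_cake_nn:
  assumes "sigma_finite_measure M" and [measurable]: "f \<in> borel_measurable M"
    and f0: "\<And>x. x \<in> space M \<Longrightarrow> f x \<le> ennreal a" and "a \<ge> 0"
  shows "(\<integral>\<^sup>+x. f x \<partial>M) = (\<integral>\<^sup>+t. emeasure M {x \<in> space M. ennreal t < f x} * indicator {0<..<a} t \<partial>lborel)"
proof -
  interpret M: sigma_finite_measure M by fact
  interpret P: pair_sigma_finite M lborel ..
  have "(\<integral>\<^sup>+x. f x \<partial>M) = (\<integral>\<^sup>+x. (\<integral>\<^sup>+t. indicator {t. 0 < t \<and> t < a \<and> ennreal t < f x} t \<partial>lborel) \<partial>M)"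
  proof (rule nn_integral_cong)
    fix x assume x: "x \<in> space M"
    from f0[OF x] obtain r where r: "f x = ennreal r" "0 \<le> r" "r \<le> a" using \<open>a \<ge> 0\<close>
      by (cases "f x") (auto simp: top_unique)
    have "{t. 0 < t \<and> t < a \<and> ennreal t < f x} = {0<..<r}"
      using r by (auto simp: ennreal_less_iff)
    then have "(\<integral>\<^sup>+t. indicator {t. 0 < t \<and> t < a \<and> ennreal t < f x} t \<partial>lborel) = emeasure lborel {0<..<r}" by simp
    then show "f x = (\<integral>\<^sup>+t. indicator {t. 0 < t \<and> t < a \<and> ennreal t < f x} t \<partial>lborel)"
      using r by simp
  qed
  also have "\<dots> = (\<integral>\<^sup>+x. (\<integral>\<^sup>+t. indicator {p \<in> space (M \<Otimes>\<^sub>M lborel). 0 < snd p \<and> snd p < a \<and> ennreal (snd p) < f (fst p)} (x, t) \<partial>lborel) \<partial>M)"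
    by (intro nn_integral_cong) (auto simp: indicator_def space_pair_measure)
  also have "\<dots> = (\<integral>\<^sup>+t. (\<integral>\<^sup>+x. indicator {p \<in> space (M \<Otimes>\<^sub>M lborel). 0 < snd p \<and> snd p < a \<and> ennreal (snd p) < f (fst p)} (x, t) \<partial>M) \<partial>lborel)"
    by (rule P.Fubini'[symmetric]) simp
  also have "\<dots> = (\<integral>\<^sup>+t. emeasure M {x \<in> space M. ennreal t < f x} * indicator {0<..<a} t \<partial>lborel)"
  proof (rule nn_integral_cong)
    fix t :: real
    have "(\<integral>\<^sup>+x. indicator {p \<in> space (M \<Otimes>\<^sub>M lborel). 0 < snd p \<and> snd p < a \<and> ennreal (snd p) < f (fst p)} (x, t) \<partial>M)
      = (\<integral>\<^sup>+x. indicator {x \<in> space M. ennreal t < f x} x * indicator {0<..<a} t \<partial>M)"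
      by (intro nn_integral_cong) (auto simp: indicator_def space_pair_measure)
    also have "\<dots> = emeasure M {x \<in> space M. ennreal t < f x} * indicator {0<..<a} t"
      by (subst nn_integral_multc) auto
    finally show "(\<integral>\<^sup>+x. indicator {p \<in> space (M \<Otimes>\<^sub>M lborel). 0 < snd p \<and> snd p < a \<and> ennreal (snd p) < f (fst p)} (x, t) \<partial>M)
      = emeasure M {x \<in> space M. ennreal t < f x} * indicator {0<..<a} t" .
  qed
  finally show ?thesis .
qed

text \<open>The squared form avoids square roots of extended reals. Measure and midpoint map are
  parameters because the property is transported to products and to image measures.\<close>

definition midpoint_PL :: "'a measure \<Rightarrow> ('a \<Rightarrow> 'a \<Rightarrow> 'a) \<Rightarrow> bool" where
  "midpoint_PL M mid \<longleftrightarrow> (\<forall>f g h. f \<in> borel_measurable M \<longrightarrow> g \<in> borel_measurable M \<longrightarrow> h \<in> borel_measurable M \<longrightarrow>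
     (\<forall>x\<in>space M. \<forall>y\<in>space M. f x * g y \<le> (h (mid x y))\<^sup>2) \<longrightarrow>
     (\<integral>\<^sup>+x. f x \<partial>M) * (\<integral>\<^sup>+x. g x \<partial>M) \<le> (\<integral>\<^sup>+x. h x \<partial>M :: ennreal)\<^sup>2)"

lemma nn_integral_layer_scaled:
  fixes f :: "real \<Rightarrow> ennreal"
  assumes [measurable]: "f \<in> borel_measurable borel" and f: "\<And>x. f x \<le> ennreal a" and "a > 0"
  shows "(\<integral>\<^sup>+x. f x \<partial>lborel) = ennreal a * (\<integral>\<^sup>+t. emeasure lborel {x. ennreal (a * t) < f x} * indicator {0<..<1} t \<partial>lborel)"
proof -
  have [measurable]: "(\<lambda>t. emeasure lborel {x. ennreal t < f x}) \<in> borel_measurable borel"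
    using lborel.measurable_emeasure_Pair[of "{p \<in> space (lborel \<Otimes>\<^sub>M lborel). ennreal (fst p) < f (snd p)}" lborel]
    by (simp add: vimage_def space_pair_measure)
  have "(\<integral>\<^sup>+x. f x \<partial>lborel) = (\<integral>\<^sup>+t. emeasure lborel {x. ennreal t < f x} * indicator {0<..<a} t \<partial>lborel)"
    using layer_cake_nn[OF lborel.sigma_finite_measure_axioms, of f a] assms by simp
  also have "\<dots> = ennreal a * (\<integral>\<^sup>+t. emeasure lborel {x. ennreal (0 + a * t) < f x} * indicator {0<..<a} (0 + a * t) \<partial>lborel)"
    using \<open>a > 0\<close> by (subst nn_integral_real_affine[where c = a and t = 0]) auto
  also have "(\<lambda>t. indicator {0<..<a} (0 + a * t) :: ennreal) = indicator {0<..<1}"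
    using \<open>a > 0\<close> by (auto simp: indicator_def fun_eq_iff zero_less_mult_iff)
  finally show ?thesis by simp
qed

lemma ennreal_amgm: "4 * (u * v) \<le> (u + v)\<^sup>2" for u v :: ennreal
proof (cases u; cases v)
  fix a b assume [simp]: "u = ennreal a" "v = ennreal b" "0 \<le> a" "0 \<le> b"
  have "4 * (a * b) \<le> (a + b)\<^sup>2" using sum_squares_bound[of a b] by (simp add: power2_eq_square algebra_simps)
  then have "ennreal (4 * (a * b)) \<le> ennreal ((a + b)\<^sup>2)" by (rule ennreal_leI)
  moreover have "ennreal (4 * (a * b)) = 4 * (ennreal a * ennreal b)" by (simp add: ennreal_mult)
  moreover have "ennreal ((a + b)\<^sup>2) = (ennreal a + ennreal b)\<^sup>2" by (simp flip: ennreal_power ennreal_plus)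
  ultimately show ?thesis by simp
qed (auto simp: power2_eq_square ennreal_mult_top ennreal_top_mult)

lemma ennreal_mult_strict_mono: "a * b < c * d" if "a < c" "b < d" for a b c d :: ennreal
proof -
  have "a * b \<le> a * d" using that by (intro mult_left_mono) auto
  have "0 < c" "0 < d" using that by (auto intro: order_le_less_trans[OF zero_le])
  show ?thesis
  proof (cases "d = \<infinity>")
    case True
    have "a * b < \<infinity>" using order_less_le_trans[OF that(1) top_greatest] order_less_le_trans[OF that(2) top_greatest]
      by (simp add: ennreal_mult_less_top)
    then show ?thesis using True \<open>0 < c\<close> by (simp add: ennreal_mult_top)
  next
    case False
    then have "a * d < c * d" using that \<open>0 < d\<close> by (intro ennreal_mult_strict_right_mono) (auto simp: less_top)
    with \<open>a * b \<le> a * d\<close> show ?thesis by simp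
  qed
qed

text \<open>Levels are measured as fractions t of the suprema. For t < 1 the superlevel sets of f
  and g are nonempty, because a and b are the exact suprema, so the one-dimensional inequality
  applies level by level; the arithmetic-geometric mean inequality then turns the sum of the two
  integrals into their product.\<close>

lemma bounded_PL_real:
  fixes f g h :: "real \<Rightarrow> ennreal"
  assumes [measurable]: "f \<in> borel_measurable borel" "g \<in> borel_measurable borel" "h \<in> borel_measurable borel"
    and fa: "(SUP x. f x) = ennreal a" and ga: "(SUP x. g x) = ennreal b" and ab: "a > 0" "b > 0"
    and mid: "\<And>x y. f x * g y \<le> (h ((x + y) / 2))\<^sup>2"
  shows "(\<integral>\<^sup>+x. f x \<partial>lborel) * (\<integral>\<^sup>+x. g x \<partial>lborel) \<le> (\<integral>\<^sup>+x. h x \<partial>lborel)\<^sup>2"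
proof -
  define c where "c = sqrt (a * b)"
  have c: "c > 0" "c * c = a * b" using ab by (auto simp: c_def)
  \<comment> \<open>h may be unbounded. Truncation at the geometric mean of the two suprema gives it
    the same range of levels, and no midpoint is lost, since \<open>c * t < c\<close> for every
    level t < 1.\<close>
  define h' where "h' x = min (h x) (ennreal c)" for x
  have [measurable]: "h' \<in> borel_measurable borel" unfolding h'_def by measurable
  let ?F = "\<lambda>t. emeasure lborel {x. ennreal (a * t) < f x} * indicator {0<..<1} t"
  let ?G = "\<lambda>t. emeasure lborel {x. ennreal (b * t) < g x} * indicator {0<..<1} t"
  let ?H = "\<lambda>t. emeasure lborel {x. ennreal (c * t) < h' x} * indicator {0<..<1} t"
  have meas: "(\<lambda>t. emeasure lborel {x. ennreal (u * t) < w x}) \<in> borel_measurable borel"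
    if [measurable]: "w \<in> borel_measurable borel" for u and w :: "real \<Rightarrow> ennreal"
    using lborel.measurable_emeasure_Pair[of "{p \<in> space (lborel \<Otimes>\<^sub>M lborel). ennreal (u * fst p) < w (snd p)}" lborel]
    by (simp add: vimage_def space_pair_measure)
  have [measurable]: "?F \<in> borel_measurable borel" "?G \<in> borel_measurable borel" "?H \<in> borel_measurable borel"
    using meas[of f a] meas[of g b] meas[of h' c] by measurable
  have le: "f x \<le> ennreal a" "g x \<le> ennreal b" "h' x \<le> ennreal c" for x
    using fa[symmetric] ga[symmetric] by (auto simp: h'_def intro: SUP_upper)
  have "?F t + ?G t \<le> 2 * ?H t" for t
  proof (cases "t \<in> {0<..<1}")
    case True
    then have t: "0 < t" "t < 1" by auto
    have "ennreal (a * t) < (SUP x. f x)" unfolding fa using t ab by (simp add: ennreal_less_iff)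
    then have ne1: "{x. ennreal (a * t) < f x} \<noteq> {}" by (auto simp: less_SUP_iff)
    have "ennreal (b * t) < (SUP x. g x)" unfolding ga using t ab by (simp add: ennreal_less_iff)
    then have ne2: "{x. ennreal (b * t) < g x} \<noteq> {}" by (auto simp: less_SUP_iff)
    have "emeasure lborel {x. ennreal (a * t) < f x} + emeasure lborel {x. ennreal (b * t) < g x}
       \<le> 2 * emeasure lborel {x. ennreal (c * t) < h' x}"
    proof (rule one_dim_brunn_minkowski[OF _ _ _ _ ne1 ne2])
      fix x y assume "x \<in> {x. ennreal (a * t) < f x}" "y \<in> {x. ennreal (b * t) < g x}"
      then have xy: "ennreal (a * t) < f x" "ennreal (b * t) < g y" by auto
      have "ennreal (c * t) < h ((x + y) / 2)"
      proof (rule ccontr)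
        assume "\<not> ennreal (c * t) < h ((x + y) / 2)"
        then have "(h ((x + y) / 2))\<^sup>2 \<le> (ennreal (c * t))\<^sup>2" by (intro power_mono) auto
        also have "\<dots> = ennreal (a * t) * ennreal (b * t)"
          using c t ab by (simp add: ennreal_power ennreal_mult[symmetric] power2_eq_square mult_ac)
        also have "\<dots> < f x * g y"
          using xy by (rule ennreal_mult_strict_mono)
        also have "\<dots> \<le> (h ((x + y) / 2))\<^sup>2" by (rule mid)
        finally show False by simp
      qed
      then show "(x + y) / 2 \<in> {x. ennreal (c * t) < h' x}"
        using c t by (auto simp: h'_def ennreal_less_iff)
    qed measurable
    then show ?thesis using True by (simp add: indicator_def)
  qed auto
  then have "(\<integral>\<^sup>+t. ?F t + ?G t \<partial>lborel) \<le> (\<integral>\<^sup>+t. 2 * ?H t \<partial>lborel)"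
    by (intro nn_integral_mono)
  then have *: "(\<integral>\<^sup>+t. ?F t \<partial>lborel) + (\<integral>\<^sup>+t. ?G t \<partial>lborel) \<le> 2 * (\<integral>\<^sup>+t. ?H t \<partial>lborel)"
    by (simp add: nn_integral_add nn_integral_cmult)
  define u v w where "u = (\<integral>\<^sup>+t. ?F t \<partial>lborel)" and "v = (\<integral>\<^sup>+t. ?G t \<partial>lborel)" and "w = (\<integral>\<^sup>+t. ?H t \<partial>lborel)"
  have "4 * (u * v) \<le> (u + v)\<^sup>2" by (rule ennreal_amgm)
  also have "\<dots> \<le> (2 * w)\<^sup>2" using * by (intro power_mono) (auto simp: u_def v_def w_def)
  also have "\<dots> = 4 * w\<^sup>2" by (simp add: power_mult_distrib)
  finally have uvw: "u * v \<le> w\<^sup>2" by (simp add: ennreal_mult_le_mult_iff)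
  have "(\<integral>\<^sup>+x. f x \<partial>lborel) * (\<integral>\<^sup>+x. g x \<partial>lborel) = (ennreal a * ennreal b) * (u * v)"
    using nn_integral_layer_scaled[of f a] nn_integral_layer_scaled[of g b] ab by (simp add: le u_def v_def mult_ac)
  also have "\<dots> \<le> (ennreal a * ennreal b) * w\<^sup>2" using uvw by (intro mult_left_mono) auto
  also have "\<dots> = (ennreal c * w)\<^sup>2"
    using c ab by (simp add: power_mult_distrib ennreal_power power2_eq_square ennreal_mult[symmetric] mult_ac)
  also have "ennreal c * w = (\<integral>\<^sup>+x. h' x \<partial>lborel)"
    using c by (subst nn_integral_layer_scaled[where a = c]) (auto simp: le w_def)
  also have "(\<integral>\<^sup>+x. h' x \<partial>lborel)\<^sup>2 \<le> (\<integral>\<^sup>+x. h x \<partial>lborel)\<^sup>2"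
    by (intro power_mono nn_integral_mono) (auto simp: h'_def)
  finally show ?thesis .
qed

lemma nn_integral_truncate:
  assumes [measurable]: "f \<in> borel_measurable M"
  shows "(\<integral>\<^sup>+x. f x \<partial>M) = (SUP n. \<integral>\<^sup>+x. min (f x) (of_nat n) \<partial>M)"
proof -
  have "f x = (SUP n. min (f x) (of_nat n))" for x
  proof (cases "f x = \<infinity>")
    case True then show ?thesis by (simp add: ennreal_SUP_of_nat_eq_top)
  next
    case False
    then obtain n where "f x < of_nat n" using ennreal_Ex_less_of_nat[of "f x"] by (auto simp: less_top)
    then have "f x \<le> min (f x) (of_nat n)" by simp
    also have "\<dots> \<le> (SUP n. min (f x) (of_nat n))" by (rule SUP_upper) simp
    finally show ?thesis by (intro antisym SUP_least) auto
  qed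
  then have "(\<integral>\<^sup>+x. f x \<partial>M) = (\<integral>\<^sup>+x. (SUP n. min (f x) (of_nat n)) \<partial>M)" by simp
  also have "\<dots> = (SUP n. \<integral>\<^sup>+x. min (f x) (of_nat n) \<partial>M)"
    by (rule nn_integral_monotone_convergence_SUP) (auto simp: incseq_def le_fun_def intro: min.coboundedI2)
  finally show ?thesis .
qed

text \<open>f and g are truncated at independent integer heights, which makes the suprema finite,
  and monotone convergence removes the truncation from both factors.\<close>

lemma midpoint_PL_real: "midpoint_PL (lborel :: real measure) (\<lambda>x y. (x + y) / 2)"
  unfolding midpoint_PL_def
proof (intro allI impI)
  fix f g h :: "real \<Rightarrow> ennreal"
  assume "f \<in> borel_measurable lborel" "g \<in> borel_measurable lborel" "h \<in> borel_measurable lborel"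
  then have [measurable]: "f \<in> borel_measurable borel" "g \<in> borel_measurable borel" "h \<in> borel_measurable borel" by auto
  assume mid: "\<forall>x\<in>space lborel. \<forall>y\<in>space lborel. f x * g y \<le> (h ((x + y) / 2))\<^sup>2"
  have *: "(\<integral>\<^sup>+x. min (f x) (of_nat m) \<partial>lborel) * (\<integral>\<^sup>+x. min (g x) (of_nat n) \<partial>lborel) \<le> (\<integral>\<^sup>+x. h x \<partial>lborel)\<^sup>2" for m n
  proof -
    define F where "F x = min (f x) (of_nat m)" for x
    define G where "G x = min (g x) (of_nat n)" for x
    have [measurable]: "F \<in> borel_measurable borel" "G \<in> borel_measurable borel" unfolding F_def G_def by measurable
    have ub: "(SUP x. F x) \<le> of_nat m" "(SUP x. G x) \<le> of_nat n" by (auto intro!: SUP_least simp: F_def G_def)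
    have fin: "(SUP x. F x) \<noteq> \<infinity>" "(SUP x. G x) \<noteq> \<infinity>"
      using order_le_less_trans[OF ub(1) of_nat_less_top] order_le_less_trans[OF ub(2) of_nat_less_top] by (simp_all only: less_top infinity_ennreal_def)
    show ?thesis
    \<comment> \<open>Rescaling by a supremum needs it to be positive; a vanishing supremum makes
      one of the integrals zero.\<close>
    proof (cases "(SUP x. F x) = 0 \<or> (SUP x. G x) = 0")
      case True
      then have "(\<forall>x. F x = 0) \<or> (\<forall>x. G x = 0)"
        by (metis SUP_upper UNIV_I le_zero_eq)
      then show ?thesis unfolding F_def[symmetric] G_def[symmetric] by auto
    next
      case False
      obtain a where a: "(SUP x. F x) = ennreal a" "a \<ge> 0" using fin(1) by (cases "SUP x. F x") auto
      obtain b where b: "(SUP x. G x) = ennreal b" "b \<ge> 0" using fin(2) by (cases "SUP x. G x") auto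
      have "F x * G y \<le> (h ((x + y) / 2))\<^sup>2" for x y
      proof -
        have "F x * G y \<le> f x * g y" by (intro mult_mono) (auto simp: F_def G_def)
        then show ?thesis using mid by (force intro: order_trans)
      qed
      from bounded_PL_real[OF _ _ _ a(1) b(1) _ _ this] False a b show ?thesis
        unfolding F_def[symmetric] G_def[symmetric] by auto
    qed
  qed
  show "(\<integral>\<^sup>+x. f x \<partial>lborel) * (\<integral>\<^sup>+x. g x \<partial>lborel) \<le> (\<integral>\<^sup>+x. h x \<partial>lborel)\<^sup>2"
    by (subst (1 2) nn_integral_truncate)
       (auto simp: SUP_mult_left_ennreal SUP_mult_right_ennreal intro!: SUP_least *)
qed

lemma midpoint_PL_D:
  assumes "midpoint_PL M mid" "f \<in> borel_measurable M" "g \<in> borel_measurable M" "h \<in> borel_measurable M"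
    "\<And>x y. x \<in> space M \<Longrightarrow> y \<in> space M \<Longrightarrow> f x * g y \<le> (h (mid x y))\<^sup>2"
  shows "(\<integral>\<^sup>+x. f x \<partial>M) * (\<integral>\<^sup>+x. g x \<partial>M) \<le> (\<integral>\<^sup>+x. h x \<partial>M :: ennreal)\<^sup>2"
  using assms unfolding midpoint_PL_def by blast

text \<open>Tensorization: for fixed first coordinates the slices satisfy the hypothesis on N, and
  the conclusion on N is exactly the hypothesis on M for the partial integrals.\<close>

lemma midpoint_PL_pair:
  assumes "sigma_finite_measure M" "sigma_finite_measure N"
    and 1: "midpoint_PL M m1" and 2: "midpoint_PL N m2"
    and sp: "\<And>x y. x \<in> space M \<Longrightarrow> y \<in> space M \<Longrightarrow> m1 x y \<in> space M"
  shows "midpoint_PL (M \<Otimes>\<^sub>M N) (\<lambda>x y. (m1 (fst x) (fst y), m2 (snd x) (snd y)))"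
  unfolding midpoint_PL_def
proof (intro allI impI)
  interpret N: sigma_finite_measure N by fact
  fix f g h :: "'a \<times> 'b \<Rightarrow> ennreal"
  assume m[measurable]: "f \<in> borel_measurable (M \<Otimes>\<^sub>M N)" "g \<in> borel_measurable (M \<Otimes>\<^sub>M N)" "h \<in> borel_measurable (M \<Otimes>\<^sub>M N)"
    and mid: "\<forall>x\<in>space (M \<Otimes>\<^sub>M N). \<forall>y\<in>space (M \<Otimes>\<^sub>M N). f x * g y \<le> (h (m1 (fst x) (fst y), m2 (snd x) (snd y)))\<^sup>2"
  show "(\<integral>\<^sup>+x. f x \<partial>(M \<Otimes>\<^sub>M N)) * (\<integral>\<^sup>+x. g x \<partial>(M \<Otimes>\<^sub>M N)) \<le> (\<integral>\<^sup>+x. h x \<partial>(M \<Otimes>\<^sub>M N))\<^sup>2"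
    unfolding N.nn_integral_fst[OF m(1), symmetric] N.nn_integral_fst[OF m(2), symmetric] N.nn_integral_fst[OF m(3), symmetric]
  proof (rule midpoint_PL_D[OF 1])
    fix x y assume "x \<in> space M" "y \<in> space M"
    then show "(\<integral>\<^sup>+z. f (x, z) \<partial>N) * (\<integral>\<^sup>+z. g (y, z) \<partial>N) \<le> (\<integral>\<^sup>+z. h (m1 x y, z) \<partial>N)\<^sup>2"
      using mid sp by (intro midpoint_PL_D[OF 2]) (auto simp: space_pair_measure)
  qed measurable
qed

lemma midpoint_PL_distr:
  assumes PL: "midpoint_PL M m1" and T[measurable]: "T \<in> measurable M N" 
    and hom: "\<And>x y. x \<in> space M \<Longrightarrow> y \<in> space M \<Longrightarrow> T (m1 x y) = m2 (T x) (T y)"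
  shows "midpoint_PL (distr M N T) m2"
  unfolding midpoint_PL_def
proof (intro allI impI)
  fix f g h :: "'b \<Rightarrow> ennreal"
  assume "f \<in> borel_measurable (distr M N T)" "g \<in> borel_measurable (distr M N T)" "h \<in> borel_measurable (distr M N T)"
  then have [measurable]: "f \<in> borel_measurable N" "g \<in> borel_measurable N" "h \<in> borel_measurable N" by auto
  assume mid: "\<forall>x\<in>space (distr M N T). \<forall>y\<in>space (distr M N T). f x * g y \<le> (h (m2 x y))\<^sup>2"
  show "(\<integral>\<^sup>+x. f x \<partial>(distr M N T)) * (\<integral>\<^sup>+x. g x \<partial>(distr M N T)) \<le> (\<integral>\<^sup>+x. h x \<partial>(distr M N T))\<^sup>2"
    using mid measurable_space[OF T]
    by (simp add: nn_integral_distr) (rule midpoint_PL_D[OF PL], auto simp: hom)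
qed

lemma measurable_Complex [measurable]: "(\<lambda>(x, y). Complex x y) \<in> borel_measurable (lborel \<Otimes>\<^sub>M lborel)"
  unfolding Complex_eq case_prod_beta by measurable

lemma lborel_complex: "(lborel :: complex measure) = distr (lborel \<Otimes>\<^sub>M lborel) borel (\<lambda>(x, y). Complex x y)"
proof (rule lborel_eqI)
  fix l u :: complex assume lu: "\<And>b. b \<in> Basis \<Longrightarrow> l \<bullet> b \<le> u \<bullet> b"
  then have l: "Re l \<le> Re u" "Im l \<le> Im u" using lu[of 1] lu[of \<i>] by (auto simp: Basis_complex_def inner_complex_def)
  have "emeasure (distr (lborel \<Otimes>\<^sub>M lborel) borel (\<lambda>(x, y). Complex x y)) (box l u)
     = emeasure (lborel \<Otimes>\<^sub>M lborel) ({Re l<..<Re u} \<times> {Im l<..<Im u})"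
    by (subst emeasure_distr) (auto intro!: arg_cong[where f = "emeasure _"] simp: space_pair_measure in_box_complex_iff)
  also have "\<dots> = ennreal ((Re u - Re l) * (Im u - Im l))"
    using l by (subst lborel.emeasure_pair_measure_Times) (auto simp: ennreal_mult)
  finally show "emeasure (distr (lborel \<Otimes>\<^sub>M lborel) borel (\<lambda>(x, y). Complex x y)) (box l u) = ennreal (\<Prod>b\<in>Basis. (u - l) \<bullet> b)"
    by (simp add: Basis_complex_def inner_complex_def)
qed simp

lemma midpoint_PL_complex: "midpoint_PL (lborel :: complex measure) (\<lambda>x y. (x + y) / 2)"
proof -
  show ?thesis
    unfolding lborel_complex
    by (rule midpoint_PL_distr[OF midpoint_PL_pair[OF lborel.sigma_finite_measure_axioms lborel.sigma_finite_measure_axioms midpoint_PL_real midpoint_PL_real]])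
       (auto simp: complex_eq_iff)
qed

text \<open>The slicing argument for pairs, repeated coordinate by coordinate. The midpoint is
  restricted to the index set because elements of a product space must be extensional.\<close>

lemma midpoint_PL_PiM:
  fixes M :: "'a measure" and I :: "'i set"
  assumes "finite I" and PL: "midpoint_PL M m1" and sf: "sigma_finite_measure M"
    and sp: "\<And>x y. x \<in> space M \<Longrightarrow> y \<in> space M \<Longrightarrow> m1 x y \<in> space M"
  shows "midpoint_PL (PiM I (\<lambda>_. M)) (\<lambda>x y. \<lambda>i\<in>I. m1 (x i) (y i))"
  using \<open>finite I\<close>
proof (induction I rule: finite_induct)
  case empty
  show ?case
    using sf by (auto simp: midpoint_PL_def product_sigma_finite.nn_integral_empty product_sigma_finite_def space_PiM restrict_def)
next
  case (insert i I)
  interpret product_sigma_finite "\<lambda>_. M" by (simp add: product_sigma_finite_def sf)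
  show ?case
    unfolding midpoint_PL_def
  proof (intro allI impI)
    fix f g h :: "('i \<Rightarrow> 'a) \<Rightarrow> ennreal"
    let ?P = "PiM (insert i I) (\<lambda>_. M)"
    assume m[measurable]: "f \<in> borel_measurable ?P" "g \<in> borel_measurable ?P" "h \<in> borel_measurable ?P"
      and mid: "\<forall>x\<in>space ?P. \<forall>y\<in>space ?P. f x * g y \<le> (h (\<lambda>j\<in>insert i I. m1 (x j) (y j)))\<^sup>2"
    show "(\<integral>\<^sup>+x. f x \<partial>?P) * (\<integral>\<^sup>+x. g x \<partial>?P) \<le> (\<integral>\<^sup>+x. h x \<partial>?P)\<^sup>2"
      unfolding product_nn_integral_insert[OF insert(1,2) m(1)] product_nn_integral_insert[OF insert(1,2) m(2)]
         product_nn_integral_insert[OF insert(1,2) m(3)]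
    proof (rule midpoint_PL_D[OF insert.IH])
      fix x y assume xy: "x \<in> space (PiM I (\<lambda>_. M))" "y \<in> space (PiM I (\<lambda>_. M))"
      have [measurable]: "(\<lambda>z. x(i := z)) \<in> measurable M ?P" if "x \<in> space (PiM I (\<lambda>_. M))" for x
        using that by (intro measurable_fun_upd[where J = I]) auto
      have [simp]: "(\<lambda>j\<in>I. m1 (x j) (y j)) \<in> space (PiM I (\<lambda>_. M))"
        using xy sp by (auto simp: space_PiM PiE_iff)
      show "(\<integral>\<^sup>+z. f (x(i := z)) \<partial>M) * (\<integral>\<^sup>+z. g (y(i := z)) \<partial>M) \<le> (\<integral>\<^sup>+z. h ((\<lambda>j\<in>I. m1 (x j) (y j))(i := z)) \<partial>M)\<^sup>2"
      proof (rule midpoint_PL_D[OF PL])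
        fix z w assume zw: "z \<in> space M" "w \<in> space M"
        have "f (x(i := z)) * g (y(i := w)) \<le> (h (\<lambda>j\<in>insert i I. m1 ((x(i := z)) j) ((y(i := w)) j)))\<^sup>2"
          using xy zw by (intro mid[rule_format]) (auto simp: space_PiM PiE_iff extensional_def)
        also have "(\<lambda>j\<in>insert i I. m1 ((x(i := z)) j) ((y(i := w)) j)) = (\<lambda>j\<in>I. m1 (x j) (y j))(i := m1 z w)"
          using insert(2) by (auto simp: fun_eq_iff restrict_def)
        finally show "f (x(i := z)) * g (y(i := w)) \<le> (h ((\<lambda>j\<in>I. m1 (x j) (y j))(i := m1 z w)))\<^sup>2" .
      qed (use xy in measurable)
    qed measurable
  qed
qed

text \<open>Prekopa-Leindler for indicator functions. This multiplicative form carries no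
  dimension-dependent exponent, which is what survives logarithms divided by n^2.\<close>

theorem brunn_minkowski_complex_PiM:
  fixes I :: "'i set"
  assumes "finite I" and [measurable]: "A \<in> sets (PiM I (\<lambda>_. lborel :: complex measure))" "B \<in> sets (PiM I (\<lambda>_. lborel :: complex measure))" "C \<in> sets (PiM I (\<lambda>_. lborel :: complex measure))"
    and mid: "\<And>x y. x \<in> A \<Longrightarrow> y \<in> B \<Longrightarrow> (\<lambda>i\<in>I. (x i + y i) / 2) \<in> C"
  shows "emeasure (PiM I (\<lambda>_. lborel :: complex measure)) A * emeasure (PiM I (\<lambda>_. lborel :: complex measure)) B
     \<le> (emeasure (PiM I (\<lambda>_. lborel :: complex measure)) C)\<^sup>2"
proof -
  have "(\<integral>\<^sup>+x. indicator A x \<partial>PiM I (\<lambda>_. lborel :: complex measure)) * (\<integral>\<^sup>+x. indicator B x \<partial>PiM I (\<lambda>_. lborel :: complex measure))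
     \<le> (\<integral>\<^sup>+x. indicator C x \<partial>PiM I (\<lambda>_. lborel :: complex measure))\<^sup>2"
    by (rule midpoint_PL_D[OF midpoint_PL_PiM[OF assms(1) midpoint_PL_complex lborel.sigma_finite_measure_axioms]])
       (use mid in \<open>auto simp: indicator_def\<close>)
  then show ?thesis by simp
qed

section \<open>Integration by parts for complex Gaussians\<close>

definition ngauss :: "real \<Rightarrow> real measure" where
  "ngauss \<sigma> = density lborel (\<lambda>x. ennreal (normal_density 0 \<sigma> x))"

text \<open>Normalized so that |z|^2 has mean \<tau>; the real and the imaginary part then have
  variance \<tau>/2 each.\<close>

definition cgauss :: "real \<Rightarrow> complex measure" where
  "cgauss \<tau> = density lborel (\<lambda>z. ennreal (exp (- (cmod z)\<^sup>2 / \<tau>) / (pi * \<tau>)))"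

lemma sets_cgauss [simp, measurable_cong]: "sets (cgauss \<tau>) = sets borel"
  and space_cgauss [simp]: "space (cgauss \<tau>) = UNIV"
  and sets_ngauss [simp, measurable_cong]: "sets (ngauss \<sigma>) = sets borel"
  and space_ngauss [simp]: "space (ngauss \<sigma>) = UNIV"
  by (auto simp: cgauss_def ngauss_def)

lemma prob_space_ngauss: "\<sigma> > 0 \<Longrightarrow> prob_space (ngauss \<sigma>)"
  unfolding ngauss_def by (rule prob_space_normal_density)

lemma cgauss_eq_distr:
  assumes "\<tau> > 0"
  defines "\<sigma> \<equiv> sqrt (\<tau> / 2)"
  shows "cgauss \<tau> = distr (ngauss \<sigma> \<Otimes>\<^sub>M ngauss \<sigma>) borel (\<lambda>(x, y). Complex x y)"
proof -
  have \<sigma>: "\<sigma> > 0" "2 * \<sigma>\<^sup>2 = \<tau>" using assms by auto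
  interpret N: prob_space "ngauss \<sigma>" using \<sigma> by (simp add: prob_space_ngauss)
  have "cgauss \<tau> = distr (density (lborel \<Otimes>\<^sub>M lborel) (\<lambda>p. ennreal (exp (- (cmod (case p of (x, y) \<Rightarrow> Complex x y))\<^sup>2 / \<tau>) / (pi * \<tau>)))) borel (\<lambda>(x, y). Complex x y)"
    unfolding cgauss_def lborel_complex by (subst density_distr) auto
  also have "(\<lambda>p. ennreal (exp (- (cmod (case p of (x, y) \<Rightarrow> Complex x y))\<^sup>2 / \<tau>) / (pi * \<tau>)))
      = (\<lambda>(x, y). ennreal (normal_density 0 \<sigma> x) * ennreal (normal_density 0 \<sigma> y))"
  proof -
    have "exp (- (x\<^sup>2 + y\<^sup>2) / \<tau>) / (pi * \<tau>) = normal_density 0 \<sigma> x * normal_density 0 \<sigma> y" for x y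
    proof -
      have "sqrt (pi * \<tau>) * sqrt (pi * \<tau>) = pi * \<tau>" using \<open>\<tau> > 0\<close> by simp
      then show ?thesis
        unfolding normal_density_def mult.assoc[symmetric] using \<open>\<tau> > 0\<close> \<sigma>(2)
        by (simp add: mult.commute[of 2 pi] mult.assoc exp_add[symmetric] add_divide_distrib diff_divide_distrib)
    qed
    then show ?thesis by (auto simp: fun_eq_iff cmod_def ennreal_mult[symmetric])
  qed
  also have "density (lborel \<Otimes>\<^sub>M lborel) (\<lambda>(x, y). ennreal (normal_density 0 \<sigma> x) * ennreal (normal_density 0 \<sigma> y)) = ngauss \<sigma> \<Otimes>\<^sub>M ngauss \<sigma>"
    unfolding ngauss_def using N.sigma_finite_measure_axioms
    by (intro pair_measure_density[symmetric]) (auto simp: ngauss_def lborel.sigma_finite_measure_axioms)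
  finally show ?thesis .
qed

lemma prob_space_cgauss: assumes "\<tau> > 0" shows "prob_space (cgauss \<tau>)"
proof -
  interpret N: prob_space "ngauss (sqrt (\<tau> / 2))" using assms by (simp add: prob_space_ngauss)
  interpret P: pair_prob_space "ngauss (sqrt (\<tau> / 2))" "ngauss (sqrt (\<tau> / 2))" ..
  show ?thesis unfolding cgauss_eq_distr[OF assms]
    by (rule P.prob_space_distr) (simp add: Complex_eq case_prod_beta)
qed

lemma integrable_ngauss_abs_power: "\<sigma> > 0 \<Longrightarrow> integrable (ngauss \<sigma>) (\<lambda>x. \<bar>x\<bar> ^ k)"
  unfolding ngauss_def using integrable_normal_moment_abs[of \<sigma> 0 k]
  by (subst integrable_density) auto

lemma integrable_ngauss_one_plus_abs_power: "\<sigma> > 0 \<Longrightarrow> integrable (ngauss \<sigma>) (\<lambda>x. (1 + \<bar>x\<bar>) ^ k)"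
  unfolding binomial_ring by (intro Bochner_Integration.integrable_sum) (auto intro!: integrable_mult_right integrable_ngauss_abs_power)

lemma integrable_ngauss_poly:
  fixes P :: "complex poly"
  assumes "\<sigma> > 0" shows "integrable (ngauss \<sigma>) (\<lambda>x. of_real x ^ m * poly P (of_real x))"
proof -
  have "integrable (ngauss \<sigma>) (\<lambda>x. complex_of_real x ^ k)" for k
  proof (rule Bochner_Integration.integrable_bound[OF integrable_ngauss_abs_power[OF assms, of k]])
    show "AE x in ngauss \<sigma>. norm (complex_of_real x ^ k) \<le> norm (\<bar>x\<bar> ^ k)" by (simp add: norm_power)
  qed simp
  then show ?thesis
    unfolding poly_altdef sum_distrib_left mult.left_commute[of "of_real _ ^ m"] power_add[symmetric]
    by (intro Bochner_Integration.integrable_sum integrable_mult_right)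
qed

text \<open>Read off the explicit even and odd moments. For n = 0 the truncated exponent n - 1 does
  no harm because its coefficient is 0.\<close>

lemma ngauss_moment_rec:
  assumes "\<sigma> > 0"
  shows "(\<integral>x. x ^ Suc n \<partial>ngauss \<sigma>) = \<sigma>\<^sup>2 * real n * (\<integral>x. x ^ (n - 1) \<partial>ngauss \<sigma>)"
proof -
  have 1: "(\<integral>x. x ^ k \<partial>ngauss \<sigma>) = (\<integral>x. normal_density 0 \<sigma> x * x ^ k \<partial>lborel)" for k
    unfolding ngauss_def by (subst integral_density) auto
  consider k where "n = 2 * k" | k where "n = 2 * k + 1" by (metis oddE evenE)
  then show ?thesis
  proof cases
    case 1
    show ?thesis
    proof (cases k)
      case 0
      then show ?thesis unfolding \<open>\<And>k. (\<integral>x. x ^ k \<partial>ngauss \<sigma>) = _\<close> using integral_normal_moment_odd[OF assms, of 0 0] 1 by simp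
    next
      case (Suc j)
      have "n - 1 = 2 * j + 1" "Suc n = 2 * k + 1" using 1 Suc by auto
      then show ?thesis unfolding \<open>\<And>k. (\<integral>x. x ^ k \<partial>ngauss \<sigma>) = _\<close> 
        using integral_normal_moment_odd[OF assms, of 0 k] integral_normal_moment_odd[OF assms, of 0 j] by simp
    qed
  next
    case 2
    then have e: "Suc n = 2 * Suc k" "n - 1 = 2 * k" by auto
    have "fact (2 * Suc k) / ((2 / \<sigma>\<^sup>2) ^ Suc k * fact (Suc k)) = \<sigma>\<^sup>2 * real n * (fact (2 * k) / ((2 / \<sigma>\<^sup>2) ^ k * fact k))"
    proof -
      have f1: "fact (2 * Suc k) = (2 * real k + 2) * (2 * real k + 1) * fact (2 * k)" by (simp add: algebra_simps)
      have f2: "fact (Suc k) = (real k + 1) * fact k" by simp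
      have n: "real n = 2 * real k + 1" using 2 by simp
      have nz: "(2 / \<sigma>\<^sup>2) ^ k \<noteq> 0" "fact k \<noteq> (0::real)" "real k + 1 \<noteq> 0" using assms by auto
      show ?thesis unfolding f1 f2 n power_Suc using nz assms by (simp add: divide_simps) (simp add: algebra_simps)?
    qed
    then show ?thesis unfolding e \<open>\<And>k. (\<integral>x. x ^ k \<partial>ngauss \<sigma>) = _\<close>
      using integral_normal_moment_even[OF assms, of 0 "Suc k"] integral_normal_moment_even[OF assms, of 0 k] by simp
  qed
qed

text \<open>Integration by parts is obtained algebraically from the moment recursion. Since
  \<open>pCons a P\<close> is a + X P, the induction on the coefficients raises the power of x,
  which is why a free factor x^m is carried along.\<close>

lemma ngauss_ibp_aux:
  fixes P :: "complex poly"
  assumes "\<sigma> > 0"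
  shows "(\<integral>x. of_real x ^ Suc m * poly P (of_real x) \<partial>ngauss \<sigma>) =
    of_real (\<sigma>\<^sup>2) * (\<integral>x. of_nat m * (of_real x ^ (m - 1) * poly P (of_real x)) + of_real x ^ m * poly (pderiv P) (of_real x) \<partial>ngauss \<sigma>)"
proof (induction P arbitrary: m)
  case 0 show ?case by simp
next
  case (pCons a P)
  note int[simp] = integrable_ngauss_poly[OF assms]
  have pw: "integrable (ngauss \<sigma>) (\<lambda>x. complex_of_real x ^ k)" for k using int[of k 1] by simp
  have mom: "(\<integral>x. complex_of_real x ^ Suc n \<partial>ngauss \<sigma>) = of_real (\<sigma>\<^sup>2) * of_nat n * (\<integral>x. of_real x ^ (n - 1) \<partial>ngauss \<sigma>)" for n
    unfolding of_real_power[symmetric] integral_complex_of_real ngauss_moment_rec[OF assms] by simp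
  have "(\<integral>x. of_real x ^ Suc m * poly (pCons a P) (of_real x) \<partial>ngauss \<sigma>)
      = (\<integral>x. a * of_real x ^ Suc m + of_real x ^ Suc (Suc m) * poly P (of_real x) \<partial>ngauss \<sigma>)"
    by (simp add: algebra_simps)
  also have "\<dots> = a * (\<integral>x. of_real x ^ Suc m \<partial>ngauss \<sigma>) + (\<integral>x. of_real x ^ Suc (Suc m) * poly P (of_real x) \<partial>ngauss \<sigma>)"
    unfolding Bochner_Integration.integral_add[OF integrable_mult_right[OF pw] int] integral_mult_right_zero ..
  also have "\<dots> = of_real (\<sigma>\<^sup>2) * ((\<integral>x. (a * of_nat m) * of_real x ^ (m - 1) \<partial>ngauss \<sigma>) +
      (\<integral>x. of_nat (Suc m) * (of_real x ^ (Suc m - 1) * poly P (of_real x)) + of_real x ^ Suc m * poly (pderiv P) (of_real x) \<partial>ngauss \<sigma>))"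
    unfolding mom pCons.IH by (simp add: algebra_simps)
  also have "(\<integral>x. (a * of_nat m) * of_real x ^ (m - 1) \<partial>ngauss \<sigma>) +
      (\<integral>x. of_nat (Suc m) * (of_real x ^ (Suc m - 1) * poly P (of_real x)) + of_real x ^ Suc m * poly (pderiv P) (of_real x) \<partial>ngauss \<sigma>)
     = (\<integral>x. (a * of_nat m) * of_real x ^ (m - 1) + (of_nat (Suc m) * (of_real x ^ (Suc m - 1) * poly P (of_real x)) + of_real x ^ Suc m * poly (pderiv P) (of_real x)) \<partial>ngauss \<sigma>)"
    by (rule Bochner_Integration.integral_add[symmetric, OF integrable_mult_right[OF pw] Bochner_Integration.integrable_add[OF integrable_mult_right[OF int] int]])
  also have "\<dots> = (\<integral>x. of_nat m * (of_real x ^ (m - 1) * poly (pCons a P) (of_real x)) + of_real x ^ m * poly (pderiv (pCons a P)) (of_real x) \<partial>ngauss \<sigma>)"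
    by (rule Bochner_Integration.integral_cong[OF refl]) (cases m; simp add: pderiv_pCons algebra_simps)
  finally show ?case .
qed

lemma ngauss_ibp:
  fixes P :: "complex poly"
  assumes "\<sigma> > 0"
  shows "(\<integral>x. of_real x * poly P (of_real x) \<partial>ngauss \<sigma>) = of_real (\<sigma>\<^sup>2) * (\<integral>x. poly (pderiv P) (of_real x) \<partial>ngauss \<sigma>)"
  using ngauss_ibp_aux[OF assms, of 0 P] by simp

text \<open>A class that is stable under sums and products and integrable against every Gaussian, so
  that integrability never has to be checked for a particular integrand.\<close>

definition poly_growth :: "(complex \<Rightarrow> complex) \<Rightarrow> bool" where
  "poly_growth F \<longleftrightarrow> F \<in> borel_measurable borel \<and> (\<exists>C k. \<forall>z. cmod (F z) \<le> C * (1 + cmod z) ^ k)"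

lemma poly_growth_const [simp]: "poly_growth (\<lambda>_. c)"
  unfolding poly_growth_def by (auto intro!: exI[of _ "cmod c"] exI[of _ "0::nat"])

lemma poly_growth_id [simp]: "poly_growth (\<lambda>z. z)"
  unfolding poly_growth_def by (auto intro!: exI[of _ "1::real"] exI[of _ "1::nat"])

lemma measurable_cnj [measurable]: "cnj \<in> borel_measurable borel"
  by (intro borel_measurable_continuous_onI continuous_intros)

lemma poly_growth_cnj [simp]: "poly_growth cnj"
  unfolding poly_growth_def by (auto intro!: exI[of _ "1::real"] exI[of _ "1::nat"])

lemma poly_growth_mult: assumes "poly_growth F" "poly_growth G" shows "poly_growth (\<lambda>z. F z * G z)"
proof -
  obtain C k D l where "\<forall>z. cmod (F z) \<le> C * (1 + cmod z) ^ k" "\<forall>z. cmod (G z) \<le> D * (1 + cmod z) ^ l"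
    using assms unfolding poly_growth_def by blast
  then have "cmod (F z * G z) \<le> (C * D) * (1 + cmod z) ^ (k + l)" for z
    using mult_mono'[of "cmod (F z)" "C * (1 + cmod z) ^ k" "cmod (G z)" "D * (1 + cmod z) ^ l"]
    by (simp add: norm_mult power_add mult_ac)
  with assms show ?thesis unfolding poly_growth_def by (auto intro!: exI[of _ "C * D"] exI[of _ "k + l"])
qed

lemma poly_growth_add: assumes "poly_growth F" "poly_growth G" shows "poly_growth (\<lambda>z. F z + G z)"
proof -
  obtain C k D l where *: "\<forall>z. cmod (F z) \<le> C * (1 + cmod z) ^ k" "\<forall>z. cmod (G z) \<le> D * (1 + cmod z) ^ l"
    using assms unfolding poly_growth_def by blast
  have "cmod (F z + G z) \<le> (\<bar>C\<bar> + \<bar>D\<bar>) * (1 + cmod z) ^ (k + l)" for z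
  proof -
    have "(1 + cmod z) ^ k \<le> (1 + cmod z) ^ (k + l)" "(1 + cmod z) ^ l \<le> (1 + cmod z) ^ (k + l)"
      by (auto intro!: power_increasing)
    then have "C * (1 + cmod z) ^ k \<le> \<bar>C\<bar> * (1 + cmod z) ^ (k + l)" "D * (1 + cmod z) ^ l \<le> \<bar>D\<bar> * (1 + cmod z) ^ (k + l)"
      by (auto intro!: mult_mono)
    with *[rule_format, of z] show ?thesis by (auto intro!: order_trans[OF norm_triangle_ineq] simp: algebra_simps)
  qed
  with assms show ?thesis unfolding poly_growth_def by (auto intro!: exI[of _ "\<bar>C\<bar> + \<bar>D\<bar>"] exI[of _ "k + l"])
qed

lemma poly_growth_integrable_pair:
  assumes "\<sigma> > 0" and "poly_growth F"
  shows "integrable (ngauss \<sigma> \<Otimes>\<^sub>M ngauss \<sigma>) (\<lambda>p. F (case p of (x, y) \<Rightarrow> Complex x y))"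
proof -
  interpret N: prob_space "ngauss \<sigma>" using assms by (simp add: prob_space_ngauss)
  interpret P: pair_prob_space "ngauss \<sigma>" "ngauss \<sigma>" ..
  from assms obtain C k where Fm[measurable]: "F \<in> borel_measurable borel" and b: "\<And>z. cmod (F z) \<le> C * (1 + cmod z) ^ k"
    unfolding poly_growth_def by blast
  have [measurable]: "(\<lambda>(x, y). Complex x y) \<in> borel_measurable (ngauss \<sigma> \<Otimes>\<^sub>M ngauss \<sigma>)"
    unfolding Complex_eq case_prod_beta by measurable
  have "integrable (ngauss \<sigma> \<Otimes>\<^sub>M ngauss \<sigma>) (\<lambda>p. \<bar>C\<bar> * ((1 + \<bar>fst p\<bar>) ^ k * (1 + \<bar>snd p\<bar>) ^ k))"
    using integrable_ngauss_one_plus_abs_power[OF assms(1), of k]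
    by (intro integrable_mult_right P.Fubini_integrable) (auto simp: norm_mult abs_mult case_prod_beta)
  then show ?thesis
  proof (rule Bochner_Integration.integrable_bound)
    show "AE p in ngauss \<sigma> \<Otimes>\<^sub>M ngauss \<sigma>. cmod (F (case p of (x, y) \<Rightarrow> Complex x y)) \<le> norm (\<bar>C\<bar> * ((1 + \<bar>fst p\<bar>) ^ k * (1 + \<bar>snd p\<bar>) ^ k))"
    proof (rule AE_I2)
      fix p :: "real \<times> real"
      obtain x y where p: "p = (x, y)" by (cases p)
      have "cmod (Complex x y) \<le> \<bar>x\<bar> + \<bar>y\<bar>" using cmod_le[of "Complex x y"] by simp
      moreover have "0 \<le> \<bar>x\<bar> * \<bar>y\<bar>" by simp
      ultimately have "1 + cmod (Complex x y) \<le> (1 + \<bar>x\<bar>) * (1 + \<bar>y\<bar>)" unfolding distrib_left distrib_right by linarith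
      then have "(1 + cmod (Complex x y)) ^ k \<le> (1 + \<bar>x\<bar>) ^ k * (1 + \<bar>y\<bar>) ^ k"
        unfolding power_mult_distrib[symmetric] by (intro power_mono) auto
      then have "\<bar>C\<bar> * (1 + cmod (Complex x y)) ^ k \<le> \<bar>C\<bar> * ((1 + \<bar>x\<bar>) ^ k * (1 + \<bar>y\<bar>) ^ k)" by (intro mult_left_mono) auto
      moreover have "C * (1 + cmod (Complex x y)) ^ k \<le> \<bar>C\<bar> * (1 + cmod (Complex x y)) ^ k" by (intro mult_right_mono) auto
      ultimately have "cmod (F (Complex x y)) \<le> \<bar>C\<bar> * ((1 + \<bar>x\<bar>) ^ k * (1 + \<bar>y\<bar>) ^ k)" using b[of "Complex x y"] by linarith
      then show "cmod (F (case p of (x, y) \<Rightarrow> Complex x y)) \<le> norm (\<bar>C\<bar> * ((1 + \<bar>fst p\<bar>) ^ k * (1 + \<bar>snd p\<bar>) ^ k))" by (simp add: p)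
    qed
  qed measurable
qed

lemma integrable_cgauss: assumes "\<tau> > 0" "poly_growth F" shows "integrable (cgauss \<tau>) F"
proof -
  have [measurable]: "(\<lambda>(x, y). Complex x y) \<in> borel_measurable (ngauss \<sigma> \<Otimes>\<^sub>M ngauss \<sigma>)" for \<sigma>
    unfolding Complex_eq case_prod_beta by measurable
  have [measurable]: "F \<in> borel_measurable borel" using assms by (simp add: poly_growth_def)
  show ?thesis
    unfolding cgauss_eq_distr[OF assms(1)]
    by (subst integrable_distr_eq) (use poly_growth_integrable_pair[OF _ assms(2)] assms(1) in auto)
qed

text \<open>G' is the Wirtinger derivative of G with respect to the conjugate variable, (Gx + i Gy)
  / 2. Demanding polynomials on every horizontal and vertical line is what lets the real integration
  by parts be used one variable at a time.\<close>

definition dbar1 :: "(complex \<Rightarrow> complex) \<Rightarrow> (complex \<Rightarrow> complex) \<Rightarrow> bool" where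
  "dbar1 G G' \<longleftrightarrow> (\<exists>Gx Gy. poly_growth G \<and> poly_growth Gx \<and> poly_growth Gy \<and> G' = (\<lambda>z. (Gx z + \<i> * Gy z) / 2) \<and>
     (\<forall>y. \<exists>P. \<forall>x. G (Complex x y) = poly P (of_real x) \<and> Gx (Complex x y) = poly (pderiv P) (of_real x)) \<and>
     (\<forall>x. \<exists>P. \<forall>y. G (Complex x y) = poly P (of_real y) \<and> Gy (Complex x y) = poly (pderiv P) (of_real y)))"

lemma dbar1E:
  assumes "dbar1 G G'"
  obtains Gx Gy where "poly_growth G" "poly_growth Gx" "poly_growth Gy" "G' = (\<lambda>z. (Gx z + \<i> * Gy z) / 2)"
     "\<forall>y. \<exists>P. \<forall>x. G (Complex x y) = poly P (of_real x) \<and> Gx (Complex x y) = poly (pderiv P) (of_real x)"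
     "\<forall>x. \<exists>P. \<forall>y. G (Complex x y) = poly P (of_real y) \<and> Gy (Complex x y) = poly (pderiv P) (of_real y)"
proof -
  from assms obtain Gx Gy where "poly_growth G \<and> poly_growth Gx \<and> poly_growth Gy \<and> G' = (\<lambda>z. (Gx z + \<i> * Gy z) / 2) \<and>
     (\<forall>y. \<exists>P. \<forall>x. G (Complex x y) = poly P (of_real x) \<and> Gx (Complex x y) = poly (pderiv P) (of_real x)) \<and>
     (\<forall>x. \<exists>P. \<forall>y. G (Complex x y) = poly P (of_real y) \<and> Gy (Complex x y) = poly (pderiv P) (of_real y))"
    unfolding dbar1_def by (elim exE)
  then show thesis by (elim conjE) (rule that)
qed

lemma dbar1_const: "dbar1 (\<lambda>_. c) (\<lambda>_. 0)"
  unfolding dbar1_def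
  by (rule exI[of _ "\<lambda>_. 0"], rule exI[of _ "\<lambda>_. 0"]) (auto intro!: exI[of _ "[:c:]"])

lemma dbar1_id: "dbar1 (\<lambda>z. z) (\<lambda>_. 0)"
  unfolding dbar1_def
proof (rule exI[of _ "\<lambda>_. 1"], rule exI[of _ "\<lambda>_. \<i>"], intro conjI allI)
  show "\<exists>P. \<forall>x. Complex x y = poly P (complex_of_real x) \<and> 1 = poly (pderiv P) (complex_of_real x)" for y
    by (rule exI[of _ "[:\<i> * of_real y, 1:]"]) (auto simp: pderiv_pCons Complex_eq)
  show "\<exists>P. \<forall>y. Complex x y = poly P (complex_of_real y) \<and> \<i> = poly (pderiv P) (complex_of_real y)" for x
    by (rule exI[of _ "[:of_real x, \<i>:]"]) (auto simp: pderiv_pCons Complex_eq)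
qed auto

lemma dbar1_cnj: "dbar1 cnj (\<lambda>_. 1)"
  unfolding dbar1_def
proof (rule exI[of _ "\<lambda>_. 1"], rule exI[of _ "\<lambda>_. -\<i>"], intro conjI allI)
  show "\<exists>P. \<forall>x. cnj (Complex x y) = poly P (complex_of_real x) \<and> 1 = poly (pderiv P) (complex_of_real x)" for y
    by (rule exI[of _ "[:- \<i> * of_real y, 1:]"]) (auto simp: pderiv_pCons complex_eq_iff)
  show "\<exists>P. \<forall>y. cnj (Complex x y) = poly P (complex_of_real y) \<and> -\<i> = poly (pderiv P) (complex_of_real y)" for x
    by (rule exI[of _ "[:of_real x, -\<i>:]"]) (auto simp: pderiv_pCons complex_eq_iff)
qed auto

lemma dbar1_add: assumes "dbar1 F F'" "dbar1 G G'" shows "dbar1 (\<lambda>z. F z + G z) (\<lambda>z. F' z + G' z)"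
proof -
  from assms(1) obtain Fx Fy where F: "poly_growth F" "poly_growth Fx" "poly_growth Fy" "F' = (\<lambda>z. (Fx z + \<i> * Fy z) / 2)"
     "\<forall>y. \<exists>P. \<forall>x. F (Complex x y) = poly P (of_real x) \<and> Fx (Complex x y) = poly (pderiv P) (of_real x)"
     "\<forall>x. \<exists>P. \<forall>y. F (Complex x y) = poly P (of_real y) \<and> Fy (Complex x y) = poly (pderiv P) (of_real y)"
    by (rule dbar1E)
  from assms(2) obtain Gx Gy where G: "poly_growth G" "poly_growth Gx" "poly_growth Gy" "G' = (\<lambda>z. (Gx z + \<i> * Gy z) / 2)"
     "\<forall>y. \<exists>P. \<forall>x. G (Complex x y) = poly P (of_real x) \<and> Gx (Complex x y) = poly (pderiv P) (of_real x)"
     "\<forall>x. \<exists>P. \<forall>y. G (Complex x y) = poly P (of_real y) \<and> Gy (Complex x y) = poly (pderiv P) (of_real y)"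
    by (rule dbar1E)
  show ?thesis
    unfolding dbar1_def
  proof (rule exI[of _ "\<lambda>z. Fx z + Gx z"], rule exI[of _ "\<lambda>z. Fy z + Gy z"], intro conjI allI)
    fix t
    from F(5)[rule_format, of t] G(5)[rule_format, of t] obtain P Q where
      "\<forall>x. F (Complex x t) = poly P (of_real x) \<and> Fx (Complex x t) = poly (pderiv P) (of_real x)"
      "\<forall>x. G (Complex x t) = poly Q (of_real x) \<and> Gx (Complex x t) = poly (pderiv Q) (of_real x)" by blast
    then show "\<exists>P. \<forall>x. F (Complex x t) + G (Complex x t) = poly P (of_real x) \<and> Fx (Complex x t) + Gx (Complex x t) = poly (pderiv P) (of_real x)"
      by (intro exI[of _ "P + Q"]) (simp add: pderiv_add)
    from F(6)[rule_format, of t] G(6)[rule_format, of t] obtain P Q where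
      "\<forall>x. F (Complex t x) = poly P (of_real x) \<and> Fy (Complex t x) = poly (pderiv P) (of_real x)"
      "\<forall>x. G (Complex t x) = poly Q (of_real x) \<and> Gy (Complex t x) = poly (pderiv Q) (of_real x)" by blast
    then show "\<exists>P. \<forall>x. F (Complex t x) + G (Complex t x) = poly P (of_real x) \<and> Fy (Complex t x) + Gy (Complex t x) = poly (pderiv P) (of_real x)"
      by (intro exI[of _ "P + Q"]) (simp add: pderiv_add)
    show "(\<lambda>z. F' z + G' z) = (\<lambda>z. (Fx z + Gx z + \<i> * (Fy z + Gy z)) / 2)"
      by (auto simp: F(4) G(4) algebra_simps add_divide_distrib)
  qed (intro poly_growth_add F(1-3) G(1-3))+
qed

lemma dbar1_mult: assumes "dbar1 F F'" "dbar1 G G'" shows "dbar1 (\<lambda>z. F z * G z) (\<lambda>z. F' z * G z + F z * G' z)"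
proof -
  from assms(1) obtain Fx Fy where F: "poly_growth F" "poly_growth Fx" "poly_growth Fy" "F' = (\<lambda>z. (Fx z + \<i> * Fy z) / 2)"
     "\<forall>y. \<exists>P. \<forall>x. F (Complex x y) = poly P (of_real x) \<and> Fx (Complex x y) = poly (pderiv P) (of_real x)"
     "\<forall>x. \<exists>P. \<forall>y. F (Complex x y) = poly P (of_real y) \<and> Fy (Complex x y) = poly (pderiv P) (of_real y)"
    by (rule dbar1E)
  from assms(2) obtain Gx Gy where G: "poly_growth G" "poly_growth Gx" "poly_growth Gy" "G' = (\<lambda>z. (Gx z + \<i> * Gy z) / 2)"
     "\<forall>y. \<exists>P. \<forall>x. G (Complex x y) = poly P (of_real x) \<and> Gx (Complex x y) = poly (pderiv P) (of_real x)"
     "\<forall>x. \<exists>P. \<forall>y. G (Complex x y) = poly P (of_real y) \<and> Gy (Complex x y) = poly (pderiv P) (of_real y)"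
    by (rule dbar1E)
  show ?thesis
    unfolding dbar1_def
  proof (rule exI[of _ "\<lambda>z. Fx z * G z + F z * Gx z"], rule exI[of _ "\<lambda>z. Fy z * G z + F z * Gy z"], intro conjI allI)
    fix t
    from F(5)[rule_format, of t] G(5)[rule_format, of t] obtain P Q where
      "\<forall>x. F (Complex x t) = poly P (of_real x) \<and> Fx (Complex x t) = poly (pderiv P) (of_real x)"
      "\<forall>x. G (Complex x t) = poly Q (of_real x) \<and> Gx (Complex x t) = poly (pderiv Q) (of_real x)" by blast
    then show "\<exists>P. \<forall>x. F (Complex x t) * G (Complex x t) = poly P (of_real x) \<and> Fx (Complex x t) * G (Complex x t) + F (Complex x t) * Gx (Complex x t) = poly (pderiv P) (of_real x)"
      by (intro exI[of _ "P * Q"]) (simp add: pderiv_mult algebra_simps)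
    from F(6)[rule_format, of t] G(6)[rule_format, of t] obtain P Q where
      "\<forall>x. F (Complex t x) = poly P (of_real x) \<and> Fy (Complex t x) = poly (pderiv P) (of_real x)"
      "\<forall>x. G (Complex t x) = poly Q (of_real x) \<and> Gy (Complex t x) = poly (pderiv Q) (of_real x)" by blast
    then show "\<exists>P. \<forall>x. F (Complex t x) * G (Complex t x) = poly P (of_real x) \<and> Fy (Complex t x) * G (Complex t x) + F (Complex t x) * Gy (Complex t x) = poly (pderiv P) (of_real x)"
      by (intro exI[of _ "P * Q"]) (simp add: pderiv_mult algebra_simps)
    show "(\<lambda>z. F' z * G z + F z * G' z) = (\<lambda>z. (Fx z * G z + F z * Gx z + \<i> * (Fy z * G z + F z * Gy z)) / 2)"
      by (auto simp: F(4) G(4) algebra_simps add_divide_distrib)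
  qed (intro poly_growth_add poly_growth_mult F(1-3) G(1-3))+
qed

text \<open>Fubini separates the real and the imaginary part, each a real Gaussian of variance
  \<tau>/2. The factor z = Re z + i Im z combines the two partial derivatives into Gx + i Gy, which
  is twice the conjugate derivative; hence only conjugated variables are differentiated
  below.\<close>

lemma cgauss_ibp:
  assumes \<tau>: "\<tau> > 0" and "dbar1 G G'"
  shows "(\<integral>z. z * G z \<partial>cgauss \<tau>) = of_real \<tau> * (\<integral>z. G' z \<partial>cgauss \<tau>)"
proof -
  define \<sigma> where "\<sigma> = sqrt (\<tau> / 2)"
  have \<sigma>: "\<sigma> > 0" "\<sigma>\<^sup>2 = \<tau> / 2" using assms by (auto simp: \<sigma>_def)
  interpret N: prob_space "ngauss \<sigma>" using \<sigma> by (simp add: prob_space_ngauss)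
  interpret P: pair_prob_space "ngauss \<sigma>" "ngauss \<sigma>" ..
  from assms(2) obtain Gx Gy where G: "poly_growth G" "poly_growth Gx" "poly_growth Gy" "G' = (\<lambda>z. (Gx z + \<i> * Gy z) / 2)"
     "\<forall>y. \<exists>P. \<forall>x. G (Complex x y) = poly P (of_real x) \<and> Gx (Complex x y) = poly (pderiv P) (of_real x)"
     "\<forall>x. \<exists>P. \<forall>y. G (Complex x y) = poly P (of_real y) \<and> Gy (Complex x y) = poly (pderiv P) (of_real y)"
    by (rule dbar1E)
  let ?C = "\<lambda>p. case p of (x, y) \<Rightarrow> Complex x y"
  have mC[measurable]: "?C \<in> borel_measurable (ngauss \<sigma> \<Otimes>\<^sub>M ngauss \<sigma>)"
    unfolding Complex_eq case_prod_beta by measurable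
  have E: "(\<integral>z. F z \<partial>cgauss \<tau>) = (\<integral>p. F (?C p) \<partial>(ngauss \<sigma> \<Otimes>\<^sub>M ngauss \<sigma>))" if "poly_growth F" for F
    unfolding cgauss_eq_distr[OF \<tau>] \<sigma>_def[symmetric] using that
    by (intro integral_distr) (auto simp: poly_growth_def)
  have gRe: "poly_growth (\<lambda>z. of_real (Re z))"
    unfolding poly_growth_def by (auto intro!: exI[of _ "1::real"] exI[of _ "1::nat"] simp: abs_Re_le_cmod add_increasing)
  have gIm: "poly_growth (\<lambda>z. of_real (Im z))"
    unfolding poly_growth_def by (auto intro!: exI[of _ "1::real"] exI[of _ "1::nat"] simp: abs_Im_le_cmod add_increasing)
  note int = integrable_cgauss[OF \<tau>]
  note intP = poly_growth_integrable_pair[OF \<sigma>(1)]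
  have 1: "(\<integral>z. of_real (Re z) * G z \<partial>cgauss \<tau>) = of_real (\<tau> / 2) * (\<integral>z. Gx z \<partial>cgauss \<tau>)"
  proof -
    have "(\<integral>z. of_real (Re z) * G z \<partial>cgauss \<tau>) = (\<integral>y. (\<integral>x. of_real x * G (Complex x y) \<partial>ngauss \<sigma>) \<partial>ngauss \<sigma>)"
      using P.integral_snd[of "\<lambda>x y. of_real x * G (Complex x y)"] intP[OF poly_growth_mult[OF gRe G(1)]]
      by (simp add: E[OF poly_growth_mult[OF gRe G(1)]] case_prod_unfold)
    also have "(\<lambda>y. \<integral>x. of_real x * G (Complex x y) \<partial>ngauss \<sigma>) = (\<lambda>y. of_real (\<tau> / 2) * (\<integral>x. Gx (Complex x y) \<partial>ngauss \<sigma>))"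
    proof
      fix y from G(5)[rule_format, of y] obtain P where "\<And>x. G (Complex x y) = poly P (of_real x)" "\<And>x. Gx (Complex x y) = poly (pderiv P) (of_real x)" by blast
      then show "(\<integral>x. of_real x * G (Complex x y) \<partial>ngauss \<sigma>) = of_real (\<tau> / 2) * (\<integral>x. Gx (Complex x y) \<partial>ngauss \<sigma>)"
        using ngauss_ibp[OF \<sigma>(1), of P] \<sigma> by simp
    qed
    also have "(\<integral>y. of_real (\<tau> / 2) * (\<integral>x. Gx (Complex x y) \<partial>ngauss \<sigma>) \<partial>ngauss \<sigma>) = of_real (\<tau> / 2) * (\<integral>z. Gx z \<partial>cgauss \<tau>)"
      using P.integral_snd[of "\<lambda>x y. Gx (Complex x y)"] intP[OF G(2)]
      by (simp add: E[OF G(2)] case_prod_unfold)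
    finally show ?thesis .
  qed
  have 2: "(\<integral>z. of_real (Im z) * G z \<partial>cgauss \<tau>) = of_real (\<tau> / 2) * (\<integral>z. Gy z \<partial>cgauss \<tau>)"
  proof -
    have "(\<integral>z. of_real (Im z) * G z \<partial>cgauss \<tau>) = (\<integral>x. (\<integral>y. of_real y * G (Complex x y) \<partial>ngauss \<sigma>) \<partial>ngauss \<sigma>)"
      using P.integral_fst[of "\<lambda>x y. of_real y * G (Complex x y)"] intP[OF poly_growth_mult[OF gIm G(1)]]
      by (simp add: E[OF poly_growth_mult[OF gIm G(1)]] case_prod_unfold)
    also have "(\<lambda>x. \<integral>y. of_real y * G (Complex x y) \<partial>ngauss \<sigma>) = (\<lambda>x. of_real (\<tau> / 2) * (\<integral>y. Gy (Complex x y) \<partial>ngauss \<sigma>))"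
    proof
      fix x from G(6)[rule_format, of x] obtain P where "\<And>y. G (Complex x y) = poly P (of_real y)" "\<And>y. Gy (Complex x y) = poly (pderiv P) (of_real y)" by blast
      then show "(\<integral>y. of_real y * G (Complex x y) \<partial>ngauss \<sigma>) = of_real (\<tau> / 2) * (\<integral>y. Gy (Complex x y) \<partial>ngauss \<sigma>)"
        using ngauss_ibp[OF \<sigma>(1), of P] \<sigma> by simp
    qed
    also have "(\<integral>x. of_real (\<tau> / 2) * (\<integral>y. Gy (Complex x y) \<partial>ngauss \<sigma>) \<partial>ngauss \<sigma>) = of_real (\<tau> / 2) * (\<integral>z. Gy z \<partial>cgauss \<tau>)"
      using P.integral_fst[of "\<lambda>x y. Gy (Complex x y)"] intP[OF G(3)]
      by (simp add: E[OF G(3)] case_prod_unfold)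
    finally show ?thesis .
  qed
  have "(\<integral>z. z * G z \<partial>cgauss \<tau>) = (\<integral>z. of_real (Re z) * G z + \<i> * (of_real (Im z) * G z) \<partial>cgauss \<tau>)"
    by (rule Bochner_Integration.integral_cong[OF refl]) (simp add: complex_eq_iff algebra_simps)
  also have "\<dots> = of_real (\<tau> / 2) * (\<integral>z. Gx z \<partial>cgauss \<tau>) + \<i> * (of_real (\<tau> / 2) * (\<integral>z. Gy z \<partial>cgauss \<tau>))"
    using int[OF poly_growth_mult[OF gRe G(1)]] int[OF poly_growth_mult[OF gIm G(1)]] by (simp add: 1 2)
  also have "\<dots> = of_real \<tau> * (\<integral>z. (Gx z + \<i> * Gy z) / 2 \<partial>cgauss \<tau>)"
    using int[OF G(2)] int[OF G(3)] by (simp add: algebra_simps)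
  finally show ?thesis unfolding G(4) .
qed

section \<open>Polynomials in finitely many complex Gaussian variables and their conjugates\<close>

inductive polyfun :: "'i set \<Rightarrow> (('i \<Rightarrow> complex) \<Rightarrow> complex) \<Rightarrow> bool" for B where
  polyfun_const: "polyfun B (\<lambda>_. c)"
| polyfun_coord: "i \<in> B \<Longrightarrow> polyfun B (\<lambda>f. f i)"
| polyfun_cnj: "i \<in> B \<Longrightarrow> polyfun B (\<lambda>f. cnj (f i))"
| polyfun_add: "polyfun B F \<Longrightarrow> polyfun B G \<Longrightarrow> polyfun B (\<lambda>f. F f + G f)"
| polyfun_mult: "polyfun B F \<Longrightarrow> polyfun B G \<Longrightarrow> polyfun B (\<lambda>f. F f * G f)"

text \<open>F' is the derivative of F with respect to the conjugate of the coordinate e. A relation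
  generated by the rules of differentiation delivers function, derivative and polynomiality
  together, and a derivative is established by applying the rules.\<close>

inductive dbar :: "'i set \<Rightarrow> 'i \<Rightarrow> (('i \<Rightarrow> complex) \<Rightarrow> complex) \<Rightarrow> (('i \<Rightarrow> complex) \<Rightarrow> complex) \<Rightarrow> bool" for B e where
  dbar_const: "dbar B e (\<lambda>_. c) (\<lambda>_. 0)"
| dbar_coord: "i \<in> B \<Longrightarrow> dbar B e (\<lambda>f. f i) (\<lambda>_. 0)"
| dbar_cnj: "i \<in> B \<Longrightarrow> dbar B e (\<lambda>f. cnj (f i)) (\<lambda>_. of_bool (e = i))"
| dbar_add: "dbar B e F F' \<Longrightarrow> dbar B e G G' \<Longrightarrow> dbar B e (\<lambda>f. F f + G f) (\<lambda>f. F' f + G' f)"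
| dbar_mult: "dbar B e F F' \<Longrightarrow> dbar B e G G' \<Longrightarrow> dbar B e (\<lambda>f. F f * G f) (\<lambda>f. F' f * G f + F f * G' f)"

lemma dbar_imp_polyfun: "dbar B e F F' \<Longrightarrow> polyfun B F \<and> polyfun B F'"
  by (induction rule: dbar.induct) (auto intro!: polyfun.intros)

lemma dbar_sum: "(\<And>s. s \<in> S \<Longrightarrow> dbar B e (F s) (F' s)) \<Longrightarrow> dbar B e (\<lambda>f. \<Sum>s\<in>S. F s f) (\<lambda>f. \<Sum>s\<in>S. F' s f)"
  by (induction S rule: infinite_finite_induct) (auto intro!: dbar_const[where c = 0] dbar_add)

lemma polyfun_sum: "(\<And>s. s \<in> S \<Longrightarrow> polyfun B (F s)) \<Longrightarrow> polyfun B (\<lambda>f. \<Sum>s\<in>S. F s f)"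
  by (induction S rule: infinite_finite_induct) (auto intro!: polyfun_const[where c = 0] polyfun_add)

lemma dbar_imp_dbar1: "dbar B e F F' \<Longrightarrow> dbar1 (\<lambda>z. F (f(e := z))) (\<lambda>z. F' (f(e := z)))"
proof (induction rule: dbar.induct)
  case (dbar_coord i)
  then show ?case by (cases "i = e") (auto intro: dbar1_id dbar1_const)
next
  case (dbar_cnj i)
  then show ?case by (cases "i = e") (auto intro: dbar1_cnj dbar1_const)
qed (auto intro: dbar1_const dbar1_add dbar1_mult)

abbreviation cgaussN :: "'i set \<Rightarrow> real \<Rightarrow> ('i \<Rightarrow> complex) measure" where
  "cgaussN B \<tau> \<equiv> PiM B (\<lambda>_. cgauss \<tau>)"

lemma polyfun_measurable: "polyfun B F \<Longrightarrow> F \<in> borel_measurable (PiM B (\<lambda>_. borel))"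
proof (induction rule: polyfun.induct)
  case (polyfun_coord i)
  then show ?case by (rule measurable_component_singleton)
next
  case (polyfun_cnj i)
  then show ?case by (intro measurable_compose[OF _ measurable_cnj] measurable_component_singleton)
qed auto

text \<open>The bound is a product over the coordinates, so that its integral against the product
  measure factorizes.\<close>

lemma polyfun_bound:
  assumes "finite B" "polyfun B F"
  shows "\<exists>C k. \<forall>f. cmod (F f) \<le> C * (\<Prod>i\<in>B. (1 + cmod (f i)) ^ k)"
  using assms(2)
proof (induction rule: polyfun.induct)
  have ge1: "1 \<le> (\<Prod>i\<in>B. (1 + cmod (f i)) ^ k)" for f k by (intro prod_ge_1) auto
  have coord: "cmod (f i) \<le> 1 * (\<Prod>i\<in>B. (1 + cmod (f i)) ^ 1)" if "i \<in> B" for f i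
  proof -
    have "cmod (f i) \<le> (1 + cmod (f i)) * 1" by simp
    also have "\<dots> \<le> (1 + cmod (f i)) * (\<Prod>i\<in>B - {i}. (1 + cmod (f i)))"
      by (intro mult_left_mono prod_ge_1) auto
    also have "\<dots> = (\<Prod>i\<in>B. (1 + cmod (f i)))" using assms(1) that by (subst prod.remove[of B i]) auto
    finally show ?thesis by simp
  qed
  { case (polyfun_const c) show ?case using ge1 by (intro exI[of _ "cmod c"] exI[of _ 0]) auto }
  { case (polyfun_coord i) show ?case
    proof (intro exI allI)
      fix f show "cmod (f i) \<le> 1 * (\<Prod>i\<in>B. (1 + cmod (f i)) ^ 1)" by (rule coord) fact
    qed }
  { case (polyfun_cnj i) show ?case
    proof (intro exI allI)
      fix f show "cmod (cnj (f i)) \<le> 1 * (\<Prod>i\<in>B. (1 + cmod (f i)) ^ 1)" unfolding complex_mod_cnj by (rule coord) fact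
    qed }
  { case (polyfun_add F G)
    then obtain C k D l where *: "\<And>f. cmod (F f) \<le> C * (\<Prod>i\<in>B. (1 + cmod (f i)) ^ k)" "\<And>f. cmod (G f) \<le> D * (\<Prod>i\<in>B. (1 + cmod (f i)) ^ l)" by blast
    have mono: "(\<Prod>i\<in>B. (1 + cmod (f i)) ^ k) \<le> (\<Prod>i\<in>B. (1 + cmod (f i)) ^ (k + l))" "(\<Prod>i\<in>B. (1 + cmod (f i)) ^ l) \<le> (\<Prod>i\<in>B. (1 + cmod (f i)) ^ (k + l))" for f
      by (auto intro!: prod_mono power_increasing)
    show ?case
    proof (intro exI allI)
      fix f
      let ?P = "\<lambda>k. \<Prod>i\<in>B. (1 + cmod (f i)) ^ k"
      have "C * ?P k \<le> \<bar>C\<bar> * ?P (k + l)" "D * ?P l \<le> \<bar>D\<bar> * ?P (k + l)"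
        using mono[of f] by (auto intro!: mult_mono prod_nonneg)
      with *[of f] norm_triangle_ineq[of "F f" "G f"] show "cmod (F f + G f) \<le> (\<bar>C\<bar> + \<bar>D\<bar>) * ?P (k + l)"
        unfolding distrib_right by linarith
    qed }
  { case (polyfun_mult F G)
    then obtain C k D l where *: "\<And>f. cmod (F f) \<le> C * (\<Prod>i\<in>B. (1 + cmod (f i)) ^ k)" "\<And>f. cmod (G f) \<le> D * (\<Prod>i\<in>B. (1 + cmod (f i)) ^ l)" by blast
    show ?case
    proof (intro exI allI)
      fix f
      have "cmod (F f * G f) \<le> (C * (\<Prod>i\<in>B. (1 + cmod (f i)) ^ k)) * (D * (\<Prod>i\<in>B. (1 + cmod (f i)) ^ l))"
        unfolding norm_mult by (intro mult_mono') (auto simp: *)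
      then show "cmod (F f * G f) \<le> (C * D) * (\<Prod>i\<in>B. (1 + cmod (f i)) ^ (k + l))"
        by (simp add: power_add prod.distrib mult_ac)
    qed }
qed

lemma sets_PiM_cgauss [measurable_cong]: "sets (PiM B (\<lambda>_. cgauss \<tau>)) = sets (PiM B (\<lambda>_. borel))"
  by (intro sets_PiM_cong) auto

lemma prob_space_cgaussN: "\<tau> > 0 \<Longrightarrow> prob_space (cgaussN B \<tau>)"
  by (intro prob_space_PiM prob_space_cgauss)

lemma product_sigma_finite_cgauss: "\<tau> > 0 \<Longrightarrow> product_sigma_finite (\<lambda>_. cgauss \<tau>)"
  unfolding product_sigma_finite_def using prob_space_cgauss prob_space_imp_sigma_finite by blast

lemma integrable_polyfun:
  assumes "finite B" "\<tau> > 0" "polyfun B F"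
  shows "integrable (cgaussN B \<tau>) F"
proof -
  interpret product_sigma_finite "\<lambda>_. cgauss \<tau>" using assms by (simp add: product_sigma_finite_cgauss)
  obtain C k where b: "\<And>f. cmod (F f) \<le> C * (\<Prod>i\<in>B. (1 + cmod (f i)) ^ k)" using polyfun_bound[OF assms(1,3)] by blast
  have *: "cmod (of_real ((1 + cmod z) ^ k)) = 1 * (1 + cmod z) ^ k" for z
    by (subst norm_of_real) simp
  have "poly_growth (\<lambda>z. of_real ((1 + cmod z) ^ k))"
    unfolding poly_growth_def by (intro conjI exI[of _ "1::real"] exI[of _ k] allI eq_refl *) measurable
  from integrable_cgauss[OF assms(2) this] have "integrable (cgauss \<tau>) (\<lambda>z. (1 + cmod z) ^ k)"
    by (simp only: complex_of_real_integrable_eq)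
  then have "integrable (cgaussN B \<tau>) (\<lambda>f. C * (\<Prod>i\<in>B. (1 + cmod (f i)) ^ k))"
    by (intro integrable_mult_right product_integrable_prod assms)
  then show ?thesis
  proof (rule Bochner_Integration.integrable_bound)
    show "F \<in> borel_measurable (cgaussN B \<tau>)"
      using polyfun_measurable[OF assms(3)] by (simp add: measurable_cong_sets[OF sets_PiM_cgauss refl])
    show "AE f in cgaussN B \<tau>. cmod (F f) \<le> norm (C * (\<Prod>i\<in>B. (1 + cmod (f i)) ^ k))"
    proof (rule AE_I2)
      fix f
      show "cmod (F f) \<le> norm (C * (\<Prod>i\<in>B. (1 + cmod (f i)) ^ k))"
        using b[of f] unfolding real_norm_def by (rule order_trans) (rule abs_ge_self)
    qed
  qed
qed

text \<open>Fubini singles out the coordinate e; the remaining coordinates are frozen and the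
  one-variable formula applies.\<close>

theorem cgaussN_ibp:
  assumes B: "finite B" "e \<in> B" and \<tau>: "\<tau> > 0" and d: "dbar B e F F'"
  shows "(\<integral>f. f e * F f \<partial>cgaussN B \<tau>) = of_real \<tau> * (\<integral>f. F' f \<partial>cgaussN B \<tau>)"
proof -
  interpret product_sigma_finite "\<lambda>_. cgauss \<tau>" using \<tau> by (simp add: product_sigma_finite_cgauss)
  have p: "polyfun B (\<lambda>f. f e * F f)" "polyfun B F'" using dbar_imp_polyfun[OF d] B by (auto intro: polyfun.intros)
  have Be: "insert e (B - {e}) = B" using B by auto
  have ins: "(\<integral>f. G f \<partial>cgaussN B \<tau>) = (\<integral>f. (\<integral>z. G (f(e := z)) \<partial>cgauss \<tau>) \<partial>cgaussN (B - {e}) \<tau>)" if "polyfun B G" for G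
    using product_integral_insert[of "B - {e}" e G] integrable_polyfun[OF B(1) \<tau> that] B(1) unfolding Be by auto
  show ?thesis
    unfolding ins[OF p(1)] ins[OF p(2)] using cgauss_ibp[OF \<tau> dbar_imp_dbar1[OF d]] by simp
qed

section \<open>Wishart moments\<close>

text \<open>Matrices are functions on all pairs of naturals, multiplied over the indices below n.
  Entries are then literally the coordinates of the product measure, and algebraic identities are
  equalities of functions without dimension side conditions.\<close>

type_synonym kern = "nat \<Rightarrow> nat \<Rightarrow> complex"

definition kmul :: "nat \<Rightarrow> kern \<Rightarrow> kern \<Rightarrow> kern" where
  "kmul n A C i j = (\<Sum>s<n. A i s * C s j)"
definition kadj :: "kern \<Rightarrow> kern" where "kadj A i j = cnj (A j i)"
definition ktr :: "nat \<Rightarrow> kern \<Rightarrow> complex" where "ktr n A = (\<Sum>i<n. A i i)"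
definition kid :: "nat set \<Rightarrow> kern" where "kid I i j = of_bool (i = j \<and> i \<in> I)"
definition kern_of :: "nat set \<Rightarrow> nat set \<Rightarrow> (nat \<times> nat \<Rightarrow> complex) \<Rightarrow> kern" where
  "kern_of I J f i j = (if i \<in> I \<and> j \<in> J then f (i, j) else 0)"

lemma kmul_assoc: "kmul n (kmul n A C) D = kmul n A (kmul n C D)"
proof (intro ext)
  fix i j
  have "kmul n (kmul n A C) D i j = (\<Sum>s<n. \<Sum>t<n. A i t * C t s * D s j)"
    by (simp add: kmul_def sum_distrib_right)
  also have "\<dots> = (\<Sum>t<n. \<Sum>s<n. A i t * C t s * D s j)" by (rule sum.swap)
  also have "\<dots> = kmul n A (kmul n C D) i j"
    by (simp add: kmul_def sum_distrib_left mult.assoc)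
  finally show "kmul n (kmul n A C) D i j = kmul n A (kmul n C D) i j" .
qed

lemma ktr_comm: "ktr n (kmul n A C) = ktr n (kmul n C A)"
  unfolding ktr_def kmul_def by (subst sum.swap) (simp add: mult.commute)

lemma kadj_kmul: "kadj (kmul n A C) = kmul n (kadj C) (kadj A)"
  by (auto simp: kadj_def kmul_def fun_eq_iff mult.commute)

lemma kadj_kadj [simp]: "kadj (kadj A) = A" by (auto simp: kadj_def fun_eq_iff)

lemma kadj_kid [simp]: "kadj (kid I) = kid I" by (auto simp: kadj_def kid_def fun_eq_iff)

lemma kid_kmul: "I \<subseteq> {..<n} \<Longrightarrow> (\<And>i j. i \<notin> I \<Longrightarrow> A i j = 0) \<Longrightarrow> kmul n (kid I) A = A"
proof (intro ext)
  fix i j assume I: "I \<subseteq> {..<n}" and A: "\<And>i j. i \<notin> I \<Longrightarrow> A i j = 0"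
  have "kmul n (kid I) A i j = (\<Sum>s<n. if i = s then of_bool (i \<in> I) * A i j else 0)"
    unfolding kmul_def kid_def by (rule sum.cong) auto
  also have "\<dots> = A i j" using I A by (auto simp: sum.delta')
  finally show "kmul n (kid I) A i j = A i j" .
qed

text \<open>Powers of the block times its adjoint, taken in the corner of I: the zeroth power is the
  unit of the block, so its trace is \<open>card I\<close> and not n.\<close>

primrec wpow :: "nat \<Rightarrow> nat set \<Rightarrow> nat set \<Rightarrow> nat \<Rightarrow> (nat \<times> nat \<Rightarrow> complex) \<Rightarrow> kern" where
  "wpow n I J 0 f = kid I"
| "wpow n I J (Suc m) f = kmul n (kmul n (kern_of I J f) (kadj (kern_of I J f))) (wpow n I J m f)"

definition wtr :: "nat \<Rightarrow> nat set \<Rightarrow> nat set \<Rightarrow> nat \<Rightarrow> (nat \<times> nat \<Rightarrow> complex) \<Rightarrow> complex" where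
  "wtr n I J m f = ktr n (wpow n I J m f)"

text \<open>Products of traces, because the recursion for the expectation of one trace produces
  expectations of products of two, which in general do not factor for finite n.\<close>

definition wtrs :: "nat \<Rightarrow> nat set \<Rightarrow> nat set \<Rightarrow> nat list \<Rightarrow> (nat \<times> nat \<Rightarrow> complex) \<Rightarrow> complex" where
  "wtrs n I J L f = prod_list (map (\<lambda>m. wtr n I J m f) L)"

locale blocks =
  fixes n :: nat and I J :: "nat set"
  assumes I: "I \<subseteq> {..<n}" and J: "J \<subseteq> {..<n}"
begin

lemma finite_IJ [simp]: "finite I" "finite J" using I J finite_subset by auto

abbreviation "K \<equiv> kern_of I J"
abbreviation "W m f \<equiv> wpow n I J m f"
abbreviation mm (infixl \<open>\<odot>\<close> 70) where "A \<odot> C \<equiv> kmul n A C"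

lemma K_row: "i \<notin> I \<Longrightarrow> K f i j = 0" and K_col: "j \<notin> J \<Longrightarrow> K f i j = 0"
  by (auto simp: kern_of_def)

lemma W_row: "i \<notin> I \<Longrightarrow> W m f i j = 0"
  by (cases m) (auto simp: kid_def kmul_def K_row)

lemma kid_K [simp]: "kid I \<odot> K f = K f"
  by (rule kid_kmul[OF I]) (rule K_row)

lemma kid_W [simp]: "kid I \<odot> W m f = W m f"
  by (rule kid_kmul[OF I]) (rule W_row)

lemma W_add: "W a f \<odot> W b f = W (a + b) f"
  by (induction a) (auto simp: kmul_assoc)

lemma W_one: "W (Suc 0) f = K f \<odot> kadj (K f)"
proof -
  have "kadj (kid I \<odot> K f) = kadj (K f) \<odot> kid I" by (simp only: kadj_kmul kadj_kid)
  then have "kadj (K f) \<odot> kid I = kadj (K f)" by simp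
  then show ?thesis by (simp add: kmul_assoc)
qed

lemma kadj_W [simp]: "kadj (W m f) = W m f"
proof (induction m)
  case (Suc m)
  have "kadj (W (Suc m) f) = W m f \<odot> W (Suc 0) f" by (simp only: W_one wpow.simps(2)[of n I J m] kadj_kmul kadj_kadj Suc kmul_assoc)
  then show ?case by (simp only: W_add add_Suc_right add_0_right)
qed simp


lemma K_wtr0: "wtr n I J 0 f = of_nat (card I)"
proof -
  have "(\<Sum>i<n. kid I i i) = (\<Sum>i\<in>I. kid I i i)"
    by (rule sum.mono_neutral_right) (use I in \<open>auto simp: kid_def\<close>)
  also have "\<dots> = (\<Sum>i\<in>I. 1)" by (rule sum.cong) (auto simp: kid_def)
  finally show ?thesis by (simp add: wtr_def ktr_def)
qed

lemma dbar_K: "dbar (I \<times> J) e (\<lambda>f. K f i j) (\<lambda>_. 0)"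
  by (cases "i \<in> I \<and> j \<in> J") (auto simp: kern_of_def intro: dbar_coord dbar_const)

lemma dbar_cnj_K: "e \<in> I \<times> J \<Longrightarrow> dbar (I \<times> J) e (\<lambda>f. cnj (K f i j)) (\<lambda>_. of_bool (e = (i, j)))"
proof (cases "i \<in> I \<and> j \<in> J")
  case True
  then have "(\<lambda>f. cnj (K f i j)) = (\<lambda>f. cnj (f (i, j)))" by (auto simp: kern_of_def)
  then show ?thesis using True dbar_cnj[of "(i, j)"] by simp
next
  case False
  assume "e \<in> I \<times> J"
  with False have "(\<lambda>f. cnj (K f i j)) = (\<lambda>_. 0)" "of_bool (e = (i, j)) = (0::complex)" by (auto simp: kern_of_def)
  then show ?thesis by (simp only: dbar_const)
qed

lemma dbar_KK:
  assumes "(a, b) \<in> I \<times> J"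
  shows "dbar (I \<times> J) (a, b) (\<lambda>f. (K f \<odot> kadj (K f)) i i') (\<lambda>f. K f i b * of_bool (i' = a))"
proof -
  have "dbar (I \<times> J) (a, b) (\<lambda>f. \<Sum>s<n. K f i s * cnj (K f i' s)) (\<lambda>f. \<Sum>s<n. 0 * cnj (K f i' s) + K f i s * of_bool ((a, b) = (i', s)))"
    by (intro dbar_sum dbar_mult dbar_K dbar_cnj_K assms)
  also have "(\<lambda>f. \<Sum>s<n. 0 * cnj (K f i' s) + K f i s * of_bool ((a, b) = (i', s))) = (\<lambda>f. K f i b * of_bool (i' = a))"
  proof
    fix f
    have "b < n" using assms J by auto
    have "(\<Sum>s<n. 0 * cnj (K f i' s) + K f i s * of_bool ((a, b) = (i', s))) = (\<Sum>s<n. if b = s then K f i b * of_bool (i' = a) else 0)"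
      by (rule sum.cong) auto
    then show "(\<Sum>s<n. 0 * cnj (K f i' s) + K f i s * of_bool ((a, b) = (i', s))) = K f i b * of_bool (i' = a)"
      using \<open>b < n\<close> by (simp add: sum.delta')
  qed
  finally show ?thesis by (simp add: kmul_def kadj_def)
qed

text \<open>Only the adjoint factors involve conjugated entries. Differentiating the one that
  follows \<open>W r f\<close> and \<open>K f\<close> cuts the word at that place, leaving a left
  part ending in column b and a right part starting in row a.\<close>

lemma dbar_W:
  assumes e: "(a, b) \<in> I \<times> J"
  shows "dbar (I \<times> J) (a, b) (\<lambda>f. W m f i i') (\<lambda>f. \<Sum>r<m. (W r f \<odot> K f) i b * W (m - 1 - r) f a i')"
proof (induction m arbitrary: i)
  case 0 show ?case by (simp add: dbar_const)
next
  case (Suc m)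
  have "dbar (I \<times> J) (a, b) (\<lambda>f. \<Sum>s<n. (K f \<odot> kadj (K f)) i s * W m f s i')
     (\<lambda>f. \<Sum>s<n. (K f i b * of_bool (s = a)) * W m f s i' + (K f \<odot> kadj (K f)) i s * (\<Sum>r<m. (W r f \<odot> K f) s b * W (m - 1 - r) f a i'))"
    by (intro dbar_sum dbar_mult dbar_KK e Suc.IH)
  also have "(\<lambda>f. \<Sum>s<n. (K f i b * of_bool (s = a)) * W m f s i' + (K f \<odot> kadj (K f)) i s * (\<Sum>r<m. (W r f \<odot> K f) s b * W (m - 1 - r) f a i'))
    = (\<lambda>f. \<Sum>r<Suc m. (W r f \<odot> K f) i b * W (Suc m - 1 - r) f a i')"
  proof
    fix f
    have a: "a < n" using e I by auto
    have 1: "(\<Sum>s<n. (K f i b * of_bool (s = a)) * W m f s i') = K f i b * W m f a i'"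
    proof -
      have "(\<Sum>s<n. (K f i b * of_bool (s = a)) * W m f s i') = (\<Sum>s<n. if s = a then K f i b * W m f a i' else 0)"
        by (rule sum.cong) auto
      then show ?thesis using a by simp
    qed
    have 2: "(\<Sum>s<n. (K f \<odot> kadj (K f)) i s * (\<Sum>r<m. (W r f \<odot> K f) s b * W (m - 1 - r) f a i'))
       = (\<Sum>r<m. (W (Suc r) f \<odot> K f) i b * W (m - 1 - r) f a i')"
    proof -
      have "(\<Sum>s<n. (K f \<odot> kadj (K f)) i s * (\<Sum>r<m. (W r f \<odot> K f) s b * W (m - 1 - r) f a i'))
        = (\<Sum>r<m. (\<Sum>s<n. (K f \<odot> kadj (K f)) i s * (W r f \<odot> K f) s b) * W (m - 1 - r) f a i')"
        unfolding sum_distrib_left sum_distrib_right by (subst sum.swap) (simp add: mult.assoc)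
      also have "\<dots> = (\<Sum>r<m. (W (Suc r) f \<odot> K f) i b * W (m - 1 - r) f a i')"
      proof (rule sum.cong[OF refl])
        fix r
        have "(\<Sum>s<n. (K f \<odot> kadj (K f)) i s * (W r f \<odot> K f) s b) = ((K f \<odot> kadj (K f)) \<odot> (W r f \<odot> K f)) i b"
          by (simp only: kmul_def[of n "kmul n (K f) (kadj (K f))" "kmul n (W r f) (K f)"])
        also have "\<dots> = (W (Suc r) f \<odot> K f) i b" by (simp only: kmul_assoc wpow.simps)
        finally show "(\<Sum>s<n. (K f \<odot> kadj (K f)) i s * (W r f \<odot> K f) s b) * W (m - 1 - r) f a i' = (W (Suc r) f \<odot> K f) i b * W (m - 1 - r) f a i'" by simp
      qed
      finally show ?thesis .
    qed
    show "(\<Sum>s<n. (K f i b * of_bool (s = a)) * W m f s i' + (K f \<odot> kadj (K f)) i s * (\<Sum>r<m. (W r f \<odot> K f) s b * W (m - 1 - r) f a i'))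
      = (\<Sum>r<Suc m. (W r f \<odot> K f) i b * W (Suc m - 1 - r) f a i')"
      unfolding sum.distrib 1 2 sum.lessThan_Suc_shift by simp
  qed
  finally show ?case by (simp add: kmul_def[of n "kmul n _ _"])
qed

text \<open>Under the trace the cut word closes up again, and cyclicity makes all m cuts give the
  same kernel; hence the coefficient m.\<close>

lemma dbar_wtr:
  assumes e: "(a, b) \<in> I \<times> J"
  shows "dbar (I \<times> J) (a, b) (\<lambda>f. wtr n I J m f) (\<lambda>f. of_nat m * (W (m - 1) f \<odot> K f) a b)"
proof -
  have "dbar (I \<times> J) (a, b) (\<lambda>f. \<Sum>i<n. W m f i i) (\<lambda>f. \<Sum>i<n. \<Sum>r<m. (W r f \<odot> K f) i b * W (m - 1 - r) f a i)"
    by (intro dbar_sum dbar_W e)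
  also have "(\<lambda>f. \<Sum>i<n. \<Sum>r<m. (W r f \<odot> K f) i b * W (m - 1 - r) f a i) = (\<lambda>f. of_nat m * (W (m - 1) f \<odot> K f) a b)"
  proof
    fix f
    have "(\<Sum>i<n. \<Sum>r<m. (W r f \<odot> K f) i b * W (m - 1 - r) f a i) = (\<Sum>r<m. (W (m - 1 - r) f \<odot> (W r f \<odot> K f)) a b)"
      by (subst sum.swap) (simp add: kmul_def[of n "wpow n I J (_ - _) f"] mult.commute)
    also have "\<dots> = (\<Sum>r<m. (W (m - 1) f \<odot> K f) a b)"
      by (rule sum.cong) (auto simp: kmul_assoc[symmetric] W_add)
    finally show "(\<Sum>i<n. \<Sum>r<m. (W r f \<odot> K f) i b * W (m - 1 - r) f a i) = of_nat m * (W (m - 1) f \<odot> K f) a b" by simp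
  qed
  finally show ?thesis by (simp add: wtr_def ktr_def)
qed

lemma dbar_wtrs:
  assumes e: "(a, b) \<in> I \<times> J"
  shows "dbar (I \<times> J) (a, b) (\<lambda>f. wtrs n I J L f)
    (\<lambda>f. \<Sum>x<length L. of_nat (L ! x) * (W (L ! x - 1) f \<odot> K f) a b * wtrs n I J (take x L @ drop (Suc x) L) f)"
proof (induction L)
  case Nil show ?case by (simp add: wtrs_def dbar_const)
next
  case (Cons m L)
  have "dbar (I \<times> J) (a, b) (\<lambda>f. wtr n I J m f * wtrs n I J L f)
     (\<lambda>f. (of_nat m * (W (m - 1) f \<odot> K f) a b) * wtrs n I J L f +
        wtr n I J m f * (\<Sum>x<length L. of_nat (L ! x) * (W (L ! x - 1) f \<odot> K f) a b * wtrs n I J (take x L @ drop (Suc x) L) f))"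
    by (intro dbar_mult dbar_wtr e Cons.IH)
  also have "(\<lambda>f. (of_nat m * (W (m - 1) f \<odot> K f) a b) * wtrs n I J L f +
        wtr n I J m f * (\<Sum>x<length L. of_nat (L ! x) * (W (L ! x - 1) f \<odot> K f) a b * wtrs n I J (take x L @ drop (Suc x) L) f))
     = (\<lambda>f. \<Sum>x<length (m # L). of_nat ((m # L) ! x) * (W ((m # L) ! x - 1) f \<odot> K f) a b * wtrs n I J (take x (m # L) @ drop (Suc x) (m # L)) f)"
    unfolding length_Cons sum.lessThan_Suc_shift by (simp add: wtrs_def sum_distrib_left mult_ac)
  finally show ?case by (simp add: wtrs_def)
qed

lemma wtr_polyfun: "polyfun (I \<times> J) (\<lambda>f. wtr n I J m f)"
proof -
  have K: "polyfun (I \<times> J) (\<lambda>f. K f i j)" "polyfun (I \<times> J) (\<lambda>f. cnj (K f i j))" for i j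
    by (cases "i \<in> I \<and> j \<in> J"; auto simp: kern_of_def intro: polyfun.intros)+
  have "polyfun (I \<times> J) (\<lambda>f. W m f i j)" for i j m
    by (induction m arbitrary: i j) (auto simp: kmul_def kadj_def intro!: polyfun_const polyfun_sum polyfun_mult K)
  then show ?thesis unfolding wtr_def ktr_def by (intro polyfun_sum)
qed

lemma wtrs_polyfun: "polyfun (I \<times> J) (\<lambda>f. wtrs n I J L f)"
  unfolding wtrs_def by (induction L) (auto intro!: polyfun_const polyfun_mult wtr_polyfun)

definition Ewtrs :: "real \<Rightarrow> nat list \<Rightarrow> complex" where
  "Ewtrs \<tau> L = (\<integral>f. wtrs n I J L f \<partial>cgaussN (I \<times> J) \<tau>)"

definition KW :: "nat \<Rightarrow> (nat \<times> nat \<Rightarrow> complex) \<Rightarrow> kern" where "KW m f = kadj (K f) \<odot> W m f"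

lemma sum_block: "(\<Sum>i<n. \<Sum>j<n. if i \<in> I \<and> j \<in> J then h i j else 0) = (\<Sum>e\<in>I \<times> J. h (fst e) (snd e))"
proof -
  have "(\<Sum>i<n. \<Sum>j<n. if i \<in> I \<and> j \<in> J then h i j else 0) = (\<Sum>i<n. if i \<in> I then \<Sum>j\<in>J. h i j else 0)"
  proof (rule sum.cong[OF refl])
    fix i
    have "{..<n} \<inter> J = J" using J by auto
    then show "(\<Sum>j<n. if i \<in> I \<and> j \<in> J then h i j else 0) = (if i \<in> I then \<Sum>j\<in>J. h i j else 0)"
      by (simp add: sum.If_cases Int_def)
  qed
  also have "\<dots> = (\<Sum>i\<in>I. \<Sum>j\<in>J. h i j)" using I by (simp add: sum.If_cases Int_absorb1)
  finally show ?thesis by (simp add: sum.cartesian_product case_prod_beta)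
qed

text \<open>Splits the first factor off a trace so that one Gaussian coordinate \<open>f e\<close>
  stands in front, ready for integration by parts; \<open>KW\<close> is the rest of the
  word.\<close>

lemma wtr_Suc: "wtr n I J (Suc m) f = (\<Sum>e\<in>I \<times> J. f e * KW m f (snd e) (fst e))"
proof -
  have "wtr n I J (Suc m) f = (\<Sum>i<n. \<Sum>j<n. K f i j * KW m f j i)"
    unfolding wtr_def ktr_def wpow.simps kmul_assoc KW_def[symmetric] by (simp add: kmul_def)
  also have "\<dots> = (\<Sum>i<n. \<Sum>j<n. if i \<in> I \<and> j \<in> J then f (i, j) * KW m f j i else 0)"
    by (intro sum.cong) (auto simp: kern_of_def)
  also have "\<dots> = (\<Sum>e\<in>I \<times> J. f (fst e, snd e) * KW m f (snd e) (fst e))" by (rule sum_block)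
  finally show ?thesis by simp
qed

lemma dbar_KW:
  assumes "(a, b) \<in> I \<times> J"
  shows "dbar (I \<times> J) (a, b) (\<lambda>f. KW m f b a) (\<lambda>f. W m f a a + (\<Sum>r<m. (kadj (K f) \<odot> (W r f \<odot> K f)) b b * W (m - 1 - r) f a a))"
proof -
  have "dbar (I \<times> J) (a, b) (\<lambda>f. \<Sum>s<n. cnj (K f s b) * W m f s a)
     (\<lambda>f. \<Sum>s<n. of_bool ((a, b) = (s, b)) * W m f s a + cnj (K f s b) * (\<Sum>r<m. (W r f \<odot> K f) s b * W (m - 1 - r) f a a))"
    by (intro dbar_sum dbar_mult dbar_cnj_K dbar_W assms)
  also have "(\<lambda>f. \<Sum>s<n. of_bool ((a, b) = (s, b)) * W m f s a + cnj (K f s b) * (\<Sum>r<m. (W r f \<odot> K f) s b * W (m - 1 - r) f a a))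
     = (\<lambda>f. W m f a a + (\<Sum>r<m. (kadj (K f) \<odot> (W r f \<odot> K f)) b b * W (m - 1 - r) f a a))"
  proof
    fix f
    have a: "a < n" using assms I by auto
    have "(\<Sum>s<n. of_bool ((a, b) = (s, b)) * W m f s a) = (\<Sum>s<n. if a = s then W m f a a else 0)"
      by (rule sum.cong) auto
    also have "\<dots> = W m f a a" using a by simp
    finally have 1: "(\<Sum>s<n. of_bool ((a, b) = (s, b)) * W m f s a) = W m f a a" .
    have 2: "(\<Sum>s<n. cnj (K f s b) * (\<Sum>r<m. (W r f \<odot> K f) s b * W (m - 1 - r) f a a))
       = (\<Sum>r<m. (kadj (K f) \<odot> (W r f \<odot> K f)) b b * W (m - 1 - r) f a a)"
      unfolding kmul_def[of n "kadj _"] sum_distrib_left sum_distrib_right by (subst sum.swap) (simp add: mult.assoc kadj_def)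
    show "(\<Sum>s<n. of_bool ((a, b) = (s, b)) * W m f s a + cnj (K f s b) * (\<Sum>r<m. (W r f \<odot> K f) s b * W (m - 1 - r) f a a))
      = W m f a a + (\<Sum>r<m. (kadj (K f) \<odot> (W r f \<odot> K f)) b b * W (m - 1 - r) f a a)"
      unfolding sum.distrib 1 2 ..
  qed
  finally show ?thesis by (simp add: KW_def kmul_def[of n "kadj _"] kadj_def)
qed

lemma sum_diag_I: "(\<Sum>i\<in>I. W m f i i) = wtr n I J m f"
  unfolding wtr_def ktr_def by (rule sum.mono_neutral_left) (use I W_row in auto)

text \<open>The trace over J of the adjoint order equals the trace over I of the next power, by
  cyclicity. This is where the power r becomes \<open>Suc r\<close> in the recursion.\<close>

lemma sum_diag_J: "(\<Sum>j\<in>J. (kadj (K f) \<odot> (W r f \<odot> K f)) j j) = wtr n I J (Suc r) f"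
proof -
  have "(\<Sum>j\<in>J. (kadj (K f) \<odot> (W r f \<odot> K f)) j j) = ktr n (kadj (K f) \<odot> (W r f \<odot> K f))"
    unfolding ktr_def by (rule sum.mono_neutral_left) (use J in \<open>auto simp: kmul_def kadj_def K_col\<close>)
  also have "\<dots> = wtr n I J (Suc r) f"
    by (subst ktr_comm) (simp add: kmul_assoc wtr_def, subst ktr_comm, simp add: kmul_assoc)
  finally show ?thesis .
qed

text \<open>A Gaussian pairing between two different traces merges them into one and creates no free
  index. After normalization it is this term that is suppressed, and its disappearance is what makes
  traces asymptotically independent.\<close>

lemma sum_KW: "(\<Sum>e\<in>I \<times> J. KW m f (snd e) (fst e) * (W r f \<odot> K f) (fst e) (snd e)) = wtr n I J (Suc (m + r)) f"
proof -
  have "(\<Sum>e\<in>I \<times> J. KW m f (snd e) (fst e) * (W r f \<odot> K f) (fst e) (snd e))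
     = (\<Sum>i<n. \<Sum>j<n. if i \<in> I \<and> j \<in> J then KW m f j i * (W r f \<odot> K f) i j else 0)" by (rule sum_block[symmetric])
  also have "\<dots> = (\<Sum>i<n. \<Sum>j<n. (W r f \<odot> K f) i j * KW m f j i)"
    by (intro sum.cong) (auto simp: kmul_def W_row K_col)
  also have "\<dots> = ktr n ((W r f \<odot> K f) \<odot> KW m f)" by (simp add: ktr_def kmul_def[of n "kmul n _ _"])
  also have "(W r f \<odot> K f) \<odot> KW m f = W (Suc (m + r)) f"
  proof -
    have "(W r f \<odot> K f) \<odot> KW m f = W r f \<odot> W (Suc m) f" by (simp only: KW_def kmul_assoc wpow.simps)
    then show ?thesis by (simp only: W_add add.commute[of r] add_Suc)
  qed
  finally show ?thesis by (simp add: wtr_def)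
qed


text \<open>The conjugate derivative can hit three places: the leading adjoint factor, which leaves
  a free index in J and yields \<open>card J\<close>; a later factor of the same trace, which splits
  it in two; or another trace of the list, which is joined to the first.\<close>

theorem schwinger_dyson:
  assumes \<tau>: "\<tau> > 0"
  shows "Ewtrs \<tau> (Suc m # L) = of_real \<tau> * (of_nat (card J) * Ewtrs \<tau> (m # L)
     + (\<Sum>r<m. Ewtrs \<tau> (Suc r # (m - 1 - r) # L))
     + (\<Sum>x<length L. of_nat (L ! x) * Ewtrs \<tau> ((m + L ! x) # take x L @ drop (Suc x) L)))"
proof -
  let ?B = "I \<times> J" and ?del = "\<lambda>x. take x L @ drop (Suc x) L"
  note int = integrable_polyfun[OF _ \<tau>, of ?B]
  have int': "integrable (cgaussN ?B \<tau>) (\<lambda>f. wtrs n I J L f)" for L by (rule int) (simp_all add: wtrs_polyfun)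
  \<comment> \<open>The derivative, by the product rule, of everything that multiplies the
    coordinate \<open>f e\<close>.\<close>
  define D where "D e f = (W m f (fst e) (fst e) + (\<Sum>r<m. (kadj (K f) \<odot> (W r f \<odot> K f)) (snd e) (snd e) * W (m - 1 - r) f (fst e) (fst e))) * wtrs n I J L f
      + KW m f (snd e) (fst e) * (\<Sum>x<length L. of_nat (L ! x) * (W (L ! x - 1) f \<odot> K f) (fst e) (snd e) * wtrs n I J (?del x) f)" for e f
  have d: "dbar ?B e (\<lambda>f. KW m f (snd e) (fst e) * wtrs n I J L f) (D e)" if "e \<in> ?B" for e
  proof -
    obtain a b where e1: "e = (a, b)" by (cases e)
    with that have e2: "(a, b) \<in> ?B" by simp
    show ?thesis unfolding D_def e1 fst_conv snd_conv by (intro dbar_mult dbar_KW dbar_wtrs e2)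
  qed
  have pD: "polyfun ?B (D e)" "polyfun ?B (\<lambda>f. f e * (KW m f (snd e) (fst e) * wtrs n I J L f))" if "e \<in> ?B" for e
    using dbar_imp_polyfun[OF d[OF that]] that by (auto intro: polyfun_mult polyfun_coord)
  have "Ewtrs \<tau> (Suc m # L) = (\<integral>f. (\<Sum>e\<in>?B. f e * (KW m f (snd e) (fst e) * wtrs n I J L f)) \<partial>cgaussN ?B \<tau>)"
    by (simp add: Ewtrs_def wtrs_def wtr_Suc sum_distrib_right mult.assoc)
  also have "\<dots> = (\<Sum>e\<in>?B. \<integral>f. f e * (KW m f (snd e) (fst e) * wtrs n I J L f) \<partial>cgaussN ?B \<tau>)"
    by (intro Bochner_Integration.integral_sum int pD) auto
  also have "\<dots> = (\<Sum>e\<in>?B. of_real \<tau> * (\<integral>f. D e f \<partial>cgaussN ?B \<tau>))"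
    by (intro sum.cong cgaussN_ibp \<tau> d) auto
  also have "\<dots> = of_real \<tau> * (\<integral>f. (\<Sum>e\<in>?B. D e f) \<partial>cgaussN ?B \<tau>)"
    unfolding sum_distrib_left[symmetric] by (subst Bochner_Integration.integral_sum) (auto intro!: int pD)
  also have "(\<lambda>f. \<Sum>e\<in>?B. D e f) = (\<lambda>f. of_nat (card J) * wtrs n I J (m # L) f + (\<Sum>r<m. wtrs n I J (Suc r # (m - 1 - r) # L) f)
     + (\<Sum>x<length L. of_nat (L ! x) * wtrs n I J ((m + L ! x) # ?del x) f))"
  proof
    fix f
    have sB: "(\<Sum>e\<in>?B. g (fst e) * h (snd e)) = (\<Sum>i\<in>I. g i) * (\<Sum>j\<in>J. h j)" for g h :: "nat \<Rightarrow> complex"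
      by (simp add: sum_product sum.cartesian_product case_prod_beta)
    have 1: "(\<Sum>e\<in>?B. W m f (fst e) (fst e)) = of_nat (card J) * wtr n I J m f"
      using sB[of "\<lambda>i. W m f i i" "\<lambda>_. 1"] by (simp add: sum_diag_I)
    have 2: "(\<Sum>e\<in>?B. (\<Sum>r<m. (kadj (K f) \<odot> (W r f \<odot> K f)) (snd e) (snd e) * W (m - 1 - r) f (fst e) (fst e)))
       = (\<Sum>r<m. wtr n I J (Suc r) f * wtr n I J (m - 1 - r) f)"
    proof (subst sum.swap, rule sum.cong[OF refl])
      fix r
      show "(\<Sum>e\<in>?B. (kadj (K f) \<odot> (W r f \<odot> K f)) (snd e) (snd e) * W (m - 1 - r) f (fst e) (fst e)) = wtr n I J (Suc r) f * wtr n I J (m - 1 - r) f"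
        using sB[of "\<lambda>i. W (m - 1 - r) f i i" "\<lambda>j. (kadj (K f) \<odot> (W r f \<odot> K f)) j j"]
        by (simp only: sum_diag_I sum_diag_J mult.commute)
    qed
    have 3: "(\<Sum>e\<in>?B. KW m f (snd e) (fst e) * (\<Sum>x<length L. of_nat (L ! x) * (W (L ! x - 1) f \<odot> K f) (fst e) (snd e) * wtrs n I J (?del x) f))
       = (\<Sum>x<length L. of_nat (L ! x) * (wtr n I J (m + L ! x) f * wtrs n I J (?del x) f))"
      unfolding sum_distrib_left
    proof (subst sum.swap, rule sum.cong[OF refl])
      fix x
      have "(\<Sum>e\<in>?B. KW m f (snd e) (fst e) * (of_nat (L ! x) * (W (L ! x - 1) f \<odot> K f) (fst e) (snd e) * wtrs n I J (?del x) f))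
        = of_nat (L ! x) * wtrs n I J (?del x) f * (\<Sum>e\<in>?B. KW m f (snd e) (fst e) * (W (L ! x - 1) f \<odot> K f) (fst e) (snd e))"
        by (simp add: sum_distrib_left mult_ac)
      also have "\<dots> = of_nat (L ! x) * (wtr n I J (m + L ! x) f * wtrs n I J (?del x) f)"
        \<comment> \<open>For \<open>L ! x = 0\<close> the truncated exponent
          \<open>L ! x - 1\<close> gives the wrong power, but the coefficient \<open>L ! x\<close>
          vanishes.\<close>
        unfolding sum_KW by (cases "L ! x") simp_all
      finally show "(\<Sum>e\<in>?B. KW m f (snd e) (fst e) * (of_nat (L ! x) * (W (L ! x - 1) f \<odot> K f) (fst e) (snd e) * wtrs n I J (?del x) f))
        = of_nat (L ! x) * (wtr n I J (m + L ! x) f * wtrs n I J (?del x) f)" .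
    qed
    show "(\<Sum>e\<in>?B. D e f) = of_nat (card J) * wtrs n I J (m # L) f + (\<Sum>r<m. wtrs n I J (Suc r # (m - 1 - r) # L) f)
     + (\<Sum>x<length L. of_nat (L ! x) * wtrs n I J ((m + L ! x) # ?del x) f)"
      unfolding D_def sum.distrib sum_distrib_right[symmetric] 1 2 3
      by (simp add: wtrs_def distrib_right sum_distrib_right mult.assoc)
  qed
  also have "(\<integral>f. of_nat (card J) * wtrs n I J (m # L) f + (\<Sum>r<m. wtrs n I J (Suc r # (m - 1 - r) # L) f)
     + (\<Sum>x<length L. of_nat (L ! x) * wtrs n I J ((m + L ! x) # ?del x) f) \<partial>cgaussN ?B \<tau>)
    = of_nat (card J) * Ewtrs \<tau> (m # L) + (\<Sum>r<m. Ewtrs \<tau> (Suc r # (m - 1 - r) # L))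
     + (\<Sum>x<length L. of_nat (L ! x) * Ewtrs \<tau> ((m + L ! x) # ?del x))"
    unfolding Ewtrs_def
    by (simp add: int')
  finally show ?thesis .
qed

end

section \<open>Vectors, Hilbert-Schmidt norms and operator norm bounds through traces\<close>

definition kvec :: "nat \<Rightarrow> kern \<Rightarrow> (nat \<Rightarrow> complex) \<Rightarrow> nat \<Rightarrow> complex" where
  "kvec n A v i = (\<Sum>j<n. A i j * v j)"
definition vn2 :: "nat \<Rightarrow> (nat \<Rightarrow> complex) \<Rightarrow> real" where "vn2 n v = (\<Sum>i<n. (cmod (v i))\<^sup>2)"
definition vip :: "nat \<Rightarrow> (nat \<Rightarrow> complex) \<Rightarrow> (nat \<Rightarrow> complex) \<Rightarrow> complex" where
  "vip n u v = (\<Sum>i<n. cnj (u i) * v i)"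

lemma vn2_nonneg [simp]: "0 \<le> vn2 n v" by (simp add: vn2_def sum_nonneg)

lemma vip_self: "vip n v v = of_real (vn2 n v)"
  unfolding vip_def vn2_def of_real_sum by (rule sum.cong) (simp_all add: complex_norm_square[symmetric] mult.commute[of "cnj _"])

lemma sum_mult_cauchy_schwarz:
  fixes a b :: "'i \<Rightarrow> complex"
  shows "(cmod (\<Sum>i\<in>S. a i * b i))\<^sup>2 \<le> (\<Sum>i\<in>S. (cmod (a i))\<^sup>2) * (\<Sum>i\<in>S. (cmod (b i))\<^sup>2)"
proof -
  have "cmod (\<Sum>i\<in>S. a i * b i) \<le> (\<Sum>i\<in>S. cmod (a i) * cmod (b i))"
    by (rule order_trans[OF norm_sum]) (simp add: norm_mult)
  then have "(cmod (\<Sum>i\<in>S. a i * b i))\<^sup>2 \<le> (\<Sum>i\<in>S. cmod (a i) * cmod (b i))\<^sup>2" by (intro power_mono) auto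
  also have "\<dots> \<le> (\<Sum>i\<in>S. (cmod (a i))\<^sup>2) * (\<Sum>i\<in>S. (cmod (b i))\<^sup>2)" by (rule Cauchy_Schwarz_ineq_sum)
  finally show ?thesis .
qed

lemma vip_cauchy_schwarz: "(cmod (vip n u v))\<^sup>2 \<le> vn2 n u * vn2 n v"
  unfolding vip_def vn2_def using sum_mult_cauchy_schwarz[of "\<lambda>i. cnj (u i)" v "{..<n}"] by simp

lemma kvec_kmul: "kvec n (kmul n A C) v = kvec n A (kvec n C v)"
proof
  fix i
  have "kvec n (kmul n A C) v i = (\<Sum>j<n. \<Sum>s<n. A i s * C s j * v j)" by (simp add: kvec_def kmul_def sum_distrib_right)
  also have "\<dots> = (\<Sum>s<n. \<Sum>j<n. A i s * C s j * v j)" by (rule sum.swap)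
  also have "\<dots> = kvec n A (kvec n C v) i" by (simp add: kvec_def sum_distrib_left mult.assoc)
  finally show "kvec n (kmul n A C) v i = kvec n A (kvec n C v) i" .
qed

lemma vip_kvec: "vip n u (kvec n A v) = vip n (kvec n (kadj A) u) v"
proof -
  have "vip n u (kvec n A v) = (\<Sum>i<n. \<Sum>j<n. cnj (u i) * A i j * v j)" by (simp add: vip_def kvec_def sum_distrib_left mult.assoc)
  also have "\<dots> = (\<Sum>j<n. \<Sum>i<n. cnj (u i) * A i j * v j)" by (rule sum.swap)
  also have "\<dots> = vip n (kvec n (kadj A) u) v" by (simp add: vip_def kvec_def kadj_def sum_distrib_left sum_distrib_right mult_ac)
  finally show ?thesis .
qed

definition hs2 :: "nat \<Rightarrow> kern \<Rightarrow> real" where "hs2 n A = (\<Sum>i<n. \<Sum>j<n. (cmod (A i j))\<^sup>2)"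

lemma hs2_nonneg [simp]: "0 \<le> hs2 n A" by (simp add: hs2_def sum_nonneg)

lemma ktr_kmul_kadj: "ktr n (kmul n A (kadj A)) = of_real (hs2 n A)"
  unfolding ktr_def kmul_def kadj_def hs2_def of_real_sum by (intro sum.cong) (simp_all add: complex_norm_square[symmetric])

lemma vn2_kvec_le: "vn2 n (kvec n A v) \<le> hs2 n A * vn2 n v"
proof -
  have "vn2 n (kvec n A v) \<le> (\<Sum>i<n. (\<Sum>j<n. (cmod (A i j))\<^sup>2) * vn2 n v)"
    unfolding vn2_def[of n "kvec n A v"] kvec_def
    by (rule sum_mono) (unfold vn2_def, rule sum_mult_cauchy_schwarz)
  then show ?thesis by (simp add: hs2_def sum_distrib_right)
qed

lemma ktr_cauchy_schwarz: "(cmod (ktr n (kmul n A C)))\<^sup>2 \<le> hs2 n A * hs2 n C"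
proof -
  have "ktr n (kmul n A C) = (\<Sum>p\<in>{..<n} \<times> {..<n}. A (fst p) (snd p) * C (snd p) (fst p))"
    by (simp add: ktr_def kmul_def sum.cartesian_product case_prod_beta)
  moreover have "hs2 n A = (\<Sum>p\<in>{..<n} \<times> {..<n}. (cmod (A (fst p) (snd p)))\<^sup>2)"
    by (simp add: hs2_def sum.cartesian_product case_prod_beta)
  moreover have "hs2 n C = (\<Sum>p\<in>{..<n} \<times> {..<n}. (cmod (C (snd p) (fst p)))\<^sup>2)"
    unfolding hs2_def by (subst sum.swap) (simp add: sum.cartesian_product case_prod_beta)
  ultimately show ?thesis using sum_mult_cauchy_schwarz[of "\<lambda>p. A (fst p) (snd p)" "\<lambda>p. C (snd p) (fst p)" "{..<n} \<times> {..<n}"] by simp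
qed

lemma hs2_kadj [simp]: "hs2 n (kadj A) = hs2 n A"
  unfolding hs2_def kadj_def by (subst sum.swap) simp

text \<open>Cyclicity rewrites the squared Hilbert-Schmidt norm of a product as the trace of the
  adjoint of A times A, times C times its adjoint; then Cauchy-Schwarz. Products are thereby
  controlled by higher trace moments and no operator norm enters.\<close>

lemma hs2_kmul_sq: "(hs2 n (kmul n A C))\<^sup>2 \<le> hs2 n (kmul n (kadj A) A) * hs2 n (kmul n C (kadj C))"
proof -
  have "of_real (hs2 n (kmul n A C)) = ktr n (kmul n (kmul n A C) (kadj (kmul n A C)))" by (simp add: ktr_kmul_kadj)
  also have "\<dots> = ktr n (kmul n A (kmul n (kmul n C (kadj C)) (kadj A)))" by (simp add: kadj_kmul kmul_assoc)
  also have "\<dots> = ktr n (kmul n (kmul n (kadj A) A) (kmul n C (kadj C)))" by (subst ktr_comm) (subst ktr_comm, simp add: kmul_assoc)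
  finally have "hs2 n (kmul n A C) = cmod (ktr n (kmul n (kmul n (kadj A) A) (kmul n C (kadj C))))"
    by (metis hs2_nonneg abs_of_nonneg norm_of_real)
  then show ?thesis using ktr_cauchy_schwarz[of n "kmul n (kadj A) A" "kmul n C (kadj C)"] by simp
qed

context blocks
begin

definition opbound :: "real \<Rightarrow> (nat \<times> nat \<Rightarrow> complex) \<Rightarrow> bool" where
  "opbound R f \<longleftrightarrow> (\<forall>v. vn2 n (kvec n (K f) v) \<le> R\<^sup>2 * vn2 n v)"

lemma hs2_W: "of_real (hs2 n (W m f)) = wtr n I J (2 * m) f"
  using ktr_kmul_kadj[of n "W m f"] by (simp add: W_add wtr_def mult_2)

lemma hs2_WK: "of_real (hs2 n (W m f \<odot> K f)) = wtr n I J (Suc (2 * m)) f"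
proof -
  have "(W m f \<odot> K f) \<odot> kadj (W m f \<odot> K f) = W m f \<odot> (W (Suc 0) f \<odot> W m f)"
    by (simp only: kadj_kmul kmul_assoc kadj_W W_one)
  also have "\<dots> = W (Suc (2 * m)) f" by (simp only: W_add mult_2 add_Suc add_Suc_right add_0)
  finally show ?thesis using ktr_kmul_kadj[of n "W m f \<odot> K f"] by (simp add: wtr_def)
qed

text \<open>Even and odd powers are squared Hilbert-Schmidt norms, of \<open>W k f\<close> and of
  \<open>W k f\<close> times \<open>K f\<close> respectively.\<close>

lemma wtr_nonneg: "\<exists>t\<ge>0. wtr n I J m f = of_real t"
proof (cases "even m")
  case True
  then obtain k where "m = 2 * k" by blast
  then show ?thesis using hs2_W[of k f, symmetric] hs2_nonneg by blast
next
  case False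
  then obtain k where "m = Suc (2 * k)" by (metis oddE Suc_eq_plus1)
  then show ?thesis using hs2_WK[of k f, symmetric] hs2_nonneg by blast
qed

lemma wtr_real: "wtr n I J m f = of_real (Re (wtr n I J m f))" "0 \<le> Re (wtr n I J m f)"
  using wtr_nonneg[of m f] by auto

text \<open>With h m the quadratic form of \<open>W m f\<close> at x, Cauchy-Schwarz gives h(m)^2
  \<le> |x|^2 h(2m), and j doublings lead from 1 to 2^j. The extra factor \<open>vn2 n x\<close> on
  the left replaces the exponent 2^j - 1 on the right.\<close>

lemma quad_form_chain:
  fixes x :: "nat \<Rightarrow> complex"
  shows "(cmod (vip n x (kvec n (W 1 f) x))) ^ (2 ^ j) * vn2 n x \<le> vn2 n x ^ (2 ^ j) * cmod (vip n x (kvec n (W (2 ^ j) f) x))"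
proof (induction j)
  case 0 show ?case by (simp add: mult.commute)
next
  case (Suc j)
  let ?h = "\<lambda>m. cmod (vip n x (kvec n (W m f) x))" and ?X = "vn2 n x"
  have step: "(?h m)\<^sup>2 \<le> ?X * ?h (2 * m)" for m
  proof -
    have "vip n x (kvec n (W (2 * m) f) x) = vip n (kvec n (W m f) x) (kvec n (W m f) x)"
      by (simp add: mult_2 W_add[symmetric] kvec_kmul vip_kvec[of n x])
    then have "?h (2 * m) = vn2 n (kvec n (W m f) x)" by (simp add: vip_self)
    then show ?thesis using vip_cauchy_schwarz[of n x "kvec n (W m f) x"] by simp
  qed
  show ?case
  proof (cases "?X = 0")
    case False
    then have X: "?X > 0" using vn2_nonneg[of n x] by linarith
    have "(?h 1 ^ (2 ^ j) * ?X)\<^sup>2 \<le> (?X ^ (2 ^ j) * ?h (2 ^ j))\<^sup>2" by (intro power_mono Suc) auto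
    also have "\<dots> \<le> (?X ^ (2 ^ j))\<^sup>2 * (?X * ?h (2 * 2 ^ j))"
      unfolding power_mult_distrib by (intro mult_left_mono step) auto
    finally have "?X * (?h 1 ^ (2 ^ Suc j) * ?X) \<le> ?X * (?X ^ (2 ^ Suc j) * ?h (2 ^ Suc j))"
      by (simp add: power_mult_distrib power_mult[symmetric] power2_eq_square mult_ac flip: power_add mult_2)
    then show ?thesis using X by (simp del: power_Suc)
  qed auto
qed

text \<open>This is the bound of the squared operator norm by the m-th root of the trace of
  \<open>W m f\<close> for m = 2^j, reached by repeated squaring in place of eigenvalues. For j
  \<ge> 1 the power 2^j is even, so the last quadratic form is the squared norm of a vector and can
  be estimated by a Hilbert-Schmidt norm.\<close>

lemma kvec_power_bound:
  assumes "j \<ge> 1"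
  shows "vn2 n (kvec n (K f) v) ^ (2 ^ j) \<le> vn2 n v ^ (2 ^ j) * Re (wtr n I J (2 ^ j) f)"
proof -
  define x where "x = kvec n (K f) v"
  define X where "X = vn2 n x"
  define h where "h m = cmod (vip n x (kvec n (W m f) x))" for m
  have X0: "X \<ge> 0" by (simp add: X_def)
  have h1: "h 1 = vn2 n (kvec n (kadj (K f)) x)"
    unfolding h_def by (simp add: W_one kvec_kmul vip_kvec[of n x "K f"] vip_self del: wpow.simps)
  have "X = cmod (vip n x (kvec n (K f) v))" by (simp add: X_def x_def[symmetric] vip_self)
  also have "\<dots> = cmod (vip n (kvec n (kadj (K f)) x) v)" by (simp add: vip_kvec)
  finally have 1: "X\<^sup>2 \<le> h 1 * vn2 n v" unfolding h1 using vip_cauchy_schwarz by simp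
  obtain i where j: "j = Suc i" using assms by (cases j) auto
  have "h (2 ^ j) = vn2 n (kvec n (W (2 ^ i) f) x)"
    unfolding h_def j power_Suc mult_2 W_add[symmetric] kvec_kmul vip_kvec[of n x] by (simp add: vip_self)
  also have "\<dots> \<le> hs2 n (W (2 ^ i) f) * X" unfolding X_def by (rule vn2_kvec_le)
  also have "hs2 n (W (2 ^ i) f) = Re (wtr n I J (2 ^ j) f)" using hs2_W[of "2 ^ i" f, symmetric] by (simp add: j)
  finally have 2: "h (2 ^ j) \<le> Re (wtr n I J (2 ^ j) f) * X" .
  have 3: "h 1 ^ (2 ^ j) * X \<le> X ^ (2 ^ j) * h (2 ^ j)" using quad_form_chain[of x f j] by (simp add: h_def X_def)
  show ?thesis
  proof (cases "X = 0")
    case True then show ?thesis using wtr_real(2)[of "2 ^ j" f] by (simp add: X_def[symmetric] x_def[symmetric] power_0_left)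
  next
    case False
    then have X: "X > 0" using X0 by simp
    let ?m = "2 ^ j :: nat" and ?V = "vn2 n v" and ?T = "Re (wtr n I J (2 ^ j) f)"
    have "X ^ ?m * X ^ ?m * X = (X\<^sup>2) ^ ?m * X" by (simp add: power_mult_distrib power2_eq_square)
    also have "\<dots> \<le> (h 1 * ?V) ^ ?m * X" using 1 X by (intro mult_right_mono power_mono) auto
    also have "\<dots> = ?V ^ ?m * (h 1 ^ ?m * X)" by (simp add: power_mult_distrib)
    also have "\<dots> \<le> ?V ^ ?m * (X ^ ?m * (?T * X))"
      using 2 3 X by (intro mult_left_mono order_trans[OF 3]) auto
    finally have "(X ^ ?m * X) * X ^ ?m \<le> (X ^ ?m * X) * (?V ^ ?m * ?T)" by (simp add: mult_ac)
    then show ?thesis using X by (simp add: X_def[symmetric] x_def[symmetric])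
  qed
qed

lemma opbound_if_wtr_le:
  assumes "j \<ge> 1" "Re (wtr n I J (2 ^ j) f) \<le> (R\<^sup>2) ^ (2 ^ j)"
  shows "opbound R f"
  unfolding opbound_def
proof
  fix v
  have "vn2 n (kvec n (K f) v) ^ (2 ^ j) \<le> vn2 n v ^ (2 ^ j) * Re (wtr n I J (2 ^ j) f)" by (rule kvec_power_bound) fact
  also have "\<dots> \<le> vn2 n v ^ (2 ^ j) * (R\<^sup>2) ^ (2 ^ j)" by (intro mult_left_mono assms) auto
  finally have "vn2 n (kvec n (K f) v) ^ (2 ^ j) \<le> (R\<^sup>2 * vn2 n v) ^ (2 ^ j)" by (simp add: power_mult_distrib mult.commute)
  then show "vn2 n (kvec n (K f) v) \<le> R\<^sup>2 * vn2 n v" using power_strict_mono[of "R\<^sup>2 * vn2 n v" "vn2 n (kvec n (K f) v)" "2 ^ j"] by (intro leI notI) auto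
qed

text \<open>The bound passes to the adjoint by Cauchy-Schwarz, hence to the powers, hence to their
  diagonal entries, of which \<open>card I\<close> matter.\<close>

lemma wtr_le_if_opbound:
  assumes "opbound R f"
  shows "Re (wtr n I J m f) \<le> real (card I) * (R\<^sup>2) ^ m"
proof -
  have K: "vn2 n (kvec n (K f) v) \<le> R\<^sup>2 * vn2 n v" for v using assms by (simp add: opbound_def)
  have Kadj: "vn2 n (kvec n (kadj (K f)) x) \<le> R\<^sup>2 * vn2 n x" for x
  proof -
    let ?y = "kvec n (kadj (K f)) x"
    have "(vn2 n ?y)\<^sup>2 = (cmod (vip n x (kvec n (K f) ?y)))\<^sup>2" unfolding vip_kvec[of n x] vip_self by simp
    also have "\<dots> \<le> vn2 n x * (R\<^sup>2 * vn2 n ?y)" by (rule order_trans[OF vip_cauchy_schwarz]) (intro mult_left_mono K, simp)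
    finally have "vn2 n ?y * vn2 n ?y \<le> vn2 n ?y * (R\<^sup>2 * vn2 n x)" by (simp add: power2_eq_square mult_ac)
    moreover have "0 \<le> vn2 n ?y" by simp
    ultimately show ?thesis by (cases "vn2 n ?y = 0") (auto simp: mult_le_cancel_left)
  qed
  have Wb: "vn2 n (kvec n (W m f) x) \<le> (R\<^sup>2) ^ (2 * m) * vn2 n x" for m x
  proof (induction m)
    case 0
    have "vn2 n (kvec n (W 0 f) x) \<le> vn2 n x"
      unfolding vn2_def
    proof (rule sum_mono)
      fix i assume "i \<in> {..<n}"
      have "kvec n (W 0 f) x i = (\<Sum>j<n. if i = j then of_bool (i \<in> I) * x i else 0)"
        unfolding kvec_def by (rule sum.cong) (auto simp: kid_def)
      with \<open>i \<in> _\<close> have "kvec n (W 0 f) x i = of_bool (i \<in> I) * x i" by simp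
      then show "(cmod (kvec n (W 0 f) x i))\<^sup>2 \<le> (cmod (x i))\<^sup>2" by simp
    qed
    then show ?case by simp
  next
    case (Suc m)
    have "vn2 n (kvec n (W (Suc m) f) x) = vn2 n (kvec n (K f) (kvec n (kadj (K f)) (kvec n (W m f) x)))"
      by (simp add: kvec_kmul)
    also have "\<dots> \<le> R\<^sup>2 * (R\<^sup>2 * ((R\<^sup>2) ^ (2 * m) * vn2 n x))"
      by (rule order_trans[OF K], rule mult_left_mono, rule order_trans[OF Kadj], rule mult_left_mono, rule Suc) auto
    finally show ?case by (simp add: mult_ac)
  qed
  have diag: "cmod (W m f i i) \<le> (R\<^sup>2) ^ m" if "i \<in> I" for i
  proof -
    have i: "i < n" using that I by auto
    let ?e = "\<lambda>j. of_bool (j = i) :: complex"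
    have "kvec n (W m f) ?e i = (\<Sum>j<n. if j = i then W m f i i else 0)" unfolding kvec_def by (rule sum.cong) auto
    then have e: "kvec n (W m f) ?e i = W m f i i" using i by simp
    have "vn2 n ?e = (\<Sum>j<n. if j = i then 1 else 0)" unfolding vn2_def by (rule sum.cong) auto
    then have ve: "vn2 n ?e = 1" using i by simp
    have "(cmod (kvec n (W m f) ?e i))\<^sup>2 \<le> vn2 n (kvec n (W m f) ?e)"
      unfolding vn2_def by (rule member_le_sum) (use i in auto)
    with Wb[of m ?e] e ve have "(cmod (W m f i i))\<^sup>2 \<le> ((R\<^sup>2) ^ m)\<^sup>2" by (simp add: power_mult[symmetric] mult_ac)
    then show ?thesis by (rule power2_le_imp_le) simp
  qed
  have "Re (wtr n I J m f) \<le> cmod (\<Sum>i\<in>I. W m f i i)" unfolding sum_diag_I by (rule complex_Re_le_cmod)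
  also have "\<dots> \<le> (\<Sum>i\<in>I. (R\<^sup>2) ^ m)" by (rule order_trans[OF norm_sum]) (intro sum_mono diag)
  finally show ?thesis by simp
qed

text \<open>The factor \<open>card I\<close> stays fixed as j grows, so the trace bounds force the
  norm bound: any excess ratio t > 1 would be raised to the power 2^j. The right-hand side is a
  countable family of polynomial inequalities, which is how the norm condition is seen to be
  measurable.\<close>

lemma opbound_iff:
  "opbound R f \<longleftrightarrow> (\<forall>j\<ge>1. Re (wtr n I J (2 ^ j) f) \<le> real (card I) * (R\<^sup>2) ^ (2 ^ j))"
proof
  assume "opbound R f" then show "\<forall>j\<ge>1. Re (wtr n I J (2 ^ j) f) \<le> real (card I) * (R\<^sup>2) ^ (2 ^ j)"
    using wtr_le_if_opbound by blast
next
  assume *: "\<forall>j\<ge>1. Re (wtr n I J (2 ^ j) f) \<le> real (card I) * (R\<^sup>2) ^ (2 ^ j)"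
  show "opbound R f" unfolding opbound_def
  proof (rule allI, rule ccontr)
    fix v assume "\<not> vn2 n (kvec n (K f) v) \<le> R\<^sup>2 * vn2 n v"
    then have less: "R\<^sup>2 * vn2 n v < vn2 n (kvec n (K f) v)" by simp
    define X where "X = vn2 n (kvec n (K f) v)"
    define Y where "Y = R\<^sup>2 * vn2 n v"
    have XY: "0 \<le> Y" "Y < X" using less by (auto simp: X_def Y_def)
    have b: "X ^ (2 ^ j) \<le> real (card I) * Y ^ (2 ^ j)" if "j \<ge> 1" for j
    proof -
      have "X ^ (2 ^ j) \<le> vn2 n v ^ (2 ^ j) * Re (wtr n I J (2 ^ j) f)" unfolding X_def by (rule kvec_power_bound) fact
      also have "\<dots> \<le> vn2 n v ^ (2 ^ j) * (real (card I) * (R\<^sup>2) ^ (2 ^ j))" using * that by (intro mult_left_mono) auto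
      finally show ?thesis by (simp add: Y_def power_mult_distrib mult_ac)
    qed
    have Y: "Y > 0" using b[of 1] XY by (cases "Y = 0") auto
    define t where "t = X / Y"
    have t: "t > 1" using XY Y by (simp add: t_def)
    have bt: "t ^ (2 ^ j) \<le> real (card I)" if "j \<ge> 1" for j
      using b[OF that] Y by (simp add: t_def power_divide divide_simps)
    obtain k where k: "real (card I) < t ^ k" using real_arch_pow[OF t] by blast
    have "k \<le> 2 ^ Suc k" using less_exp[of "Suc k"] by linarith
    then have "t ^ k \<le> t ^ (2 ^ Suc k)" using t by (intro power_increasing) auto
    with bt[of "Suc k"] k show False by simp
  qed
qed

end

section \<open>The normalized moment recursion: limits and uniform growth bounds\<close>

lemma list_moment_induct [case_names Nil Zero Suc]:
  fixes P :: "nat list \<Rightarrow> bool"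
  assumes "P []" and "\<And>L. P L \<Longrightarrow> P (0 # L)"
    and "\<And>m L. P (m # L) \<Longrightarrow> (\<And>r. r < m \<Longrightarrow> P (Suc r # (m - 1 - r) # L)) \<Longrightarrow>
       (\<And>x. x < length L \<Longrightarrow> P ((m + L ! x) # take x L @ drop (Suc x) L)) \<Longrightarrow> P (Suc m # L)"
  shows "P L"
\<comment> \<open>Each use of the recursion lowers the total degree by one, but splitting a trace
  lengthens the list by one; weight 2 on the degree makes the measure drop in this case too.\<close>
proof (induction "2 * sum_list L + length L" arbitrary: L rule: less_induct)
  case less
  have nth: "sum_list L' = L' ! x + sum_list (take x L' @ drop (Suc x) L')" if "x < length L'" for x and L' :: "nat list"
    using that by (subst id_take_nth_drop[of x L']) auto
  show ?case
  proof (cases L)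
    case Nil then show ?thesis using assms(1) by simp
  next
    case (Cons k L')
    show ?thesis
    proof (cases k)
      case 0
      then show ?thesis unfolding Cons by (simp add: assms(2) less Cons)
    next
      case (Suc m)
      show ?thesis unfolding Cons Suc
      proof (rule assms(3))
        show "P (m # L')" by (rule less) (simp add: Cons Suc)
        show "P (Suc r # (m - 1 - r) # L')" if "r < m" for r by (rule less) (use that in \<open>simp add: Cons Suc\<close>)
        show "P ((m + L' ! x) # take x L' @ drop (Suc x) L')" if "x < length L'" for x
          by (rule less) (use that nth[OF that] in \<open>simp add: Cons Suc\<close>)
      qed
    qed
  qed
qed

text \<open>With \<gamma> tending to 0 the joining term disappears, and the limiting recursion acts
  on the head of the list only. Hence the limits are multiplicative along the list, in particular
  for \<open>[m, m]\<close>, which says that the variance of the normalized trace vanishes.\<close>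

lemma moments_limit:
  fixes a :: "nat \<Rightarrow> nat list \<Rightarrow> complex" and M :: "nat \<Rightarrow> real"
  assumes nil: "\<And>n. a n [] = 1" and zero: "\<forall>\<^sub>F n in sequentially. \<forall>L. a n (0 # L) = a n L"
    and rec: "\<forall>\<^sub>F n in sequentially. \<forall>m L. a n (Suc m # L) = of_real (\<alpha> n) * a n (m # L) + of_real (\<beta> n) * (\<Sum>r<m. a n (Suc r # (m - 1 - r) # L))
       + of_real (\<gamma> n) * (\<Sum>x<length L. of_nat (L ! x) * a n ((m + L ! x) # take x L @ drop (Suc x) L))"
    and lim: "\<alpha> \<longlonglongrightarrow> \<alpha>'" "\<beta> \<longlonglongrightarrow> \<beta>'" "\<gamma> \<longlonglongrightarrow> 0"
    and M: "M 0 = 1" "\<And>m. M (Suc m) = \<alpha>' * M m + \<beta>' * (\<Sum>r<m. M (Suc r) * M (m - 1 - r))"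
  shows "(\<lambda>n. a n L) \<longlonglongrightarrow> of_real (prod_list (map M L))"
proof (induction L rule: list_moment_induct)
  case Nil show ?case by (simp add: nil)
next
  case (Zero L)
  have "\<forall>\<^sub>F n in sequentially. a n L = a n (0 # L)" by (rule eventually_mono[OF zero]) (drule spec[of _ L], erule sym)
  from tendsto_cong[THEN iffD1, OF this Zero] show ?case by (simp add: M)
next
  case (Suc m L)
  let ?del = "\<lambda>x. take x L @ drop (Suc x) L"
  have "(\<lambda>n. of_real (\<alpha> n) * a n (m # L) + of_real (\<beta> n) * (\<Sum>r<m. a n (Suc r # (m - 1 - r) # L))
       + of_real (\<gamma> n) * (\<Sum>x<length L. of_nat (L ! x) * a n ((m + L ! x) # ?del x)))
     \<longlonglongrightarrow> of_real \<alpha>' * of_real (prod_list (map M (m # L))) + of_real \<beta>' * (\<Sum>r<m. of_real (prod_list (map M (Suc r # (m - 1 - r) # L))))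
       + of_real 0 * (\<Sum>x<length L. of_nat (L ! x) * of_real (prod_list (map M ((m + L ! x) # ?del x))))"
    by (intro tendsto_add tendsto_mult tendsto_sum tendsto_of_real lim tendsto_const Suc) auto
  also have "of_real \<alpha>' * of_real (prod_list (map M (m # L))) + of_real \<beta>' * (\<Sum>r<m. of_real (prod_list (map M (Suc r # (m - 1 - r) # L))))
       + of_real 0 * (\<Sum>x<length L. of_nat (L ! x) * of_real (prod_list (map M ((m + L ! x) # ?del x))))
     = (of_real (prod_list (map M (Suc m # L))) :: complex)"
  proof -
    have "\<alpha>' * prod_list (map M (m # L)) + \<beta>' * (\<Sum>r<m. prod_list (map M (Suc r # (m - 1 - r) # L))) = prod_list (map M (Suc m # L))"
      by (simp add: M(2)[of m] distrib_right sum_distrib_right mult.assoc)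
    then show ?thesis by (simp only: of_real_add[symmetric] of_real_mult[symmetric] of_real_sum[symmetric] mult_zero_left of_real_0 add_0_right)
  qed
  finally show ?case
    by (rule Lim_transform_eventually) (rule eventually_mono[OF rec], drule spec[of _ m], drule spec[of _ L], erule sym)
qed

lemma inverse_square_partial_sum: "(\<Sum>u<m. 1 / (real u + 2)\<^sup>2) \<le> 1"
proof -
  have "(\<Sum>u<m. 1 / (real u + 2)\<^sup>2) \<le> 1 - 1 / (real m + 1)"
  proof (induction m)
    case (Suc m)
    have "1 / (real m + 2)\<^sup>2 \<le> 1 / ((real m + 1) * (real m + 2))"
      by (rule divide_left_mono) (auto simp: power2_eq_square)
    also have "\<dots> = 1 / (real m + 1) - 1 / (real (Suc m) + 1)" by (simp add: field_simps)
    finally show ?case using Suc by simp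
  qed simp
  also have "\<dots> \<le> 1" by simp
  finally show ?thesis .
qed

text \<open>Inverse squares are stable under convolution up to a constant, since (u + v)^2 \<le> 2
  (u^2 + v^2) for the two summands u, v of a fixed total. The 6 is twice the sum of the two series
  bounds 1 and 2.\<close>

lemma inverse_square_convolution:
  "(\<Sum>r<m. 1 / (real (Suc r) + 1)\<^sup>2 * (1 / (real (m - 1 - r) + 1)\<^sup>2)) \<le> 6 / (real (Suc m) + 1)\<^sup>2"
proof -
  have "1 / (real (Suc r) + 1)\<^sup>2 * (1 / (real (m - 1 - r) + 1)\<^sup>2) \<le> 2 * (1 / (real r + 2)\<^sup>2 + 1 / (real (m - 1 - r) + 1)\<^sup>2) / (real m + 2)\<^sup>2" if "r < m" for r
  proof -
    define u v where "u = real r + 2" and "v = real (m - 1 - r) + 1"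
    have uv: "u > 0" "v > 0" "u + v = real m + 2" using that by (auto simp: u_def v_def of_nat_diff)
    have "0 \<le> (u - v)\<^sup>2" by simp
    then have "(u + v)\<^sup>2 \<le> 2 * (u\<^sup>2 + v\<^sup>2)" by (simp add: power2_eq_square algebra_simps)
    then have "1 / u\<^sup>2 * (1 / v\<^sup>2) \<le> 2 * (1 / u\<^sup>2 + 1 / v\<^sup>2) / (u + v)\<^sup>2"
      using uv by (simp add: divide_simps add.commute)
    then show ?thesis unfolding uv(3) by (simp add: u_def v_def add.commute)
  qed
  then have "(\<Sum>r<m. 1 / (real (Suc r) + 1)\<^sup>2 * (1 / (real (m - 1 - r) + 1)\<^sup>2)) \<le> (\<Sum>r<m. 2 * (1 / (real r + 2)\<^sup>2 + 1 / (real (m - 1 - r) + 1)\<^sup>2) / (real m + 2)\<^sup>2)"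
    by (intro sum_mono) auto
  also have "\<dots> = 2 * ((\<Sum>r<m. 1 / (real r + 2)\<^sup>2) + (\<Sum>r<m. 1 / (real (m - 1 - r) + 1)\<^sup>2)) / (real m + 2)\<^sup>2"
    unfolding sum_divide_distrib[symmetric] sum_distrib_left[symmetric] sum.distrib ..
  also have "(\<Sum>r<m. 1 / (real (m - 1 - r) + 1)\<^sup>2) = (\<Sum>r<m. 1 / (real r + 1)\<^sup>2)"
    using sum.nat_diff_reindex[of "\<lambda>r. 1 / (real r + 1)\<^sup>2" m] by simp
  also have "2 * ((\<Sum>r<m. 1 / (real r + 2)\<^sup>2) + (\<Sum>r<m. 1 / (real r + 1)\<^sup>2)) / (real m + 2)\<^sup>2 \<le> 6 / (real m + 2)\<^sup>2"
  proof -
    have "(\<Sum>r<m. 1 / (real r + 1)\<^sup>2) \<le> 2"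
    proof (cases m)
      case (Suc k)
      show ?thesis unfolding Suc sum.lessThan_Suc_shift using inverse_square_partial_sum[of k] by (simp add: add.commute)
    qed simp
    with inverse_square_partial_sum[of m] show ?thesis by (intro divide_right_mono) auto
  qed
  finally show ?thesis by (simp add: add.commute)
qed

lemma inverse_square_le:
  fixes u v :: real
  assumes "0 < u" "u \<le> 2 * v" shows "1 / v\<^sup>2 \<le> 4 * (1 / u\<^sup>2)"
proof -
  have "4 / (2 * v)\<^sup>2 \<le> 4 / u\<^sup>2" using assms by (intro frac_le power_mono) auto
  then show ?thesis by (simp add: power_mult_distrib)
qed

text \<open>A pure power Q^j cannot be propagated, because the splitting term is a sum of m
  products; the factor 1/(j + 1)^2 absorbs that sum. The numbers 4, 6 and 4 in the condition on Q
  pay for the linear, the splitting and the joining term. Joining costs the cube of the total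
  degree, so the bound is claimed only while \<gamma> times this cube is at most 1, a range which
  the recursion never leaves since it lowers the degree.\<close>

lemma moments_growth:
  fixes a :: "nat list \<Rightarrow> complex" and \<alpha> \<beta> \<gamma> Q :: real
  defines "b \<equiv> \<lambda>j::nat. Q ^ j / (real j + 1)\<^sup>2"
  assumes nil: "a [] = 1" and zero: "\<And>L. a (0 # L) = a L"
    and rec: "\<And>m L. a (Suc m # L) = of_real \<alpha> * a (m # L) + of_real \<beta> * (\<Sum>r<m. a (Suc r # (m - 1 - r) # L))
       + of_real \<gamma> * (\<Sum>x<length L. of_nat (L ! x) * a ((m + L ! x) # take x L @ drop (Suc x) L))"
    and pos: "\<alpha> \<ge> 0" "\<beta> \<ge> 0" "\<gamma> \<ge> 0" and Q: "4 * \<alpha> + 6 * \<beta> + 4 \<le> Q"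
  shows "\<gamma> * (real (sum_list L) + 1) ^ 3 \<le> 1 \<Longrightarrow> cmod (a L) \<le> prod_list (map b L)"
proof (induction L rule: list_moment_induct)
  case Nil show ?case by (simp add: nil)
next
  case (Zero L) then show ?case by (simp add: zero b_def)
next
  case (Suc m L)
  let ?del = "\<lambda>x. take x L @ drop (Suc x) L"
  let ?P = "prod_list (map b L)" and ?S = "real (sum_list L)"
  have Q0: "Q > 0" using Q pos by linarith
  have b0: "b j > 0" for j using Q0 by (simp add: b_def)
  have P0: "?P > 0" by (induction L) (auto simp: b0)
  have mono: "\<gamma> * (real (sum_list L') + 1) ^ 3 \<le> 1" if "sum_list L' \<le> sum_list (Suc m # L)" for L'
  proof -
    have "\<gamma> * (real (sum_list L') + 1) ^ 3 \<le> \<gamma> * (real (sum_list (Suc m # L)) + 1) ^ 3"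
      using that pos by (intro mult_left_mono power_mono) auto
    with Suc.prems show ?thesis by linarith
  qed
  have nth: "sum_list L = L ! x + sum_list (?del x)" "?P = b (L ! x) * prod_list (map b (?del x))" if "x < length L" for x
    using that by (subst id_take_nth_drop[of x L]; simp)+
  define c where "c j = 1 / (real j + 1)\<^sup>2" for j :: nat
  have bc: "b j = c j * Q ^ j" for j by (simp add: b_def c_def)
  have 1: "cmod (a (m # L)) \<le> 4 * c (Suc m) * Q ^ m * ?P"
  proof -
    have "cmod (a (m # L)) \<le> b m * ?P" using Suc(1)[OF mono] by simp
    also have "b m \<le> 4 * c (Suc m) * Q ^ m"
    proof -
      have "c m \<le> 4 * c (Suc m)" unfolding c_def by (rule inverse_square_le) auto
      then show ?thesis unfolding bc using Q0 by (intro mult_right_mono) auto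
    qed
    finally show ?thesis using P0 by (simp add: mult_right_mono)
  qed
  have 2: "cmod (\<Sum>r<m. a (Suc r # (m - 1 - r) # L)) \<le> 6 * c (Suc m) * Q ^ m * ?P"
  proof -
    have "cmod (\<Sum>r<m. a (Suc r # (m - 1 - r) # L)) \<le> (\<Sum>r<m. b (Suc r) * (b (m - 1 - r) * ?P))"
      by (rule order_trans[OF norm_sum]) (rule sum_mono, rule order_trans[OF Suc(2)[OF _ mono]], auto)
    also have "\<dots> = (\<Sum>r<m. c (Suc r) * c (m - 1 - r)) * Q ^ m * ?P"
      unfolding sum_distrib_right
    proof (rule sum.cong[OF refl])
      fix r assume "r \<in> {..<m}"
      then have "Q ^ Suc r * Q ^ (m - 1 - r) = Q ^ m" unfolding power_add[symmetric] by (intro arg_cong[where f = "power Q"]) simp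
      then have "b (Suc r) * (b (m - 1 - r) * ?P) = c (Suc r) * c (m - 1 - r) * (Q ^ Suc r * Q ^ (m - 1 - r)) * ?P" by (simp add: bc)
      also note \<open>Q ^ Suc r * Q ^ (m - 1 - r) = Q ^ m\<close>
      finally show "b (Suc r) * (b (m - 1 - r) * ?P) = c (Suc r) * c (m - 1 - r) * Q ^ m * ?P" .
    qed
    also have "\<dots> \<le> 6 * c (Suc m) * Q ^ m * ?P"
      using inverse_square_convolution[of m] P0 Q0 by (intro mult_right_mono) (auto simp: c_def)
    finally show ?thesis .
  qed
  have 3: "cmod (\<Sum>x<length L. of_nat (L ! x) * a ((m + L ! x) # ?del x)) \<le> 4 * c (Suc m) * Q ^ m * ?P * (?S + 1) ^ 3"
  proof -
    \<comment> \<open>Two of the three factors \<open>?S + 1\<close> arise here, from reinstating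
      the weight \<open>c (L ! x)\<close> that the joined entry has lost; the third comes from
      summing the coefficients \<open>L ! x\<close>.\<close>
    have "cmod (of_nat (L ! x) * a ((m + L ! x) # ?del x)) \<le> real (L ! x) * (4 * c (Suc m) * Q ^ m * ?P * (?S + 1)\<^sup>2)" if x: "x < length L" for x
    proof -
      have le: "real (L ! x) \<le> ?S" using nth(1)[OF x] by simp
      have "cmod (a ((m + L ! x) # ?del x)) \<le> b (m + L ! x) * prod_list (map b (?del x))"
        using Suc(3)[OF x mono] nth(1)[OF x] by simp
      also have "\<dots> \<le> (4 * c (Suc m) * (?S + 1)\<^sup>2 * Q ^ m * b (L ! x)) * prod_list (map b (?del x))"
      proof (rule mult_right_mono)
        let ?l = "real (L ! x)"
        have "c (m + L ! x) \<le> 4 * c (Suc m)"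
          unfolding c_def by (rule inverse_square_le) auto
        moreover have "1 \<le> (?S + 1)\<^sup>2 * c (L ! x)"
        proof -
          have "(?l + 1)\<^sup>2 \<le> (?S + 1)\<^sup>2" using le by (intro power_mono) auto
          then show ?thesis by (simp add: c_def divide_simps)
        qed
        moreover have "c (m + L ! x) \<ge> 0" "c (Suc m) \<ge> 0" by (auto simp: c_def)
        ultimately have "c (m + L ! x) * 1 \<le> 4 * c (Suc m) * ((?S + 1)\<^sup>2 * c (L ! x))" by (intro mult_mono) auto
        then have "c (m + L ! x) * Q ^ (m + L ! x) \<le> 4 * c (Suc m) * ((?S + 1)\<^sup>2 * c (L ! x)) * Q ^ (m + L ! x)"
          using Q0 by (intro mult_right_mono) auto
        then show "b (m + L ! x) \<le> 4 * c (Suc m) * (?S + 1)\<^sup>2 * Q ^ m * b (L ! x)" by (simp add: bc power_add mult_ac)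
        show "0 \<le> prod_list (map b (?del x))" by (intro prod_list_nonneg) (auto intro: less_imp_le b0)
      qed
      also have "\<dots> = 4 * c (Suc m) * Q ^ m * ?P * (?S + 1)\<^sup>2" unfolding nth(2)[OF x] by (simp add: mult_ac)
      finally show ?thesis unfolding norm_mult by (simp add: mult_left_mono)
    qed
    then have "cmod (\<Sum>x<length L. of_nat (L ! x) * a ((m + L ! x) # ?del x)) \<le> (\<Sum>x<length L. real (L ! x) * (4 * c (Suc m) * Q ^ m * ?P * (?S + 1)\<^sup>2))"
      by (intro order_trans[OF norm_sum] sum_mono) auto
    also have "\<dots> = ?S * (4 * c (Suc m) * Q ^ m * ?P * (?S + 1)\<^sup>2)"
    proof -
      have "?S = (\<Sum>x<length L. real (L ! x))" by (simp add: sum_list_sum_nth atLeast0LessThan)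
      then show ?thesis by (simp only: sum_distrib_right)
    qed
    also have "\<dots> \<le> (?S + 1) * (4 * c (Suc m) * Q ^ m * ?P * (?S + 1)\<^sup>2)"
      using Q0 P0 by (intro mult_right_mono) (auto simp: c_def)
    finally show ?thesis by (simp add: power3_eq_cube power2_eq_square mult_ac)
  qed
  let ?C = "c (Suc m) * Q ^ m * ?P"
  have C0: "?C \<ge> 0" using Q0 P0 by (simp add: c_def)
  have "cmod (a (Suc m # L)) \<le> \<alpha> * (4 * ?C) + \<beta> * (6 * ?C) + \<gamma> * (4 * ?C * (?S + 1) ^ 3)"
    unfolding rec[of m L]
    by (rule order_trans[OF norm_triangle_ineq], rule add_mono, rule order_trans[OF norm_triangle_ineq], rule add_mono)
       (use 1 2 3 pos in \<open>auto simp: norm_mult mult.assoc intro!: mult_left_mono\<close>)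
  also have "\<gamma> * (4 * ?C * (?S + 1) ^ 3) \<le> 4 * ?C"
  proof -
    have "\<gamma> * (?S + 1) ^ 3 \<le> 1" by (rule mono) simp
    then have "4 * ?C * (\<gamma> * (?S + 1) ^ 3) \<le> 4 * ?C * 1" using C0 by (intro mult_left_mono) auto
    then show ?thesis by (simp add: mult_ac)
  qed
  also have "\<alpha> * (4 * ?C) + \<beta> * (6 * ?C) + 4 * ?C = (4 * \<alpha> + 6 * \<beta> + 4) * ?C" by (simp add: algebra_simps)
  also have "\<dots> \<le> Q * ?C" using Q C0 by (intro mult_right_mono) auto
  also have "\<dots> = b (Suc m) * ?P" by (simp add: bc)
  finally show ?case by simp
qed

text \<open>Two demands on the degree 2^j compete: it must be small enough for the growth bound, and
  large enough that 2 to this degree beats the size q in the Markov estimate. Taking j maximal with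
  (2^j + 1)^2 \<le> q makes the degree comparable to the square root of q, which meets both.\<close>

lemma dyadic_degree_choice:
  fixes b :: real
  shows "\<exists>N. \<forall>q\<ge>N. \<exists>j\<ge>1. (real (2 ^ j) + 1) ^ 3 * b \<le> (real q)\<^sup>2 \<and> 4 * real q \<le> 2 ^ (2 ^ j)"
proof -
  have "\<forall>\<^sub>F m in sequentially. 4 * (2 * real m + 1)\<^sup>2 \<le> 2 ^ m" by real_asymp
  then obtain m0 where m0: "\<And>m. m \<ge> m0 \<Longrightarrow> 4 * (2 * real m + 1)\<^sup>2 \<le> 2 ^ m" unfolding eventually_sequentially by blast
  obtain j0 where j0: "j0 \<ge> 1" "2 ^ j0 \<ge> m0" "real (2 ^ j0) \<ge> b"
  proof -
    define k where "k = max 1 (max m0 (nat \<lceil>b\<rceil>))"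
    have "k < 2 ^ k" by (rule less_exp)
    then have "real k \<le> real (2 ^ k)" by (intro of_nat_mono) simp
    moreover have "b \<le> real k" unfolding k_def by linarith
    ultimately have 3: "b \<le> real (2 ^ k)" by (rule order_trans[rotated])
    have 1: "1 \<le> k" and "m0 \<le> k" by (auto simp: k_def)
    from \<open>m0 \<le> k\<close> \<open>k < 2 ^ k\<close> have 2: "m0 \<le> 2 ^ k" by linarith
    show thesis by (rule that[OF 1 2 3])
  qed
  show ?thesis
  proof (rule exI[of _ "(2 ^ j0 + 1)\<^sup>2"], intro allI impI)
    fix q :: nat assume q: "q \<ge> (2 ^ j0 + 1)\<^sup>2"
    define P where "P j \<longleftrightarrow> (2 ^ j + 1)\<^sup>2 \<le> q" for j :: nat
    have bnd: "j \<le> q" if "P j" for j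
    proof -
      have "j < 2 ^ j" by (rule less_exp)
      also have "(2::nat) ^ j \<le> (2 ^ j + 1)\<^sup>2" by (simp add: power2_eq_square)
      finally show ?thesis using that by (simp add: P_def)
    qed
    define j where "j = (GREATEST j. P j)"
    have Pj: "P j" unfolding j_def by (rule GreatestI_nat[of P j0 q]) (use q bnd in \<open>auto simp: P_def\<close>)
    have jj0: "j0 \<le> j" unfolding j_def by (rule Greatest_le_nat[of P j0 q]) (use q bnd in \<open>auto simp: P_def\<close>)
    have nP: "\<not> P (Suc j)"
    proof
      assume "P (Suc j)"
      then have "Suc j \<le> j" unfolding j_def by (rule Greatest_le_nat[of P _ q]) (use bnd in auto)
      then show False by simp
    qed
    define m :: nat where "m = 2 ^ j"
    have m: "m \<ge> 2 ^ j0" unfolding m_def using jj0 by (intro power_increasing) auto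
    have "(m + 1)\<^sup>2 \<le> q" using Pj by (simp add: P_def m_def)
    then have "real ((m + 1)\<^sup>2) \<le> real q" by (rule of_nat_mono)
    then have mq: "(real m + 1)\<^sup>2 \<le> real q" by (simp only: of_nat_power of_nat_add of_nat_1)
    have "q < (2 * m + 1)\<^sup>2" using nP by (simp add: P_def m_def)
    then have "real q \<le> real ((2 * m + 1)\<^sup>2)" by (intro of_nat_mono) simp
    then have qm: "real q \<le> (2 * real m + 1)\<^sup>2" by (simp only: of_nat_power of_nat_add of_nat_1 of_nat_mult of_nat_numeral)
    have b: "b \<le> real m" by (rule order_trans[OF j0(3)]) (rule of_nat_mono[OF m])
    have "(real m + 1) ^ 3 * b \<le> (real m + 1) ^ 3 * (real m + 1)" using b by (intro mult_left_mono) auto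
    also have "\<dots> = ((real m + 1)\<^sup>2)\<^sup>2" by (simp add: power2_eq_square power3_eq_cube)
    also have "\<dots> \<le> (real q)\<^sup>2" using mq by (intro power_mono) auto
    finally have 1: "(real m + 1) ^ 3 * b \<le> (real q)\<^sup>2" .
    have "m0 \<le> m" using m j0(2) by (rule order_trans[rotated])
    from m0[OF this] qm have 2: "4 * real q \<le> 2 ^ m" by linarith
    show "\<exists>j\<ge>1. (real (2 ^ j) + 1) ^ 3 * b \<le> (real q)\<^sup>2 \<and> 4 * real q \<le> 2 ^ (2 ^ j)"
    proof (intro exI conjI)
      show "1 \<le> j" using jj0 j0(1) by simp
    qed (fact 1[unfolded m_def] 2[unfolded m_def])+
  qed
qed

section \<open>Concentration of the moments and of the operator norm\<close>

context blocks
begin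

lemma wtr_measurable [measurable]: "wtr n I J m \<in> borel_measurable (cgaussN (I \<times> J) \<tau>)"
  using polyfun_measurable[OF wtr_polyfun] by (simp add: measurable_cong_sets[OF sets_PiM_cgauss refl])

text \<open>Every trace is divided by \<open>card I\<close>. Splitting yields one trace more and so
  gains a factor \<open>card I\<close>, joining yields one fewer and loses a factor.\<close>

lemma normalized_recursion:
  assumes \<tau>: "\<tau> > 0" and q: "card I > 0"
  defines "a \<equiv> \<lambda>L. Ewtrs \<tau> L / of_nat (card I) ^ length L"
  shows "a [] = 1" "a (0 # L) = a L"
    "a (Suc m # L) = of_real (\<tau> * card J) * a (m # L) + of_real (\<tau> * card I) * (\<Sum>r<m. a (Suc r # (m - 1 - r) # L))
       + of_real (\<tau> / card I) * (\<Sum>x<length L. of_nat (L ! x) * a ((m + L ! x) # take x L @ drop (Suc x) L))"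
proof -
  interpret P: prob_space "cgaussN (I \<times> J) \<tau>" using \<tau> by (rule prob_space_cgaussN)
  have q': "(of_nat (card I) :: complex) \<noteq> 0" by (simp only: of_nat_eq_0_iff) (use q in linarith)
  show "a [] = 1" by (simp add: a_def Ewtrs_def wtrs_def P.prob_space)
  show "a (0 # L) = a L" using q' by (simp add: a_def Ewtrs_def wtrs_def K_wtr0)
  define c where "c = (of_nat (card I) :: complex)"
  have len: "length (take x L @ drop (Suc x) L) = length L - 1" if "x < length L" for x using that by simp
  have 3: "(\<Sum>x<length L. of_nat (L ! x) * Ewtrs \<tau> ((m + L ! x) # take x L @ drop (Suc x) L))
     = c ^ length L * (\<Sum>x<length L. of_nat (L ! x) * a ((m + L ! x) # take x L @ drop (Suc x) L))"
    unfolding sum_distrib_left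
  proof (rule sum.cong[OF refl])
    fix x assume "x \<in> {..<length L}"
    then have "length ((m + L ! x) # take x L @ drop (Suc x) L) = length L" by auto
    then have "a ((m + L ! x) # take x L @ drop (Suc x) L) = Ewtrs \<tau> ((m + L ! x) # take x L @ drop (Suc x) L) / c ^ length L"
      by (simp only: a_def c_def)
    then show "of_nat (L ! x) * Ewtrs \<tau> ((m + L ! x) # take x L @ drop (Suc x) L) = c ^ length L * (of_nat (L ! x) * a ((m + L ! x) # take x L @ drop (Suc x) L))"
      using q' by (simp add: c_def)
  qed
  have 2: "(\<Sum>r<m. Ewtrs \<tau> (Suc r # (m - 1 - r) # L)) = c ^ (length L + 2) * (\<Sum>r<m. a (Suc r # (m - 1 - r) # L))"
    unfolding sum_distrib_left a_def c_def using q' by (intro sum.cong) auto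
  have 1: "Ewtrs \<tau> (m # L) = c ^ (length L + 1) * a (m # L)" unfolding a_def c_def using q' by simp
  have "a (Suc m # L) = Ewtrs \<tau> (Suc m # L) / c ^ (length L + 1)" by (simp add: a_def c_def)
  also have "\<dots> = of_real \<tau> * (of_nat (card J) * a (m # L) + c * (\<Sum>r<m. a (Suc r # (m - 1 - r) # L))
       + (\<Sum>x<length L. of_nat (L ! x) * a ((m + L ! x) # take x L @ drop (Suc x) L)) / c)"
    unfolding schwinger_dyson[OF \<tau>, where m = m and L = L] 1 2 3 using q' by (simp add: c_def[symmetric] field_simps)
  finally show "a (Suc m # L) = of_real (\<tau> * card J) * a (m # L) + of_real (\<tau> * card I) * (\<Sum>r<m. a (Suc r # (m - 1 - r) # L))
       + of_real (\<tau> / card I) * (\<Sum>x<length L. of_nat (L ! x) * a ((m + L ! x) # take x L @ drop (Suc x) L))"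
    by (simp add: c_def algebra_simps)
qed

text \<open>Markov's inequality for the trace moment of degree m = 2^j: its mean is at most
  \<open>card I\<close> times Q^m, while failure of the norm bound forces it above (2 Q)^m. The
  quotient \<open>card I\<close> / 2^m is below 1/4 by the choice of j.\<close>

lemma opbound_probability:
  fixes \<tau> Q :: real
  assumes \<tau>: "\<tau> > 0" and q: "card I > 0" and Q: "4 * (\<tau> * card J) + 6 * (\<tau> * card I) + 4 \<le> Q"
    and j: "j \<ge> 1" "\<tau> / card I * (real (2 ^ j) + 1) ^ 3 \<le> 1" "4 * real (card I) \<le> 2 ^ (2 ^ j)"
  shows "measure (cgaussN (I \<times> J) \<tau>) {f \<in> space (cgaussN (I \<times> J) \<tau>). \<not> opbound (sqrt (2 * Q)) f} \<le> 1 / 4"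
proof -
  interpret P: prob_space "cgaussN (I \<times> J) \<tau>" using \<tau> by (rule prob_space_cgaussN)
  define m :: nat where "m = 2 ^ j"
  have "\<tau> * card J \<ge> 0" "\<tau> * card I \<ge> 0" using \<tau> by auto
  then have Q0: "Q > 0" using Q by linarith
  have int: "integrable (cgaussN (I \<times> J) \<tau>) (wtr n I J m)" by (rule integrable_polyfun[OF _ \<tau> wtr_polyfun]) simp
  have "cmod (Ewtrs \<tau> [m] / of_nat (card I) ^ length [m]) \<le> prod_list (map (\<lambda>j. Q ^ j / (real j + 1)\<^sup>2) [m])"
  proof (rule moments_growth[where a = "\<lambda>L. Ewtrs \<tau> L / of_nat (card I) ^ length L" and \<alpha> = "\<tau> * card J" and \<beta> = "\<tau> * card I" and \<gamma> = "\<tau> / card I"])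
    show "\<tau> / card I * (real (sum_list [m]) + 1) ^ 3 \<le> 1" using j(2) by (simp add: m_def)
  qed (fact normalized_recursion[OF \<tau> q] Q | use \<tau> in simp)+
  also have "\<dots> \<le> Q ^ m" using Q0 by (simp add: divide_le_eq mult_le_cancel_left1)
  finally have "cmod (Ewtrs \<tau> [m]) \<le> real (card I) * Q ^ m" using q by (simp add: norm_divide divide_le_eq mult.commute)
  moreover have "Ewtrs \<tau> [m] = (\<integral>f. of_real (Re (wtr n I J m f)) \<partial>cgaussN (I \<times> J) \<tau>)"
    unfolding Ewtrs_def wtrs_def
    by (rule Bochner_Integration.integral_cong[OF refl]) (simp only: list.map prod_list.Cons prod_list.Nil mult_1_right, rule wtr_real(1))
  ultimately have E: "(\<integral>f. Re (wtr n I J m f) \<partial>cgaussN (I \<times> J) \<tau>) \<le> real (card I) * Q ^ m"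
    by (simp add: integral_complex_of_real)
  have "{f \<in> space (cgaussN (I \<times> J) \<tau>). \<not> opbound (sqrt (2 * Q)) f} \<subseteq> {f \<in> space (cgaussN (I \<times> J) \<tau>). Re (wtr n I J m f) \<ge> (2 * Q) ^ m}"
  proof (intro subsetI CollectI conjI)
    fix f assume f: "f \<in> {f \<in> space (cgaussN (I \<times> J) \<tau>). \<not> opbound (sqrt (2 * Q)) f}"
    then show "f \<in> space (cgaussN (I \<times> J) \<tau>)" by simp
    show "(2 * Q) ^ m \<le> Re (wtr n I J m f)"
      using opbound_if_wtr_le[OF j(1), of f "sqrt (2 * Q)"] Q0 f by (intro leI notI) (auto simp: m_def)
  qed
  then have "P.prob {f \<in> space (cgaussN (I \<times> J) \<tau>). \<not> opbound (sqrt (2 * Q)) f} \<le> P.prob {f \<in> space (cgaussN (I \<times> J) \<tau>). Re (wtr n I J m f) \<ge> (2 * Q) ^ m}"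
    by (intro P.finite_measure_mono) auto
  also have "\<dots> \<le> (\<integral>f. Re (wtr n I J m f) \<partial>cgaussN (I \<times> J) \<tau>) / (2 * Q) ^ m"
    by (rule integral_Markov_inequality_measure[where A = "{}"]) (use int Q0 wtr_real(2) in auto)
  also have "\<dots> \<le> real (card I) * Q ^ m / (2 * Q) ^ m" using E Q0 by (intro divide_right_mono) auto
  also have "\<dots> = real (card I) / 2 ^ m" using Q0 by (simp add: power_mult_distrib)
  also have "\<dots> \<le> 1 / 4" using j(3) by (simp add: m_def divide_simps)
  finally show ?thesis .
qed

text \<open>Chebyshev's inequality. The second moment of a trace is the entry \<open>[m, m]\<close>
  of the same family, so the recursion also controls the variance.\<close>

lemma moment_deviation_probability:
  fixes \<tau> \<epsilon> M :: real
  assumes \<tau>: "\<tau> > 0" and q: "card I > 0" and \<epsilon>: "\<epsilon> > 0"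
  defines "a \<equiv> \<lambda>L. Ewtrs \<tau> L / of_nat (card I) ^ length L"
  shows "measure (cgaussN (I \<times> J) \<tau>) {f \<in> space (cgaussN (I \<times> J) \<tau>). \<not> \<bar>Re (wtr n I J m f) / card I - M\<bar> \<le> \<epsilon>}
     \<le> Re (a [m, m] - 2 * of_real M * a [m] + of_real (M\<^sup>2)) / \<epsilon>\<^sup>2"
proof -
  interpret P: prob_space "cgaussN (I \<times> J) \<tau>" using \<tau> by (rule prob_space_cgaussN)
  let ?t = "\<lambda>f. Re (wtr n I J m f) / card I"
  have int: "integrable (cgaussN (I \<times> J) \<tau>) (wtrs n I J L)" for L by (rule integrable_polyfun[OF _ \<tau> wtrs_polyfun]) simp
  have i1: "integrable (cgaussN (I \<times> J) \<tau>) (\<lambda>f. Re (wtr n I J m f))"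
    using integrable_Re[OF int[of "[m]"]] by (simp add: wtrs_def)
  have sq: "Re (wtrs n I J [m, m] f) = (Re (wtr n I J m f))\<^sup>2" for f
    using wtr_nonneg[of m f] by (auto simp: wtrs_def power2_eq_square)
  have i2: "integrable (cgaussN (I \<times> J) \<tau>) (\<lambda>f. (Re (wtr n I J m f))\<^sup>2)"
    using integrable_Re[OF int[of "[m, m]"]] by (simp only: sq)
  have E1: "Re (Ewtrs \<tau> [m]) = (\<integral>f. Re (wtr n I J m f) \<partial>cgaussN (I \<times> J) \<tau>)"
    unfolding Ewtrs_def using int[of "[m]"] by (simp add: wtrs_def flip: integral_Re)
  have E2: "Re (Ewtrs \<tau> [m, m]) = (\<integral>f. (Re (wtr n I J m f))\<^sup>2 \<partial>cgaussN (I \<times> J) \<tau>)"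
    unfolding Ewtrs_def integral_Re[OF int[of "[m, m]"], symmetric] sq ..
  have exp: "(?t f - M)\<^sup>2 = (Re (wtr n I J m f))\<^sup>2 / (real (card I))\<^sup>2 - 2 * M / card I * Re (wtr n I J m f) + M\<^sup>2" for f
    by (simp add: power2_diff power_divide)
  have i: "integrable (cgaussN (I \<times> J) \<tau>) (\<lambda>f. (?t f - M)\<^sup>2)"
    unfolding exp using i1 i2 by simp
  have "P.prob {f \<in> space (cgaussN (I \<times> J) \<tau>). \<not> \<bar>?t f - M\<bar> \<le> \<epsilon>} \<le> P.prob {f \<in> space (cgaussN (I \<times> J) \<tau>). (?t f - M)\<^sup>2 \<ge> \<epsilon>\<^sup>2}"
    using \<epsilon> by (intro P.finite_measure_mono) (auto simp: abs_le_square_iff[symmetric])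
  also have "\<dots> \<le> (\<integral>f. (?t f - M)\<^sup>2 \<partial>cgaussN (I \<times> J) \<tau>) / \<epsilon>\<^sup>2"
    by (rule integral_Markov_inequality_measure[where A = "{}"]) (use i \<epsilon> in auto)
  also have "(\<integral>f. (?t f - M)\<^sup>2 \<partial>cgaussN (I \<times> J) \<tau>) = Re (Ewtrs \<tau> [m, m]) / (real (card I))\<^sup>2 - 2 * M / card I * Re (Ewtrs \<tau> [m]) + M\<^sup>2"
    unfolding exp E1 E2 using i1 i2 by (simp add: P.prob_space)
  also have "\<dots> = Re (a [m, m] - 2 * of_real M * a [m] + of_real (M\<^sup>2))"
    by (simp add: a_def power2_eq_square flip: of_nat_mult)
  finally show ?thesis .
qed

end

theorem wishart_law_of_large_numbers:
  fixes I J :: "nat \<Rightarrow> nat set" and \<tau> :: "nat \<Rightarrow> real"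
  assumes bl: "\<forall>\<^sub>F n in sequentially. blocks n (I n) (J n)" and \<tau>: "\<forall>\<^sub>F n in sequentially. \<tau> n > 0"
    and q: "filterlim (\<lambda>n. card (I n)) at_top sequentially"
    and lim: "(\<lambda>n. \<tau> n * card (J n)) \<longlonglongrightarrow> \<alpha>" "(\<lambda>n. \<tau> n * card (I n)) \<longlonglongrightarrow> \<beta>"
    and M: "M 0 = 1" "\<And>m. M (Suc m) = \<alpha> * M m + \<beta> * (\<Sum>r<m. M (Suc r) * M (m - 1 - r))"
    and Q: "4 * \<alpha> + 6 * \<beta> + 4 < Q" and \<epsilon>: "\<epsilon> > 0"
  shows "\<forall>\<^sub>F n in sequentially. 1 / 2 \<le> measure (cgaussN (I n \<times> J n) (\<tau> n)) {f \<in> space (cgaussN (I n \<times> J n) (\<tau> n)).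
     (\<forall>m\<le>r. \<bar>Re (wtr n (I n) (J n) m f) / card (I n) - M m\<bar> \<le> \<epsilon>) \<and> blocks.opbound n (I n) (J n) (sqrt (2 * Q)) f}"
proof -
  let ?G = "\<lambda>n. cgaussN (I n \<times> J n) (\<tau> n)"
  \<comment> \<open>The recursion is available only for large n. The default for the other n is
    chosen so that the empty product has value 1 for every n, as \<open>moments_limit\<close>
    requires.\<close>
  define a where "a n L = (if blocks n (I n) (J n) \<and> \<tau> n > 0 \<and> card (I n) > 0 then blocks.Ewtrs n (I n) (J n) (\<tau> n) L / of_nat (card (I n)) ^ length L else of_bool (L = []))" for n and L :: "nat list"
  have q0: "\<forall>\<^sub>F n in sequentially. card (I n) > 0" using q[unfolded filterlim_at_top, rule_format, of 1] by eventually_elim simp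
  have good: "\<forall>\<^sub>F n in sequentially. blocks n (I n) (J n) \<and> \<tau> n > 0 \<and> card (I n) > 0"
    using bl \<tau> q0 by eventually_elim auto
  have qr: "filterlim (\<lambda>n. real (card (I n))) at_top sequentially" by (rule filterlim_compose[OF filterlim_real_sequentially q])
  have \<gamma>: "(\<lambda>n. \<tau> n / card (I n)) \<longlonglongrightarrow> 0"
  proof -
    have "(\<lambda>n. (\<tau> n * card (I n)) * (inverse (real (card (I n))) * inverse (real (card (I n))))) \<longlonglongrightarrow> \<beta> * (0 * 0)"
      by (intro tendsto_mult lim tendsto_inverse_0_at_top qr)
    then have "(\<lambda>n. (\<tau> n * card (I n)) * (inverse (real (card (I n))) * inverse (real (card (I n))))) \<longlonglongrightarrow> 0" by simp
    then show ?thesis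
      by (rule Lim_transform_eventually) (use q0 in eventually_elim, simp add: divide_inverse)
  qed
  have limit: "(\<lambda>n. a n L) \<longlonglongrightarrow> of_real (prod_list (map M L))" for L
  proof (rule moments_limit[OF _ _ _ lim \<gamma> M])
    show "a n [] = 1" for n using blocks.normalized_recursion(1)[of n "I n" "J n" "\<tau> n"] by (auto simp: a_def)
    show "\<forall>\<^sub>F n in sequentially. \<forall>L. a n (0 # L) = a n L"
      using good
    proof eventually_elim
      case (elim n)
      then show ?case using blocks.normalized_recursion(2)[of n "I n" "J n" "\<tau> n"] by (simp add: a_def)
    qed
    show "\<forall>\<^sub>F n in sequentially. \<forall>m L. a n (Suc m # L) = of_real (\<tau> n * card (J n)) * a n (m # L) + of_real (\<tau> n * card (I n)) * (\<Sum>r<m. a n (Suc r # (m - 1 - r) # L))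
       + of_real (\<tau> n / card (I n)) * (\<Sum>x<length L. of_nat (L ! x) * a n ((m + L ! x) # take x L @ drop (Suc x) L))"
      using good
    proof eventually_elim
      case (elim n)
      then have e: "a n L = blocks.Ewtrs n (I n) (J n) (\<tau> n) L / of_nat (card (I n)) ^ length L" for L by (simp add: a_def)
      from elim show ?case unfolding e by (intro allI blocks.normalized_recursion(3)) auto
    qed
  qed
  have dev: "(\<lambda>n. \<Sum>m\<le>r. Re (a n [m, m] - 2 * of_real (M m) * a n [m] + of_real ((M m)\<^sup>2)) / \<epsilon>\<^sup>2) \<longlonglongrightarrow> 0"
  proof -
    have "(\<lambda>n. \<Sum>m\<le>r. Re (a n [m, m] - 2 * of_real (M m) * a n [m] + of_real ((M m)\<^sup>2)) / \<epsilon>\<^sup>2)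
       \<longlonglongrightarrow> (\<Sum>m\<le>r. Re (of_real (prod_list (map M [m, m])) - 2 * of_real (M m) * of_real (prod_list (map M [m])) + of_real ((M m)\<^sup>2)) / \<epsilon>\<^sup>2)"
      using \<epsilon> by (intro tendsto_sum tendsto_divide tendsto_Re tendsto_add tendsto_diff tendsto_mult tendsto_const limit) auto
    then show ?thesis by (simp add: power2_eq_square)
  qed
  \<comment> \<open>The permitted failure probability 1/2 is shared: a quarter for all moments
    together, a quarter for the norm.\<close>
  then have dev': "\<forall>\<^sub>F n in sequentially. (\<Sum>m\<le>r. Re (a n [m, m] - 2 * of_real (M m) * a n [m] + of_real ((M m)\<^sup>2)) / \<epsilon>\<^sup>2) < 1 / 4"
    by (rule order_tendstoD) simp
  have Qn: "\<forall>\<^sub>F n in sequentially. 4 * (\<tau> n * card (J n)) + 6 * (\<tau> n * card (I n)) + 4 < Q"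
    by (rule order_tendstoD(2)[OF _ Q]) (intro tendsto_intros lim)
  have bn: "\<forall>\<^sub>F n in sequentially. \<tau> n * card (I n) < \<beta> + 1" by (rule order_tendstoD(2)[OF lim(2)]) simp
  obtain N where N: "\<And>q. q \<ge> N \<Longrightarrow> \<exists>j\<ge>1. (real (2 ^ j) + 1) ^ 3 * (\<beta> + 1) \<le> (real q)\<^sup>2 \<and> 4 * real q \<le> 2 ^ (2 ^ j)"
    using dyadic_degree_choice by blast
  have qN: "\<forall>\<^sub>F n in sequentially. card (I n) \<ge> N" using q by (simp add: filterlim_at_top)
  show ?thesis
    using good dev' Qn bn qN
  proof eventually_elim
    case (elim n)
    interpret blocks n "I n" "J n" using elim by blast
    have \<tau>n: "\<tau> n > 0" and qn: "card (I n) > 0" using elim by auto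
    interpret P: prob_space "?G n" using \<tau>n by (rule prob_space_cgaussN)
    have e: "a n L = Ewtrs (\<tau> n) L / of_nat (card (I n)) ^ length L" for L using elim by (simp add: a_def)
    let ?q = "real (card (I n))"
    obtain j where j: "j \<ge> 1" "(real (2 ^ j) + 1) ^ 3 * (\<beta> + 1) \<le> ?q\<^sup>2" "4 * ?q \<le> 2 ^ (2 ^ j)" using N elim by blast
    have "\<tau> n / ?q * (real (2 ^ j) + 1) ^ 3 = (real (2 ^ j) + 1) ^ 3 * (\<tau> n * ?q) / ?q\<^sup>2" using qn by (simp add: power2_eq_square)
    also have "\<dots> \<le> (real (2 ^ j) + 1) ^ 3 * (\<beta> + 1) / ?q\<^sup>2" using elim(4) by (intro divide_right_mono mult_left_mono) auto
    also have "\<dots> \<le> 1" using j(2) qn by (simp add: divide_le_eq)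
    finally have j2: "\<tau> n / ?q * (real (2 ^ j) + 1) ^ 3 \<le> 1" .
    let ?B = "{f \<in> space (?G n). \<not> opbound (sqrt (2 * Q)) f}"
    let ?D = "\<lambda>m. {f \<in> space (?G n). \<not> \<bar>Re (wtr n (I n) (J n) m f) / ?q - M m\<bar> \<le> \<epsilon>}"
    let ?S = "{f \<in> space (?G n). (\<forall>m\<le>r. \<bar>Re (wtr n (I n) (J n) m f) / ?q - M m\<bar> \<le> \<epsilon>) \<and> opbound (sqrt (2 * Q)) f}"
    have mB[measurable]: "?B \<in> sets (?G n)" unfolding opbound_iff by measurable
    have mD[measurable]: "?D m \<in> sets (?G n)" for m by measurable
    have mU: "(\<Union>m\<le>r. ?D m) \<in> sets (?G n)" by (intro sets.finite_UN mD) auto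
    have "P.prob ?B \<le> 1 / 4" by (rule opbound_probability[OF \<tau>n qn _ j(1) j2 j(3)]) (use elim in auto)
    moreover have "P.prob (\<Union>m\<le>r. ?D m) \<le> 1 / 4"
    proof -
      have "P.prob (\<Union>m\<le>r. ?D m) \<le> (\<Sum>m\<le>r. P.prob (?D m))" by (rule P.finite_measure_subadditive_finite) (use mD in auto)
      also have "\<dots> \<le> (\<Sum>m\<le>r. Re (a n [m, m] - 2 * of_real (M m) * a n [m] + of_real ((M m)\<^sup>2)) / \<epsilon>\<^sup>2)"
        unfolding e by (intro sum_mono moment_deviation_probability \<tau>n qn \<epsilon>)
      finally show ?thesis using elim(2) by linarith
    qed
    moreover have "P.prob (?B \<union> (\<Union>m\<le>r. ?D m)) \<le> P.prob ?B + P.prob (\<Union>m\<le>r. ?D m)"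
      by (rule measure_Un_le[OF mB mU])
    moreover have "P.prob (space (?G n) - (?B \<union> (\<Union>m\<le>r. ?D m))) = 1 - P.prob (?B \<union> (\<Union>m\<le>r. ?D m))"
      by (rule P.prob_compl) (use mB mU in auto)
    moreover have "space (?G n) - (?B \<union> (\<Union>m\<le>r. ?D m)) = ?S" by auto
    ultimately show ?case by simp
  qed
qed

section \<open>Moments of the Marchenko--Pastur distribution\<close>

locale mp =
  fixes l :: real
  assumes l: "l \<ge> 1"
begin

definition "u = 1 + l"
definition "lo = (1 - sqrt l)\<^sup>2"
definition "hi = (1 + sqrt l)\<^sup>2"
definition "disc x = 4 * l - (x - u)\<^sup>2" for x :: real
text \<open>Moments of the semicircle law with centre u and radius twice the square root of l. They
  are the Marchenko-Pastur moments shifted by one degree and divided by l; the shift removes the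
  factor 1/x of the density, whose support reaches 0 when l = 1.\<close>

definition "s m = integral {lo..hi} (\<lambda>x. x ^ m * sqrt (disc x)) / (2 * pi * l)" for m :: nat

lemma lo_hi: "lo = u - 2 * sqrt l" "hi = u + 2 * sqrt l" "lo < hi" "0 \<le> lo"
proof -
  show "lo = u - 2 * sqrt l" "hi = u + 2 * sqrt l" using l by (auto simp: lo_def hi_def u_def power2_sum power2_diff)
  then show "lo < hi" using l by simp
  show "0 \<le> lo" by (simp add: lo_def)
qed

lemma disc_factor: "disc x = (x - lo) * (hi - x)"
proof -
  have "sqrt l * sqrt l = l" using l by simp
  then show ?thesis unfolding disc_def lo_hi by (simp add: algebra_simps power2_eq_square)
qed

lemma disc_pos: "x \<in> {lo<..<hi} \<Longrightarrow> disc x > 0" and disc_nonneg: "x \<in> {lo..hi} \<Longrightarrow> disc x \<ge> 0"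
  by (auto simp: disc_factor)

lemma disc_ends: "disc lo = 0" "disc hi = 0" by (auto simp: disc_factor)

lemma cont_disc [continuous_intros]: "continuous_on S disc"
  unfolding disc_def by (intro continuous_intros)

lemma int_moment: "(\<lambda>x. x ^ m * sqrt (disc x)) integrable_on {lo..hi}"
  by (intro integrable_continuous_interval continuous_intros)

lemma deriv_disc: "(disc has_real_derivative 2 * (u - x)) (at x)"
  unfolding disc_def by (auto intro!: derivative_eq_intros simp: algebra_simps)

text \<open>The function x^m times \<open>disc\<close> to the power 3/2 vanishes at both ends of the
  support, so its derivative integrates to 0; expanding the derivative gives the three
  terms.\<close>

lemma s_rec: "real m * (4 * l - u\<^sup>2) * s (m - 1) + (2 * real m + 3) * u * s m - (real m + 3) * s (Suc m) = 0"
proof -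
  let ?F = "\<lambda>x. x ^ m * (disc x * sqrt (disc x))"
  let ?f = "\<lambda>x. real m * (4 * l - u\<^sup>2) * (x ^ (m - 1) * sqrt (disc x)) + (2 * real m + 3) * u * (x ^ m * sqrt (disc x)) - (real m + 3) * (x ^ Suc m * sqrt (disc x))"
  have "(?f has_integral (?F hi - ?F lo)) {lo..hi}"
  proof (rule fundamental_theorem_of_calculus_interior)
    show "continuous_on {lo..hi} ?F" by (intro continuous_intros)
    fix x assume x: "x \<in> {lo<..<hi}"
    then have d: "disc x > 0" by (rule disc_pos)
    have sq: "disc x / sqrt (disc x) = sqrt (disc x)" using d by (simp add: real_div_sqrt)
    have "(?F has_real_derivative real m * x ^ (m - 1) * (disc x * sqrt (disc x)) + x ^ m * ((2 * (u - x)) * sqrt (disc x) + disc x * ((2 * (u - x)) * (inverse (sqrt (disc x)) / 2)))) (at x)"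
      using d by (auto intro!: derivative_eq_intros deriv_disc DERIV_chain2[where f = sqrt] simp: algebra_simps)
    moreover have "real m * x ^ (m - 1) * (disc x * sqrt (disc x)) + x ^ m * ((2 * (u - x)) * sqrt (disc x) + disc x * ((2 * (u - x)) * (inverse (sqrt (disc x)) / 2))) = ?f x"
    proof -
      have "disc x * ((2 * (u - x)) * (inverse (sqrt (disc x)) / 2)) = (u - x) * (disc x / sqrt (disc x))"
        unfolding divide_inverse[of "disc x" "sqrt (disc x)"] by simp
      also have "\<dots> = (u - x) * sqrt (disc x)" unfolding sq ..
      finally have e: "disc x * ((2 * (u - x)) * (inverse (sqrt (disc x)) / 2)) = (u - x) * sqrt (disc x)" .
      have D: "disc x = 4 * l - u\<^sup>2 + 2 * u * x - x\<^sup>2" by (simp add: disc_def power2_diff algebra_simps)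
      have m: "real m * x ^ (m - 1) * x = real m * x ^ m" by (cases m) auto
      have "real m * x ^ (m - 1) * disc x = real m * x ^ (m - 1) * (4 * l - u\<^sup>2) + (real m * x ^ (m - 1) * x) * (2 * u - x)"
        unfolding D by (simp add: algebra_simps power2_eq_square)
      then have "real m * x ^ (m - 1) * (disc x * sqrt (disc x)) = (real m * x ^ (m - 1) * (4 * l - u\<^sup>2) + real m * x ^ m * (2 * u - x)) * sqrt (disc x)"
        unfolding m by (simp only: mult.assoc[symmetric])
      then show ?thesis unfolding e by (simp add: algebra_simps)
    qed
    ultimately have "(?F has_real_derivative ?f x) (at x)" by (rule back_subst)
    then show "(?F has_vector_derivative ?f x) (at x)" by (simp add: has_real_derivative_iff_has_vector_derivative)
  qed (use lo_hi in simp)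
  moreover have "(?f has_integral (real m * (4 * l - u\<^sup>2) * integral {lo..hi} (\<lambda>x. x ^ (m - 1) * sqrt (disc x)) + (2 * real m + 3) * u * integral {lo..hi} (\<lambda>x. x ^ m * sqrt (disc x)) - (real m + 3) * integral {lo..hi} (\<lambda>x. x ^ Suc m * sqrt (disc x)))) {lo..hi}"
    by (intro has_integral_diff has_integral_add has_integral_mult_right integrable_integral int_moment)
  ultimately have "real m * (4 * l - u\<^sup>2) * integral {lo..hi} (\<lambda>x. x ^ (m - 1) * sqrt (disc x)) + (2 * real m + 3) * u * integral {lo..hi} (\<lambda>x. x ^ m * sqrt (disc x)) - (real m + 3) * integral {lo..hi} (\<lambda>x. x ^ Suc m * sqrt (disc x)) = ?F hi - ?F lo"
    by (rule has_integral_unique[rotated])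
  then have E: "real m * (4 * l - u\<^sup>2) * integral {lo..hi} (\<lambda>x. x ^ (m - 1) * sqrt (disc x)) + (2 * real m + 3) * u * integral {lo..hi} (\<lambda>x. x ^ m * sqrt (disc x)) - (real m + 3) * integral {lo..hi} (\<lambda>x. x ^ Suc m * sqrt (disc x)) = 0"
    by (simp add: disc_ends)
  have "real m * (4 * l - u\<^sup>2) * s (m - 1) + (2 * real m + 3) * u * s m - (real m + 3) * s (Suc m)
    = (real m * (4 * l - u\<^sup>2) * integral {lo..hi} (\<lambda>x. x ^ (m - 1) * sqrt (disc x)) + (2 * real m + 3) * u * integral {lo..hi} (\<lambda>x. x ^ m * sqrt (disc x)) - (real m + 3) * integral {lo..hi} (\<lambda>x. x ^ Suc m * sqrt (disc x))) / (2 * pi * l)"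
    unfolding s_def add_divide_distrib diff_divide_distrib times_divide_eq_right ..
  then show ?thesis unfolding E by simp
qed

text \<open>The integral is the area of a half disc of radius r with r^2 = 4 l, that is 2 pi
  l.\<close>

lemma s_0: "s 0 = 1"
proof -
  define r where "r = 2 * sqrt l"
  have r: "r > 0" "r\<^sup>2 = 4 * l" using l by (auto simp: r_def power_mult_distrib)
  have ends: "lo = u - r" "hi = u + r" by (auto simp: lo_hi r_def)
  have disc: "disc x = r\<^sup>2 - (x - u)\<^sup>2" for x by (simp add: disc_def r)
  let ?F = "\<lambda>x. ((x - u) * sqrt (disc x) + r\<^sup>2 * arcsin ((x - u) / r)) / 2"
  have "((\<lambda>x. sqrt (disc x)) has_integral (?F hi - ?F lo)) {lo..hi}"
  proof (rule fundamental_theorem_of_calculus_interior)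
    show "continuous_on {lo..hi} ?F"
      using r by (intro continuous_intros) (auto simp: ends field_simps)
    fix x assume x: "x \<in> {lo<..<hi}"
    then have d: "disc x > 0" by (rule disc_pos)
    have b: "-1 < (x - u) / r" "(x - u) / r < 1" using x r by (auto simp: ends field_simps)
    have sq: "sqrt (1 - ((x - u) / r)\<^sup>2) = sqrt (disc x) / r"
    proof -
      have "1 - ((x - u) / r)\<^sup>2 = disc x / r\<^sup>2" 
      proof -
        have "disc x / r\<^sup>2 = r\<^sup>2 / r\<^sup>2 - (x - u)\<^sup>2 / r\<^sup>2" unfolding disc by (rule diff_divide_distrib)
        moreover have "r\<^sup>2 / r\<^sup>2 = 1" using r(1) by simp
        ultimately show ?thesis by (simp only: power_divide)
      qed
      then have "sqrt (1 - ((x - u) / r)\<^sup>2) = sqrt (disc x) / sqrt (r\<^sup>2)" by (simp only: real_sqrt_divide)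
      then show ?thesis using r(1) by (simp only: real_sqrt_abs abs_of_pos)
    qed
    have dd: "(disc has_real_derivative 2 * (u - x)) (at x)" by (rule deriv_disc)
    have "(?F has_real_derivative (1 * sqrt (disc x) + (x - u) * ((2 * (u - x)) * (inverse (sqrt (disc x)) / 2)) + r\<^sup>2 * ((1 / r) * inverse (sqrt (1 - ((x - u) / r)\<^sup>2)))) / 2) (at x)"
      using d b r by (auto intro!: derivative_eq_intros dd)
    moreover have "(1 * sqrt (disc x) + (x - u) * ((2 * (u - x)) * (inverse (sqrt (disc x)) / 2)) + r\<^sup>2 * ((1 / r) * inverse (sqrt (1 - ((x - u) / r)\<^sup>2)))) / 2 = sqrt (disc x)"
    proof -
      have ss: "sqrt (disc x) * sqrt (disc x) = disc x" using d by simp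
      have "1 * sqrt (disc x) + (x - u) * ((2 * (u - x)) * (inverse (sqrt (disc x)) / 2)) + r\<^sup>2 * ((1 / r) * inverse (sqrt (1 - ((x - u) / r)\<^sup>2)))
         = sqrt (disc x) + (r\<^sup>2 - (x - u)\<^sup>2) / sqrt (disc x)"
        unfolding sq using r d by (simp add: field_simps power2_eq_square)
      also have "\<dots> = 2 * sqrt (disc x)" unfolding disc[symmetric] using d by (simp add: real_div_sqrt)
      finally show ?thesis by simp
    qed
    ultimately have "(?F has_real_derivative sqrt (disc x)) (at x)" by (rule back_subst)
    then show "(?F has_vector_derivative sqrt (disc x)) (at x)" by (simp add: has_real_derivative_iff_has_vector_derivative)
  qed (use lo_hi in simp)
  moreover have "?F hi - ?F lo = 2 * pi * l" using r by (simp add: disc_ends) (simp add: ends arcsin_minus)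
  ultimately show ?thesis unfolding s_def using l by (simp add: integral_unique)
qed

end

text \<open>Read X as the formal variable, G as a generating series and dG as its derivative. Then
  the conclusion is 2 D H' = D' H, the differential equation solved by the square root of D, and H^2
  = D is the quadratic equation for G in completed-square form
  (\<open>riccati_final\<close>).\<close>

lemma riccati_from_ode:
  fixes X U L G dG :: "'a :: idom"
  defines "D \<equiv> 1 - 2 * U * X - (4 * L - U\<^sup>2) * X\<^sup>2" and "H \<equiv> 1 - U * X - 2 * L * X\<^sup>2 * G"
  assumes "X * D * dG = G * ((4 * L - U\<^sup>2) * X\<^sup>2 + 3 * U * X - 2) + 2"
  shows "D * (2 * (- U - 4 * L * X * G - 2 * L * X\<^sup>2 * dG)) = (- 2 * U - 2 * (4 * L - U\<^sup>2) * X) * H"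
proof -
  have "D * (2 * (- U - 4 * L * X * G - 2 * L * X\<^sup>2 * dG)) - (- 2 * U - 2 * (4 * L - U\<^sup>2) * X) * H
    = - 4 * L * X * (X * D * dG - (G * ((4 * L - U\<^sup>2) * X\<^sup>2 + 3 * U * X - 2) + 2))"
    unfolding D_def H_def by (simp add: algebra_simps power2_eq_square power3_eq_cube)
  then show ?thesis using assms(3) by simp
qed

lemma riccati_final:
  fixes X U L G :: "'a :: idom"
  assumes "(1 - U * X - 2 * L * X\<^sup>2 * G) * (1 - U * X - 2 * L * X\<^sup>2 * G) = 1 - 2 * U * X - (4 * L - U\<^sup>2) * X\<^sup>2"
  shows "4 * L * X\<^sup>2 * (G - (1 + U * X * G + L * X\<^sup>2 * G\<^sup>2)) = 0"
proof -
  have "4 * L * X\<^sup>2 * (G - (1 + U * X * G + L * X\<^sup>2 * G\<^sup>2)) = (1 - 2 * U * X - (4 * L - U\<^sup>2) * X\<^sup>2) - (1 - U * X - 2 * L * X\<^sup>2 * G) * (1 - U * X - 2 * L * X\<^sup>2 * G)"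
    by (simp add: algebra_simps power2_eq_square power3_eq_cube)
  then show ?thesis using assms by simp
qed

text \<open>The quotient P / D has derivative 0 and constant term 1.\<close>

lemma fps_eq_if_log_deriv_eq:
  fixes P D :: "real fps"
  assumes eq: "fps_deriv P * D = fps_deriv D * P" and 0: "fps_nth P 0 = 1" "fps_nth D 0 = 1"
  shows "P = D"
proof -
  have i: "inverse D * D = 1" using 0 by (intro inverse_mult_eq_1) simp
  have "fps_deriv (P * inverse D) = fps_deriv P * inverse D * (inverse D * D) - P * fps_deriv D * (inverse D)\<^sup>2"
    unfolding i using 0 by (simp add: fps_inverse_deriv)
  also have "\<dots> = (fps_deriv P * D - fps_deriv D * P) * (inverse D)\<^sup>2" by (simp add: power2_eq_square algebra_simps)
  also have "\<dots> = 0" using eq by simp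
  finally have "P * inverse D = fps_const (fps_nth (P * inverse D) 0)" using fps_deriv_eq_0_iff by blast
  then have "P * inverse D = 1" using 0 by simp
  then have "P * inverse D * D = D" by simp
  then show ?thesis using i by (simp add: mult.assoc)
qed

context mp
begin

text \<open>Gaussian integration by parts gives a quadratic recursion, integration against the
  density a linear one. The linear recursion is a first-order differential equation for the
  generating series G; it forces H H = D because both sides have the same logarithmic derivative and
  constant term. Cancelling 4 L X^2 in the domain of power series leaves G = 1 + U X G + L X^2 G^2,
  whose coefficients are the claim.\<close>

lemma s_convolution: "s (Suc m) = u * s m + l * (\<Sum>i<m. s i * s (m - 1 - i))"
proof -
  define G where "G = Abs_fps s"
  define c0 where "c0 = 4 * l - u\<^sup>2"
  define X U L where "X = (fps_X :: real fps)" and "U = fps_const u" and "L = fps_const l"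
  define D where "D = 1 - 2 * U * X - (4 * L - U\<^sup>2) * X\<^sup>2"
  define H where "H = 1 - U * X - 2 * L * X\<^sup>2 * G"
  have num: "(4 * L - U\<^sup>2) = fps_const c0" "2 * U = fps_const (2 * u)" "3 * U = fps_const (3 * u)" "(2 :: real fps) = fps_const 2"
    by (simp_all add: L_def U_def c0_def fps_numeral_fps_const power2_eq_square)
  have XG: "fps_nth (X ^ k * F) n = (if n < k then 0 else fps_nth F (n - k))" for k n F
    unfolding X_def by (rule fps_X_power_mult_nth)
  have X1: "fps_nth (X * F) n = (if n = 0 then 0 else fps_nth F (n - 1))" for n F
    unfolding X_def by (rule fps_X_mult_nth)
  have ode': "X * fps_deriv G - fps_const (2 * u) * (X ^ 2 * fps_deriv G) - fps_const c0 * (X ^ 3 * fps_deriv G)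
     = fps_const c0 * (X ^ 2 * G) + fps_const (3 * u) * (X * G) - fps_const 2 * G + fps_const 2" (is "?l = ?r")
  proof (rule fps_ext)
    fix n
    note nth = fps_sub_nth fps_add_nth fps_mult_left_const_nth XG X1 fps_deriv_nth fps_nth_fps_const G_def fps_nth_Abs_fps
    \<comment> \<open>Degree n is the instance n - 1 of \<open>s_rec\<close>; the lowest degrees
      stand apart because some shifted coefficients are still zero there.\<close>
    consider "n = 0" | "n = 1" | "n = 2" | j where "n = Suc (Suc (Suc j))" by (metis One_nat_def Suc_1 not0_implies_Suc)
    then show "fps_nth ?l n = fps_nth ?r n"
    proof cases
      case 1 then show ?thesis unfolding nth by (simp add: s_0)
    next
      case 2 then show ?thesis unfolding nth using s_rec[of 0] by (simp add: s_0)
    next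
      case 3 then show ?thesis unfolding nth using s_rec[of 1] by (simp add: c0_def numeral_2_eq_2)
    next
      case 4 then show ?thesis unfolding nth using s_rec[of "Suc (Suc j)"] by (simp add: c0_def) (simp add: algebra_simps)
    qed
  qed
  have "X * D * fps_deriv G = X * fps_deriv G - 2 * U * (X ^ 2 * fps_deriv G) - (4 * L - U\<^sup>2) * (X ^ 3 * fps_deriv G)"
    unfolding D_def by (simp add: algebra_simps power2_eq_square power3_eq_cube)
  also have "\<dots> = (4 * L - U\<^sup>2) * (X ^ 2 * G) + 3 * U * (X * G) - 2 * G + 2"
    using ode' unfolding num(1-3) by (simp add: fps_numeral_fps_const)
  also have "\<dots> = G * ((4 * L - U\<^sup>2) * X\<^sup>2 + 3 * U * X - 2) + 2" by (simp add: algebra_simps power2_eq_square power3_eq_cube)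
  finally have ode: "X * D * fps_deriv G = G * ((4 * L - U\<^sup>2) * X\<^sup>2 + 3 * U * X - 2) + 2" .
  have dc: "fps_deriv X = 1" "fps_deriv U = 0" "fps_deriv L = 0" by (simp_all add: X_def U_def L_def)
  have dnum: "fps_deriv (numeral k :: real fps) = 0" for k by (simp add: fps_numeral_fps_const)
  have dD: "fps_deriv D = - 2 * U - 2 * (4 * L - U\<^sup>2) * X"
    by (simp add: D_def dc dnum power2_eq_square algebra_simps)
  have dH: "fps_deriv H = - U - 4 * L * X * G - 2 * L * X\<^sup>2 * fps_deriv G"
    by (simp add: H_def dc dnum power2_eq_square algebra_simps)
  have H2: "D * (2 * fps_deriv H) = fps_deriv D * H"
    unfolding dH dD using riccati_from_ode[of X U L "fps_deriv G" G] ode unfolding D_def H_def by blast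
  have "H * H = D"
  proof (rule fps_eq_if_log_deriv_eq)
    have "fps_deriv (H * H) = fps_deriv H * H + H * fps_deriv H" by simp
    moreover have "(fps_deriv H * H + H * fps_deriv H) * D = H * (D * (2 * fps_deriv H))" by (simp add: algebra_simps power2_eq_square power3_eq_cube)
    ultimately show "fps_deriv (H * H) * D = fps_deriv D * (H * H)" unfolding H2 by (simp add: mult_ac)
    show "fps_nth (H * H) 0 = 1" "fps_nth D 0 = 1" by (simp_all add: H_def D_def X_def)
  qed
  then have "4 * L * X\<^sup>2 * (G - (1 + U * X * G + L * X\<^sup>2 * G\<^sup>2)) = 0"
    unfolding H_def D_def by (rule riccati_final)
  moreover have "4 * L * X\<^sup>2 \<noteq> 0" using l by (simp add: L_def X_def)
  ultimately have "G - (1 + U * X * G + L * X\<^sup>2 * G\<^sup>2) = 0" using mult_eq_0_iff by blast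
  then have G: "G = 1 + U * (X * G) + L * (X ^ 2 * (G * G))" by (simp add: power2_eq_square mult.assoc)
  have "s (Suc m) = fps_nth (1 + U * (X * G) + L * (X ^ 2 * (G * G))) (Suc m)" unfolding G[symmetric] by (simp add: G_def)
  also have "\<dots> = fps_nth 1 (Suc m) + u * fps_nth G m + l * fps_nth (X ^ 2 * (G * G)) (Suc m)"
    by (simp only: U_def L_def fps_add_nth fps_mult_left_const_nth X1) simp
  also have "\<dots> = u * s m + l * (if m = 0 then 0 else fps_nth (G * G) (m - 1))"
    unfolding XG by (cases m) (simp_all add: G_def)
  also have "(if m = 0 then 0 else fps_nth (G * G) (m - 1)) = (\<Sum>i<m. s i * s (m - 1 - i))"
    by (cases m) (simp_all add: fps_mult_nth G_def atLeast0AtMost lessThan_Suc_atMost)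
  finally show ?thesis .
qed

lemma sets_marchenko_pastur [simp]: "sets (marchenko_pastur l) = sets borel" by (simp add: marchenko_pastur_def)

text \<open>One power of x cancels the denominator of the density and leaves a continuous integrand,
  so the Lebesgue integral becomes the gauge integral in \<open>s\<close>.\<close>

lemma mp_integral:
  "(\<integral>x. x ^ Suc m \<partial>marchenko_pastur l) = l * s m"
proof -
  have e: "4 * l - (x - 1 - l)\<^sup>2 = disc x" for x by (simp add: disc_def u_def diff_diff_eq)
  have MP: "marchenko_pastur l = density lborel (\<lambda>x. ennreal (indicator {lo..hi} x * (sqrt (disc x) / (2 * pi * x))))"
    unfolding marchenko_pastur_def e lo_def hi_def ..
  have [measurable]: "disc \<in> borel_measurable borel" unfolding disc_def by measurable
  have "AE x in lborel. 0 \<le> indicator {lo..hi} x * (sqrt (disc x) / (2 * pi * x))"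
  proof (rule AE_I2)
    fix x
    have "0 \<le> sqrt (disc x) / (2 * pi * x)" if "x \<in> {lo..hi}"
      using that lo_hi(4) disc_nonneg[OF that] by (intro divide_nonneg_nonneg) auto
    then show "0 \<le> indicator {lo..hi} x * (sqrt (disc x) / (2 * pi * x))" by (auto simp: indicator_def)
  qed
  then have "(\<integral>x. x ^ Suc m \<partial>marchenko_pastur l) = (\<integral>x. (indicator {lo..hi} x * (sqrt (disc x) / (2 * pi * x))) *\<^sub>R x ^ Suc m \<partial>lborel)"
    unfolding MP by (intro integral_density) auto
  also have "\<dots> = (\<integral>x. indicator {lo..hi} x *\<^sub>R (x ^ m * sqrt (disc x) / (2 * pi)) \<partial>lborel)"
  proof (rule Bochner_Integration.integral_cong[OF refl])
    fix x
    have "sqrt (disc x) / (2 * pi * x) * x ^ Suc m = x ^ m * sqrt (disc x) / (2 * pi)" if "x \<in> {lo..hi}"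
    proof (cases "x = 0")
      \<comment> \<open>This happens only when the support reaches 0. Division by 0 gives 0 on the
        left, and on the right \<open>disc\<close> vanishes at the end point.\<close>
      case True
      with that lo_hi(4) have "lo = 0" by auto
      then show ?thesis using True disc_ends by simp
    qed simp
    then show "(indicator {lo..hi} x * (sqrt (disc x) / (2 * pi * x))) *\<^sub>R x ^ Suc m = indicator {lo..hi} x *\<^sub>R (x ^ m * sqrt (disc x) / (2 * pi))"
      by (auto simp: indicator_def)
  qed
  also have "\<dots> = integral {lo..hi} (\<lambda>x. x ^ m * sqrt (disc x) / (2 * pi))"
  proof -
    have "set_integrable lborel {lo..hi} (\<lambda>x. x ^ m * sqrt (disc x) / (2 * pi))"
      by (rule borel_integrable_atLeastAtMost') (intro continuous_intros, simp)
    from set_borel_integral_eq_integral(2)[OF this] show ?thesis unfolding set_lebesgue_integral_def .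
  qed
  also have "\<dots> = integral {lo..hi} (\<lambda>x. x ^ m * sqrt (disc x)) / (2 * pi)" by simp
  also have "\<dots> = l * s m" using l by (simp add: s_def)
  finally show ?thesis .
qed

end

text \<open>In the sum over r the last term contains M 0 = 1. Separating it accounts for the
  difference between the coefficient 1 + \<theta> of \<open>s_convolution\<close> and \<theta> here.
  The value M 0 is supplied by \<open>prob_space\<close>, since \<open>mp_integral\<close> starts at
  degree one.\<close>

theorem scaled_marchenko_pastur_moments:
  fixes \<theta> \<kappa> :: real
  assumes \<theta>: "\<theta> \<ge> 1" and \<mu>: "\<mu> = distr (marchenko_pastur \<theta>) borel (\<lambda>t. \<kappa> * t)" "prob_space \<mu>"
  defines "M \<equiv> \<lambda>m. \<integral>t. t ^ m \<partial>\<mu>"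
  shows "M 0 = 1" "M (Suc m) = \<kappa> * \<theta> * M m + \<kappa> * (\<Sum>r<m. M (Suc r) * M (m - 1 - r))"
proof -
  interpret mp \<theta> by unfold_locales (rule \<theta>)
  interpret prob_space \<mu> by (rule \<mu>(2))
  have M0: "M 0 = 1" by (simp add: M_def prob_space)
  then show "M 0 = 1" .
  have MS: "M (Suc k) = \<kappa> ^ Suc k * (\<theta> * s k)" for k
  proof -
    have "M (Suc k) = (\<integral>t. (\<kappa> * t) ^ Suc k \<partial>marchenko_pastur \<theta>)"
      unfolding M_def \<mu>(1) by (rule integral_distr) (auto simp: marchenko_pastur_def)
    then show ?thesis by (simp only: power_mult_distrib integral_mult_right_zero mp_integral)
  qed
  show "M (Suc m) = \<kappa> * \<theta> * M m + \<kappa> * (\<Sum>r<m. M (Suc r) * M (m - 1 - r))"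
  proof (cases m)
    case 0 then show ?thesis by (simp add: MS M0 s_0)
  next
    case (Suc k)
    have "(\<Sum>r<k. M (Suc r) * M (k - r)) = (\<Sum>r<k. \<kappa> ^ Suc k * (\<theta>\<^sup>2 * (s r * s (k - 1 - r))))"
    proof (rule sum.cong[OF refl])
      fix r assume "r \<in> {..<k}"
      then have "r < k" by simp
      then have k: "k - r = Suc (k - 1 - r)" "Suc r + Suc (k - 1 - r) = Suc k" by arith+
      define j where "j = k - 1 - r"
      have "\<kappa> ^ Suc k = \<kappa> ^ Suc r * \<kappa> ^ Suc j" using k(2) by (simp only: power_add[symmetric] j_def)
      then show "M (Suc r) * M (k - r) = \<kappa> ^ Suc k * (\<theta>\<^sup>2 * (s r * s (k - 1 - r)))"
        unfolding k(1) MS j_def[symmetric] by (simp only: power2_eq_square mult_ac)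
    qed
    also have "\<dots> = \<kappa> ^ Suc k * \<theta>\<^sup>2 * (\<Sum>r<k. s r * s (k - 1 - r))" by (simp add: sum_distrib_left mult.assoc)
    finally have S: "(\<Sum>r<Suc k. M (Suc r) * M (Suc k - 1 - r)) = \<kappa> ^ Suc k * \<theta>\<^sup>2 * (\<Sum>r<k. s r * s (k - 1 - r)) + M (Suc k)"
      by (simp add: M0)
    show ?thesis unfolding Suc S unfolding MS s_convolution[of k] u_def by (simp add: algebra_simps power2_eq_square)
  qed
qed

section \<open>Operators in a rectangular probability space\<close>

lemma parallelogram_functional:
  fixes x y :: "'a :: real_inner"
  assumes "linear f"
  defines "Q \<equiv> \<lambda>x. inner x x - 2 * f x"
  shows "Q x + Q y - 2 * Q ((1/2) *\<^sub>R (x + y)) = inner (x - y) (x - y) / 2"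
proof -
  have f: "f ((1/2) *\<^sub>R (x + y)) = (f x + f y) / 2"
    using assms(1) by (simp add: linear_add linear_scale)
  show ?thesis unfolding Q_def f by (simp add: inner_add inner_diff inner_commute field_simps)
qed

text \<open>w minimizes |x|^2 - 2 f(x). The parallelogram identity bounds the distance of two
  near-minimizers, so a minimizing sequence is Cauchy, and the first variation at the limit
  vanishes.\<close>

theorem riesz_representation:
  fixes f :: "'a :: {real_inner, complete_space} \<Rightarrow> real"
  assumes "bounded_linear f"
  shows "\<exists>w. \<forall>x. f x = inner w x"
proof -
  interpret f: bounded_linear f by fact
  define Q where "Q x = inner x x - 2 * f x" for x
  have par: "Q x + Q y - 2 * Q ((1/2) *\<^sub>R (x + y)) = (norm (x - y))\<^sup>2 / 2" for x y
    using parallelogram_functional[OF f.linear_axioms, of x y] by (simp add: Q_def power2_norm_eq_inner)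
  obtain C where C: "\<And>x. norm (f x) \<le> norm x * C" using f.bounded by blast
  have lower: "- C\<^sup>2 \<le> Q x" for x
  proof -
    have "0 \<le> (norm x - C)\<^sup>2" by simp
    moreover have "f x \<le> norm x * C" using C[of x] by simp
    ultimately show ?thesis by (simp add: Q_def power2_norm_eq_inner[symmetric] power2_diff)
  qed
  define m where "m = (INF x. Q x)"
  have bdd: "bdd_below (range Q)" using lower by (auto intro!: bdd_belowI)
  have mle: "m \<le> Q x" for x unfolding m_def by (rule cINF_lower[OF bdd]) simp
  have "\<exists>x. Q x < m + 1 / real (Suc n)" for n
  proof -
    have "(INF x. Q x) < m + 1 / real (Suc n)" unfolding m_def by simp
    then show ?thesis by (subst (asm) cINF_less_iff) (use bdd in auto)
  qed
  then obtain x where x: "\<And>n. Q (x n) < m + 1 / real (Suc n)" by metis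
  have close: "(norm (x i - x j))\<^sup>2 \<le> 2 / real (Suc i) + 2 / real (Suc j)" for i j
    using par[of "x i" "x j"] x[of i] x[of j] mle[of "(1/2) *\<^sub>R (x i + x j)"] by simp
  have "Cauchy x"
  proof (rule metric_CauchyI)
    fix e :: real assume e: "e > 0"
    obtain N where N: "4 / e\<^sup>2 < real N" using reals_Archimedean2 by blast
    show "\<exists>M. \<forall>m\<ge>M. \<forall>n\<ge>M. dist (x m) (x n) < e"
    proof (intro exI allI impI)
      fix i j assume ij: "i \<ge> N" "j \<ge> N"
      have N0: "real (Suc N) > 0" by simp
      have "2 / real (Suc i) \<le> 2 / real (Suc N)" "2 / real (Suc j) \<le> 2 / real (Suc N)"
        using ij by (auto intro!: divide_left_mono)
      then have "(norm (x i - x j))\<^sup>2 \<le> 4 / real (Suc N)" using close[of i j] by simp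
      also have "\<dots> < e\<^sup>2"
      proof -
        have "4 < real N * e\<^sup>2" using N e by (simp add: pos_divide_less_eq)
        also have "\<dots> \<le> real (Suc N) * e\<^sup>2" by (intro mult_right_mono) auto
        finally show ?thesis using N0 by (simp add: pos_divide_less_eq mult.commute)
      qed
      finally have "norm (x i - x j) < e" by (rule power_less_imp_less_base) (use e in simp)
      then show "dist (x i) (x j) < e" by (simp add: dist_norm)
    qed
  qed
  then obtain w where w: "x \<longlonglongrightarrow> w" using Cauchy_convergent_iff convergent_def by blast
  have "(\<lambda>n. Q (x n)) \<longlonglongrightarrow> Q w" unfolding Q_def by (intro tendsto_intros w f.tendsto)
  moreover have "(\<lambda>n. m + 1 / real (Suc n)) \<longlonglongrightarrow> m + 0"
    by (intro tendsto_add tendsto_const LIMSEQ_Suc[OF lim_const_over_n])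
  ultimately have Qw: "Q w \<le> m" using x by (intro LIMSEQ_le[of "\<lambda>n. Q (x n)" _ "\<lambda>n. m + 1 / real (Suc n)"]) (auto intro!: exI[of _ 0] less_imp_le)
  show ?thesis
  proof (intro exI[of _ w] allI)
    fix v
    define b where "b = inner w v - f v"
    have q: "0 \<le> t * t * inner v v + 2 * t * b" for t
      using order_trans[OF Qw mle[of "w + t *\<^sub>R v"]]
      by (simp add: Q_def b_def inner_add f.add f.scale algebra_simps inner_commute)
    have "b = 0"
    proof (rule ccontr)
      assume b: "b \<noteq> 0"
      \<comment> \<open>Used in the test value t = - b / s: the summand 1 keeps s positive even for
        v = 0 and makes the quadratic expression strictly negative.\<close>
      define s where "s = inner v v + 1"
      have s: "s > 0" using inner_ge_zero[of v] unfolding s_def by linarith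
      have "0 \<le> (- b / s) * (- b / s) * inner v v + 2 * (- b / s) * b" by (rule q)
      also have "\<dots> = (b\<^sup>2 / s) * (inner v v / s - 2)" using s by (simp add: power2_eq_square field_simps)
      also have "\<dots> < 0"
      proof (rule mult_pos_neg)
        show "0 < b\<^sup>2 / s" using b s by simp
        have "inner v v / s \<le> 1" using s by (simp add: s_def)
        then show "inner v v / s - 2 < 0" by simp
      qed
      finally show False by simp
    qed
    then show "f v = inner w v" by (simp add: b_def)
  qed
qed

lemma Im_cinner: "Im (cinner x y) = inner x (scaleC (- \<i>) y)" for x y :: "'h :: chilbert_space"
  by (simp flip: Re_cinner add: cinner_scaleC_right)

lemma cinner_ext: "(\<And>y. cinner x y = cinner x' y) \<Longrightarrow> x = x'" for x x' :: "'h :: chilbert_space"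
proof -
  assume "\<And>y. cinner x y = cinner x' y"
  then have "inner x y = inner x' y" for y by (simp flip: Re_cinner)
  then have "inner (x - x') (x - x') = 0" by (simp add: inner_diff_left)
  then show "x = x'" by simp
qed

text \<open>\<open>op_adj\<close> is a definite description and carries no information until
  existence and uniqueness are shown. Riesz is applied to the real inner product; complex linearity
  of T recovers the imaginary part, which is the real inner product with a rotated vector.\<close>

lemma op_adj_exists:
  fixes T :: "('h :: chilbert_space) bop"
  assumes T: "clinear_op T"
  shows "\<exists>S. \<forall>x y. cinner (blinfun_apply S x) y = cinner x (blinfun_apply T y)"
proof -
  have "\<exists>w. \<forall>y. inner x (blinfun_apply T y) = inner w y" for x
    by (rule riesz_representation) (intro bounded_linear_intros)
  then obtain S where S: "\<And>x y. inner x (blinfun_apply T y) = inner (S x) y" by metis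
  have ext: "u = v" if "\<And>y. inner u y = inner v y" for u v :: 'h
  proof -
    have "inner (u - v) (u - v) = 0" using that by (simp add: inner_diff_left)
    then show ?thesis by simp
  qed
  have bl: "bounded_linear S"
  proof (rule bounded_linear_intro[where K = "norm T"])
    show "S (x + y) = S x + S y" for x y by (rule ext) (simp add: S[symmetric] inner_add_left)
    show "S (r *\<^sub>R x) = r *\<^sub>R S x" for r x by (rule ext) (simp add: S[symmetric])
    show "norm (S x) \<le> norm x * norm T" for x
    proof -
      have "norm (S x) * norm (S x) = inner x (blinfun_apply T (S x))" by (simp add: S power2_eq_square[symmetric] power2_norm_eq_inner)
      also have "\<dots> \<le> norm x * norm (blinfun_apply T (S x))" by (rule norm_cauchy_schwarz)
      also have "\<dots> \<le> norm x * (norm T * norm (S x))" by (intro mult_left_mono norm_blinfun) simp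
      finally show ?thesis by (cases "norm (S x) = 0") (auto simp: mult_ac)
    qed
  qed
  have "cinner (S x) y = cinner x (blinfun_apply T y)" for x y
  proof (rule complex_eqI)
    show "Re (cinner (S x) y) = Re (cinner x (blinfun_apply T y))" by (simp add: Re_cinner S)
    show "Im (cinner (S x) y) = Im (cinner x (blinfun_apply T y))"
      using T S[of x "scaleC (- \<i>) y"] by (simp add: Im_cinner clinear_op_def)
  qed
  then show ?thesis by (intro exI[of _ "Blinfun S"]) (simp add: bounded_linear_Blinfun_apply[OF bl])
qed

lemma op_adj_cinner:
  fixes T :: "('h :: chilbert_space) bop"
  assumes T: "clinear_op T"
  shows "cinner (blinfun_apply (op_adj T) x) y = cinner x (blinfun_apply T y)"
proof -
  have "\<exists>!S. \<forall>x y. cinner (blinfun_apply S x) y = cinner x (blinfun_apply T y)"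
  proof (rule ex_ex1I[OF op_adj_exists[OF T]])
    fix S S' assume "\<forall>x y. cinner (blinfun_apply S x) y = cinner x (blinfun_apply T y)" "\<forall>x y. cinner (blinfun_apply S' x) y = cinner x (blinfun_apply T y)"
    then show "S = S'" by (intro blinfun_eqI cinner_ext) simp
  qed
  from theI'[OF this] show ?thesis unfolding op_adj_def by blast
qed

lemma op_adj_eqI:
  fixes T S :: "('h :: chilbert_space) bop"
  assumes "clinear_op T" "\<And>x y. cinner (blinfun_apply S x) y = cinner x (blinfun_apply T y)"
  shows "op_adj T = S"
  by (intro blinfun_eqI cinner_ext) (simp add: op_adj_cinner assms)

lemma bop_assoc: "(S o\<^sub>L T) o\<^sub>L U = S o\<^sub>L (T o\<^sub>L U)" for S T U :: "('h :: chilbert_space) bop"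
  by (rule blinfun_eqI) simp

lemma bop_id [simp]: "id_blinfun o\<^sub>L T = T" "T o\<^sub>L id_blinfun = T" for T :: "('h :: chilbert_space) bop"
  by (rule blinfun_eqI, simp)+

lemma clinear_op_comp: "clinear_op S \<Longrightarrow> clinear_op T \<Longrightarrow> clinear_op (S o\<^sub>L T)"
  by (simp add: clinear_op_def)

lemma clinear_op_add: "clinear_op S \<Longrightarrow> clinear_op T \<Longrightarrow> clinear_op (S + T)"
  by (simp add: clinear_op_def scaleC_add_right blinfun.add_left)

lemma op_adj_comp: "clinear_op S \<Longrightarrow> clinear_op T \<Longrightarrow> op_adj (S o\<^sub>L T) = op_adj T o\<^sub>L op_adj S"
  by (rule op_adj_eqI) (auto simp: clinear_op_comp op_adj_cinner)

text \<open>The bicommutant identity is the only source of closure properties of a von Neumann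
  algebra here: sums, products and 0 stay in A because A is itself a commutant.\<close>

lemma commutant_comp: "S \<in> commutant X \<Longrightarrow> T \<in> commutant X \<Longrightarrow> S o\<^sub>L T \<in> commutant X"
proof -
  assume ST: "S \<in> commutant X" "T \<in> commutant X"
  have "(S o\<^sub>L T) o\<^sub>L s = s o\<^sub>L (S o\<^sub>L T)" if "s \<in> X" for s
  proof -
    have "(S o\<^sub>L T) o\<^sub>L s = S o\<^sub>L (s o\<^sub>L T)" using ST that by (simp add: commutant_def bop_assoc)
    also have "\<dots> = (s o\<^sub>L S) o\<^sub>L T" using ST that by (simp add: commutant_def bop_assoc[symmetric])
    finally show ?thesis by (simp add: bop_assoc)
  qed
  then show ?thesis using ST by (simp add: commutant_def clinear_op_comp)
qed

lemma commutant_add: "S \<in> commutant X \<Longrightarrow> T \<in> commutant X \<Longrightarrow> S + T \<in> commutant X"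
  unfolding commutant_def by (auto simp: clinear_op_add
      bounded_bilinear.add_left[OF bounded_bilinear_blinfun_compose] bounded_bilinear.add_right[OF bounded_bilinear_blinfun_compose])

lemma commutant_zero: "0 \<in> commutant X"
proof -
  have "scaleC c (0 :: 'a :: chilbert_space) = 0" for c using norm_scaleC[of c "0 :: 'a"] by simp
  then show ?thesis unfolding commutant_def by (auto simp: clinear_op_def)
qed

section \<open>Words in an off-diagonal element and its adjoint\<close>

definition alt_word :: "bool \<Rightarrow> nat \<Rightarrow> bool list" where
  "alt_word h m = concat (replicate m [h, \<not> h])"

lemma alt_word_Suc: "alt_word h (Suc m) = h # (\<not> h) # alt_word h m"
  by (simp add: alt_word_def)

lemma length_alt_word [simp]: "length (alt_word h m) = 2 * m"
  by (induction m) (auto simp: alt_word_Suc alt_word_def[of _ 0])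

text \<open>Alternating words with different end letters have even length and are powers of a
  two-letter word. The other alternating words begin and end with the same letter, hence map between
  different corners, and E does not see them.\<close>

lemma successively_neq_classification:
  assumes "es \<noteq> []" "successively (\<noteq>) es" "hd es \<noteq> last es"
  shows "\<exists>m\<ge>1. es = alt_word (hd es) m"
  using assms
proof (induction "length es" arbitrary: es rule: less_induct)
  case less
  then obtain a b es' where es: "es = a # b # es'" by (cases es; cases "tl es") auto
  have b: "b = (\<not> a)" using less.prems by (auto simp: es)
  show ?case
  proof (cases "es' = []")
    case True
    then have "es = alt_word (hd es) 1" by (simp add: es b alt_word_def)
    then show ?thesis by blast
  next
    case False
    then obtain e es'' where es': "es' = e # es''" by (cases es') auto
    have "e = a" using less.prems by (auto simp: es es' b)
    moreover have "\<exists>m\<ge>1. es' = alt_word (hd es') m"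
    proof (rule less(1))
      show "length es' < length es" by (simp add: es)
      show "es' \<noteq> []" by fact
      show "successively (\<noteq>) es'" using less.prems(2) unfolding es es' by simp
      show "hd es' \<noteq> last es'" using less.prems(3) \<open>e = a\<close> unfolding es es' by simp
    qed
    ultimately obtain m where "es' = alt_word a m" by (auto simp: es')
    then have "es = alt_word (hd es) (Suc m)" by (simp add: alt_word_Suc es b)
    then show ?thesis by (intro exI[of _ "Suc m"]) simp
  qed
qed

locale rect_space =
  fixes A :: "('h :: chilbert_space) bop set" and \<phi> :: "'h bop \<Rightarrow> complex" and d :: nat and p :: "nat \<Rightarrow> 'h bop"
  assumes rect: "rectangular_prob_space A \<phi> d p"
begin

lemma tracial: "tracial_wstar_prob_space A \<phi>" using rect by (simp add: rectangular_prob_space_def)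

lemma A_clinear: "x \<in> A \<Longrightarrow> clinear_op x" and A_adj: "x \<in> A \<Longrightarrow> op_adj x \<in> A"
  and A_bicommutant: "commutant (commutant A) = A"
  using tracial by (auto simp: tracial_wstar_prob_space_def von_neumann_algebra_def)

lemma A_comp: "x \<in> A \<Longrightarrow> y \<in> A \<Longrightarrow> x o\<^sub>L y \<in> A"
  using commutant_comp[of x "commutant A" y] by (simp add: A_bicommutant)

lemma A_add: "x \<in> A \<Longrightarrow> y \<in> A \<Longrightarrow> x + y \<in> A"
  using commutant_add[of x "commutant A" y] by (simp add: A_bicommutant)

lemma A_zero: "0 \<in> A" using commutant_zero[of "commutant A"] by (simp add: A_bicommutant)

lemma phi_add: "x \<in> A \<Longrightarrow> y \<in> A \<Longrightarrow> \<phi> (x + y) = \<phi> x + \<phi> y"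
  and phi_id: "\<phi> id_blinfun = 1"
  and phi_comm: "x \<in> A \<Longrightarrow> y \<in> A \<Longrightarrow> \<phi> (x o\<^sub>L y) = \<phi> (y o\<^sub>L x)"
  and phi_pos: "x \<in> A \<Longrightarrow> Im (\<phi> (op_adj x o\<^sub>L x)) = 0 \<and> Re (\<phi> (op_adj x o\<^sub>L x)) \<ge> 0"
  and phi_faithful: "x \<in> A \<Longrightarrow> \<phi> (op_adj x o\<^sub>L x) = 0 \<Longrightarrow> x = 0"
  using tracial by (auto simp: tracial_wstar_prob_space_def)

lemma phi_zero: "\<phi> 0 = 0" using phi_add[OF A_zero A_zero] by simp

lemma p_A: "i \<in> {1..d} \<Longrightarrow> p i \<in> A" and p_nonzero: "i \<in> {1..d} \<Longrightarrow> p i \<noteq> 0"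
  and p_adj: "i \<in> {1..d} \<Longrightarrow> op_adj (p i) = p i" and p_idem: "i \<in> {1..d} \<Longrightarrow> p i o\<^sub>L p i = p i"
  and p_orth: "i \<in> {1..d} \<Longrightarrow> j \<in> {1..d} \<Longrightarrow> i \<noteq> j \<Longrightarrow> p i o\<^sub>L p j = 0"
  and p_sum: "(\<Sum>i=1..d. p i) = id_blinfun"
  using rect by (auto simp: rectangular_prob_space_def)

lemma rho_pos: assumes i: "i \<in> {1..d}" shows "rho \<phi> p i > 0"
proof -
  have "op_adj (p i) o\<^sub>L p i = p i" unfolding p_adj[OF i] by (rule p_idem[OF i])
  then have "Im (\<phi> (p i)) = 0" "Re (\<phi> (p i)) \<ge> 0" "\<phi> (p i) \<noteq> 0"
    using phi_pos[OF p_A[OF i]] phi_faithful[OF p_A[OF i]] p_nonzero[OF i] by auto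
  then show ?thesis by (auto simp: rho_def complex_eq_iff)
qed

lemma sum_rho: "(\<Sum>i=1..d. rho \<phi> p i) = 1"
proof -
  have "finite S \<Longrightarrow> S \<subseteq> {1..d} \<Longrightarrow> (\<Sum>i\<in>S. p i) \<in> A \<and> \<phi> (\<Sum>i\<in>S. p i) = (\<Sum>i\<in>S. \<phi> (p i))" for S
  proof (induction S rule: finite_induct)
    case (insert i S)
    then show ?case by (simp add: A_add p_A phi_add)
  qed (simp add: A_zero phi_zero)
  from this[of "{1..d}"] have "(\<Sum>i=1..d. \<phi> (p i)) = 1" unfolding p_sum phi_id by simp
  from arg_cong[OF this, of Re] show ?thesis by (simp add: rho_def)
qed

lemma p_contraction: assumes i: "i \<in> {1..d}" shows "norm (blinfun_apply (p i) v) \<le> norm v"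
proof -
  let ?w = "blinfun_apply (p i) v"
  have "cinner ?w ?w = cinner (blinfun_apply (op_adj (p i)) v) ?w" unfolding p_adj[OF i] ..
  also have "\<dots> = cinner v (blinfun_apply (p i o\<^sub>L p i) v)" by (simp add: op_adj_cinner[OF A_clinear[OF p_A[OF i]]])
  finally have "inner ?w ?w = inner v ?w" unfolding p_idem[OF i] by (simp flip: Re_cinner)
  then have "norm ?w * norm ?w \<le> norm v * norm ?w" using norm_cauchy_schwarz[of v ?w] by (simp add: power2_norm_eq_inner[symmetric] power2_eq_square)
  then show ?thesis by (cases "norm ?w = 0") auto
qed

text \<open>The triangle inequality is crude for orthogonal projections, but it is sharp when a
  single coefficient is nonzero, which is how it is used in \<open>norm_single_coef\<close>.\<close>

lemma norm_diag_le: "norm (\<Sum>i=1..d. op_scale (c i) (p i)) \<le> (\<Sum>i=1..d. cmod (c i))"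
proof -
  have "norm (op_scale (c i) (p i)) \<le> cmod (c i)" if "i \<in> {1..d}" for i
    by (rule norm_blinfun_bound) (use p_contraction[OF that] in \<open>auto simp: op_scale.rep_eq norm_scaleC mult_left_mono\<close>)
  then show ?thesis by (intro order_trans[OF norm_sum] sum_mono) auto
qed

lemma coeff_le_norm_diag: assumes k: "k \<in> {1..d}" shows "cmod (c k) \<le> norm (\<Sum>i=1..d. op_scale (c i) (p i))"
proof -
  obtain v where v: "blinfun_apply (p k) v \<noteq> 0" using p_nonzero[OF k] by (metis blinfun_eqI zero_blinfun.rep_eq)
  let ?w = "blinfun_apply (p k) v"
  have zc: "scaleC z 0 = (0 :: 'h)" for z using norm_scaleC[of z "0 :: 'h"] by simp
  have pw: "blinfun_apply (p i) ?w = (if i = k then ?w else 0)" if "i \<in> {1..d}" for i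
  proof -
    have "blinfun_apply (p i) ?w = blinfun_apply (p i o\<^sub>L p k) v" by simp
    also have "p i o\<^sub>L p k = (if i = k then p k else 0)" using p_idem[OF k] p_orth[OF that k] by auto
    finally show ?thesis by simp
  qed
  have "blinfun_apply (\<Sum>i=1..d. op_scale (c i) (p i)) ?w = (\<Sum>i=1..d. scaleC (c i) (blinfun_apply (p i) ?w))"
    by (simp add: blinfun.sum_left op_scale.rep_eq)
  also have "\<dots> = (\<Sum>i=1..d. if i = k then scaleC (c k) ?w else 0)" by (rule sum.cong) (auto simp: pw zc)
  also have "\<dots> = scaleC (c k) ?w" using k by simp
  finally have "cmod (c k) * norm ?w = norm (blinfun_apply (\<Sum>i=1..d. op_scale (c i) (p i)) ?w)" by (simp add: norm_scaleC)
  also have "\<dots> \<le> norm (\<Sum>i=1..d. op_scale (c i) (p i)) * norm ?w" by (rule norm_blinfun)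
  finally show ?thesis using v by simp
qed

end

locale rect_element = rect_space A \<phi> d p for A :: "('h :: chilbert_space) bop set" and \<phi> d p +
  fixes k l :: nat and b :: "'h bop"
  assumes k: "k \<in> {1..d}" and l: "l \<in> {1..d}" and kl: "k \<noteq> l" and type: "has_type A p k l b"
begin

lemma pk_A: "p k \<in> A" and pl_A: "p l \<in> A" using p_A k l by auto

lemma b_A: "b \<in> A" and pk_b: "p k o\<^sub>L b = b" and b_pl: "b o\<^sub>L p l = b"
proof -
  from type obtain x where x: "x \<in> A" "b = p k o\<^sub>L x o\<^sub>L p l" by (auto simp: has_type_def corner_def)
  then show "b \<in> A" by (simp add: A_comp pk_A pl_A)
  show "p k o\<^sub>L b = b" unfolding x(2) by (simp only: bop_assoc[symmetric] p_idem[OF k])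
  show "b o\<^sub>L p l = b" unfolding x(2) by (simp only: bop_assoc p_idem[OF l])
qed

definition "bs = op_adj b"

lemma bs_A: "bs \<in> A" and pl_bs: "p l o\<^sub>L bs = bs" and bs_pk: "bs o\<^sub>L p k = bs"
proof -
  show "bs \<in> A" by (simp add: bs_def A_adj b_A)
  show "p l o\<^sub>L bs = bs" using op_adj_comp[OF A_clinear[OF b_A] A_clinear[OF pl_A]] by (simp add: bs_def b_pl p_adj[OF l])
  show "bs o\<^sub>L p k = bs" using op_adj_comp[OF A_clinear[OF pk_A] A_clinear[OF b_A]] by (simp add: bs_def pk_b p_adj[OF k])
qed

text \<open>Indices of the projections that fix a letter from the left and from the right;
  \<open>True\<close> denotes the adjoint, which has type (l, k).\<close>

abbreviation lt :: "bool \<Rightarrow> nat" where "lt e \<equiv> (if e then l else k)"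
abbreviation rt :: "bool \<Rightarrow> nat" where "rt e \<equiv> (if e then k else l)"
definition letter :: "bool \<Rightarrow> 'h bop" where "letter e = (if e then bs else b)"

lemma letter_A: "letter e \<in> A" and p_letter: "p (lt e) o\<^sub>L letter e = letter e" and letter_p: "letter e o\<^sub>L p (rt e) = letter e"
  by (auto simp: letter_def b_A bs_A pk_b pl_bs b_pl bs_pk)

lemma lr_in: "lt e \<in> {1..d}" "rt e \<in> {1..d}" using k l by auto

lemma op_word_Cons: "op_word b (e # es) = letter e o\<^sub>L op_word b es"
  by (simp add: op_word_def letter_def bs_def)

lemma op_word_Nil: "op_word b [] = id_blinfun" by (simp add: op_word_def)

lemma p_other_letter: "i \<in> {1..d} \<Longrightarrow> i \<noteq> lt e \<Longrightarrow> p i o\<^sub>L letter e = 0"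
  proof -
  assume i: "i \<in> {1..d}" "i \<noteq> lt e"
  have "p i o\<^sub>L letter e = (p i o\<^sub>L p (lt e)) o\<^sub>L letter e" by (simp only: bop_assoc p_letter)
  also have "p i o\<^sub>L p (lt e) = 0" by (rule p_orth[OF i(1) lr_in(1) i(2)])
  finally show ?thesis by simp
qed

lemma letter_other_p: "i \<in> {1..d} \<Longrightarrow> i \<noteq> rt e \<Longrightarrow> letter e o\<^sub>L p i = 0"
  proof -
  assume i: "i \<in> {1..d}" "i \<noteq> rt e"
  have "letter e o\<^sub>L p i = letter e o\<^sub>L (p (rt e) o\<^sub>L p i)" by (simp only: bop_assoc[symmetric] letter_p)
  also have "p (rt e) o\<^sub>L p i = 0" by (rule p_orth[OF lr_in(2) i(1) i(2)[symmetric]])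
  finally show ?thesis by simp
qed

lemma letter_same: "letter e o\<^sub>L letter e = 0"
proof -
  have "letter e o\<^sub>L letter e = (letter e o\<^sub>L p (lt e)) o\<^sub>L letter e" by (simp only: bop_assoc p_letter)
  also have "letter e o\<^sub>L p (lt e) = 0" using kl lr_in[of e] by (intro letter_other_p) auto
  finally show ?thesis by simp
qed

lemma op_word_left: "es \<noteq> [] \<Longrightarrow> i \<in> {1..d} \<Longrightarrow> i \<noteq> lt (hd es) \<Longrightarrow> p i o\<^sub>L op_word b es = 0"
proof -
  assume "es \<noteq> []" and i: "i \<in> {1..d}" "i \<noteq> lt (hd es)"
  then obtain e es' where es: "es = e # es'" by (cases es) auto
  have "p i o\<^sub>L op_word b es = (p i o\<^sub>L letter e) o\<^sub>L op_word b es'" by (simp only: es op_word_Cons bop_assoc)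
  also have "p i o\<^sub>L letter e = 0" by (rule p_other_letter) (use i in \<open>simp_all add: es\<close>)
  finally show ?thesis by simp
qed

lemma op_word_right: "es \<noteq> [] \<Longrightarrow> i \<in> {1..d} \<Longrightarrow> i \<noteq> rt (last es) \<Longrightarrow> op_word b es o\<^sub>L p i = 0"
proof (induction es)
  case (Cons e es)
  show ?case
  proof (cases "es = []")
    case True
    then show ?thesis using Cons.prems letter_other_p[of i e] by (simp add: op_word_Cons op_word_Nil)
  next
    case False
    then show ?thesis using Cons by (simp add: op_word_Cons bop_assoc)
  qed
qed simp

lemma op_word_not_alternating: "\<not> successively (\<noteq>) es \<Longrightarrow> op_word b es = 0"
proof (induction es)
  case (Cons e es)
  show ?case
  proof (cases "successively (\<noteq>) es")
    case True
    then obtain es' where "es = e # es'" using Cons.prems by (cases es) (auto simp: successively_Cons)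
    then show ?thesis by (simp add: op_word_Cons bop_assoc[symmetric] letter_same)
  next
    case False then show ?thesis using Cons.IH by (simp add: op_word_Cons)
  qed
qed simp

definition "coef i es = corner_state \<phi> p i (p i o\<^sub>L op_word b es o\<^sub>L p i)"
definition "mom m = corner_state \<phi> p k (((\<lambda>y. (b o\<^sub>L op_adj b) o\<^sub>L y) ^^ m) (p k))"

lemma bbs_pow: "m \<ge> 1 \<Longrightarrow> op_word b (alt_word False m) o\<^sub>L p k = ((\<lambda>y. (b o\<^sub>L op_adj b) o\<^sub>L y) ^^ m) (p k)"
proof (induction m)
  case (Suc m)
  show ?case
  proof (cases m)
    case 0
    then show ?thesis by (simp add: alt_word_Suc alt_word_def[of _ 0] op_word_Cons op_word_Nil letter_def bs_def[symmetric])
  next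
    case (Suc j)
    then show ?thesis using Suc.IH by (simp add: alt_word_Suc op_word_Cons letter_def bs_def[symmetric] bop_assoc del: funpow.simps) (simp add: bop_assoc bs_def)
  qed
qed simp

lemma op_word_A: "es \<noteq> [] \<Longrightarrow> op_word b es \<in> A"
proof (induction es)
  case (Cons e es)
  then show ?case by (cases "es = []") (auto simp: op_word_Cons op_word_Nil letter_A A_comp)
qed simp

lemma op_word_p_hd: "es \<noteq> [] \<Longrightarrow> p (lt (hd es)) o\<^sub>L op_word b es = op_word b es"
  by (cases es) (simp_all add: op_word_Cons bop_assoc[symmetric] p_letter del: if_distrib)

lemma coef_alt_False: assumes "m \<ge> 1" "i \<in> {1..d}"
  shows "coef i (alt_word False m) = (if i = k then mom m else 0)"
proof -
  obtain j where m: "m = Suc j" using assms by (cases m) auto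
  have ne: "alt_word False m \<noteq> []" "hd (alt_word False m) = False" by (auto simp: m alt_word_Suc)
  show ?thesis
  proof (cases "i = k")
    case True
    have "p k o\<^sub>L op_word b (alt_word False m) = op_word b (alt_word False m)" using op_word_p_hd[OF ne(1)] ne(2) by simp
    then show ?thesis using True bbs_pow[OF assms(1)] by (simp add: coef_def mom_def)
  next
    case False
    then show ?thesis using op_word_left[OF ne(1) assms(2)] ne(2) by (simp add: coef_def corner_state_def phi_zero)
  qed
qed

lemma op_word_shift: "bs o\<^sub>L op_word b (alt_word False m) o\<^sub>L b = op_word b (alt_word True (Suc m))"
proof (induction m)
  case 0 show ?case by (simp add: alt_word_Suc alt_word_def[of _ 0] op_word_Cons op_word_Nil letter_def)
next
  case (Suc m)
  have "bs o\<^sub>L op_word b (alt_word False (Suc m)) o\<^sub>L b = bs o\<^sub>L (b o\<^sub>L (bs o\<^sub>L op_word b (alt_word False m) o\<^sub>L b))"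
    by (simp add: alt_word_Suc[of False] op_word_Cons letter_def bop_assoc)
  also have "\<dots> = op_word b (alt_word True (Suc (Suc m)))"
    unfolding Suc.IH by (simp add: alt_word_Suc[of True] op_word_Cons letter_def)
  finally show ?case .
qed

text \<open>Traciality moves one letter around, so the two alternating words of the same length have
  equal value under the unnormalized state. The factor is the quotient of the normalizations of the
  two corner states.\<close>

lemma coef_alt_True: assumes "m \<ge> 1" "i \<in> {1..d}"
  shows "coef i (alt_word True m) = (if i = l then of_real (rho \<phi> p k / rho \<phi> p l) * mom m else 0)"
proof -
  obtain j where m: "m = Suc j" using assms by (cases m) auto
  have ne: "alt_word True m \<noteq> []" "hd (alt_word True m) = True" by (auto simp: m alt_word_Suc)
  show ?thesis
  proof (cases "i = l")
    case True
    have "\<phi> (p l o\<^sub>L op_word b (alt_word True m) o\<^sub>L p l) = \<phi> (op_word b (alt_word True m))"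
    proof -
      have "p l o\<^sub>L op_word b (alt_word True m) = op_word b (alt_word True m)" using op_word_p_hd[OF ne(1)] ne(2) by simp
      moreover have "op_word b (alt_word True m) o\<^sub>L p l = op_word b (alt_word True m)"
        unfolding m op_word_shift[symmetric] by (simp add: bop_assoc b_pl)
      ultimately show ?thesis by simp
    qed
    also have "\<dots> = \<phi> (op_word b (alt_word False m) o\<^sub>L p k)"
    proof (cases j)
      case 0
      then show ?thesis using phi_comm[OF bs_A b_A]
        by (simp add: m alt_word_Suc alt_word_def[of _ 0] op_word_Cons op_word_Nil letter_def bop_assoc bs_pk)
    next
      case (Suc i)
      have w: "op_word b (alt_word False j) o\<^sub>L b \<in> A" using op_word_A[of "alt_word False j"] by (simp add: Suc alt_word_Suc A_comp b_A)
      have "\<phi> (op_word b (alt_word True m)) = \<phi> (bs o\<^sub>L (op_word b (alt_word False j) o\<^sub>L b))"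
        unfolding m op_word_shift[symmetric] by (simp add: bop_assoc)
      also have "\<dots> = \<phi> ((op_word b (alt_word False j) o\<^sub>L b) o\<^sub>L bs)" by (rule phi_comm[OF bs_A w])
      also have "(op_word b (alt_word False j) o\<^sub>L b) o\<^sub>L bs = op_word b (alt_word False m) o\<^sub>L p k"
      proof -
        have "op_word b (alt_word False j) o\<^sub>L (b o\<^sub>L bs) = b o\<^sub>L (bs o\<^sub>L op_word b (alt_word False j)) o\<^sub>L p k" for j
        proof (induction j)
          case 0 show ?case by (simp add: alt_word_def[of _ 0] op_word_Nil bop_assoc bs_pk)
        next
          case (Suc j) then show ?case by (simp add: alt_word_Suc op_word_Cons letter_def bop_assoc)
        qed
        then show ?thesis by (simp add: m alt_word_Suc op_word_Cons letter_def bop_assoc)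
      qed
      finally show ?thesis .
    qed
    also have "\<dots> = of_real (rho \<phi> p k) * mom m"
      using rho_pos[OF k] bbs_pow[OF assms(1)] by (simp add: mom_def corner_state_def)
    finally show ?thesis using True by (simp add: coef_def corner_state_def)
  next
    case False
    then show ?thesis using op_word_left[OF ne(1) assms(2)] ne(2) by (simp add: coef_def corner_state_def phi_zero)
  qed
qed

text \<open>A repeated letter kills the word because k differs from l. An alternating word with
  equal end letters has different left and right projections, so no p i can compress it to something
  nonzero.\<close>

lemma coef_other:
  assumes "es \<noteq> []" "i \<in> {1..d}" "\<And>h m. m \<ge> 1 \<Longrightarrow> es \<noteq> alt_word h m"
  shows "coef i es = 0"
proof (cases "successively (\<noteq>) es")
  case True
  then have "hd es = last es" using successively_neq_classification[OF assms(1) True] assms(3) by blast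
  then have "i \<noteq> lt (hd es) \<or> i \<noteq> rt (last es)" using kl by (auto split: if_splits)
  then have "p i o\<^sub>L op_word b es o\<^sub>L p i = 0"
  proof
    assume "i \<noteq> lt (hd es)"
    from op_word_left[OF assms(1,2) this] show ?thesis by simp
  next
    assume "i \<noteq> rt (last es)"
    from op_word_right[OF assms(1,2) this] show ?thesis by (simp add: bop_assoc)
  qed
  then show ?thesis by (simp add: coef_def corner_state_def phi_zero)
next
  case False
  then show ?thesis by (simp add: op_word_not_alternating coef_def corner_state_def phi_zero)
qed

end

section \<open>Volumes and separation of microstates\<close>

definition gdens :: "'i set \<Rightarrow> real \<Rightarrow> ('i \<Rightarrow> complex) \<Rightarrow> real" where
  "gdens B \<tau> f = exp (- (\<Sum>e\<in>B. (cmod (f e))\<^sup>2) / \<tau>) / (pi * \<tau>) ^ card B"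

abbreviation lborelN :: "'i set \<Rightarrow> ('i \<Rightarrow> complex) measure" where
  "lborelN B \<equiv> PiM B (\<lambda>_. lborel)"

lemma sets_lborelN: "sets (lborelN B) = sets (PiM B (\<lambda>_. borel))"
  by (intro sets_PiM_cong) auto

lemma gdens_measurable [measurable]: "finite B \<Longrightarrow> gdens B \<tau> \<in> borel_measurable (lborelN B)"
  unfolding gdens_def by measurable

lemma gdens_nonneg: "\<tau> > 0 \<Longrightarrow> gdens B \<tau> f \<ge> 0"
  unfolding gdens_def by (intro divide_nonneg_nonneg) auto

lemma cgaussN_density:
  assumes B: "finite B" and \<tau>: "\<tau> > 0"
  shows "cgaussN B \<tau> = density (lborelN B) (\<lambda>f. ennreal (gdens B \<tau> f))"
proof -
  interpret G: product_sigma_finite "\<lambda>_. cgauss \<tau>" using \<tau> by (rule product_sigma_finite_cgauss)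
  interpret L: product_sigma_finite "\<lambda>_. lborel :: complex measure" by (simp add: product_sigma_finite_def lborel.sigma_finite_measure_axioms)
  let ?g = "\<lambda>z. ennreal (exp (- (cmod z)\<^sup>2 / \<tau>) / (pi * \<tau>))"
  have dens: "ennreal (gdens B \<tau> f) = (\<Prod>e\<in>B. ?g (f e))" for f
  proof -
    have "gdens B \<tau> f = (\<Prod>e\<in>B. exp (- (cmod (f e))\<^sup>2 / \<tau>) / (pi * \<tau>))"
      using B by (simp add: gdens_def prod_dividef exp_sum[symmetric] sum_divide_distrib[symmetric] sum_negf)
    then show ?thesis using \<tau> by (simp add: prod_ennreal)
  qed
  have "density (lborelN B) (\<lambda>f. ennreal (gdens B \<tau> f)) = cgaussN B \<tau>"
  proof (rule G.PiM_eqI[OF B])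
    show "sets (density (lborelN B) (\<lambda>f. ennreal (gdens B \<tau> f))) = sets (cgaussN B \<tau>)"
      by (simp add: sets_lborelN sets_PiM_cgauss)
    fix A assume "\<And>i. i \<in> B \<Longrightarrow> A i \<in> sets (cgauss \<tau>)"
    then have A: "\<And>i. i \<in> B \<Longrightarrow> A i \<in> sets borel" by simp
    then have AL: "Pi\<^sub>E B A \<in> sets (lborelN B)" using B by (intro sets_PiM_I_finite) auto
    have "emeasure (density (lborelN B) (\<lambda>f. ennreal (gdens B \<tau> f))) (Pi\<^sub>E B A) = (\<integral>\<^sup>+f. ennreal (gdens B \<tau> f) * indicator (Pi\<^sub>E B A) f \<partial>lborelN B)"
      using B AL by (subst emeasure_density) auto
    also have "\<dots> = (\<integral>\<^sup>+f. (\<Prod>e\<in>B. ?g (f e) * indicator (A e) (f e)) \<partial>lborelN B)"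
    proof (rule nn_integral_cong)
      fix f assume f: "f \<in> space (lborelN B)"
      have "indicator (Pi\<^sub>E B A) f = (\<Prod>e\<in>B. indicator (A e) (f e) :: ennreal)"
      proof (cases "f \<in> Pi\<^sub>E B A")
        case True then show ?thesis by (auto simp: PiE_iff)
      next
        case False
        then obtain e where "e \<in> B" "f e \<notin> A e" using f by (auto simp: PiE_iff space_PiM)
        then have "(\<Prod>e\<in>B. indicator (A e) (f e) :: ennreal) = 0" using B by (intro prod_zero) (auto intro!: bexI[of _ e])
        then show ?thesis using False by simp
      qed
      then show "ennreal (gdens B \<tau> f) * indicator (Pi\<^sub>E B A) f = (\<Prod>e\<in>B. ?g (f e) * indicator (A e) (f e))"
        unfolding dens by (simp add: prod.distrib)
    qed
    also have "\<dots> = (\<Prod>e\<in>B. \<integral>\<^sup>+z. ?g z * indicator (A e) z \<partial>lborel)"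
      using A by (intro L.product_nn_integral_prod[OF B]) simp
    also have "\<dots> = (\<Prod>e\<in>B. emeasure (cgauss \<tau>) (A e))"
    proof (rule prod.cong[OF refl])
      fix e assume "e \<in> B"
      then have "A e \<in> sets lborel" using A by simp
      then show "(\<integral>\<^sup>+z. ?g z * indicator (A e) z \<partial>lborel) = emeasure (cgauss \<tau>) (A e)"
        unfolding cgauss_def by (subst emeasure_density) auto
    qed
    finally show "emeasure (density (lborelN B) (\<lambda>f. ennreal (gdens B \<tau> f))) (Pi\<^sub>E B A) = (\<Prod>e\<in>B. emeasure (cgauss \<tau>) (A e))" .
  qed
  then show ?thesis by simp
qed

lemma volume_le_gaussian:
  fixes \<tau> T :: real
  assumes B: "finite B" and \<tau>: "\<tau> > 0" and X: "X \<in> sets (lborelN B)"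
    and T: "\<And>f. f \<in> X \<Longrightarrow> (\<Sum>e\<in>B. (cmod (f e))\<^sup>2) \<le> T"
  shows "emeasure (lborelN B) X \<le> ennreal (exp (T / \<tau>) * (pi * \<tau>) ^ card B)"
proof -
  interpret P: prob_space "cgaussN B \<tau>" using \<tau> by (rule prob_space_cgaussN)
  let ?c = "exp (T / \<tau>) * (pi * \<tau>) ^ card B"
  have c: "?c > 0" using \<tau> by simp
  have "emeasure (lborelN B) X = (\<integral>\<^sup>+f. indicator X f \<partial>lborelN B)" using X by simp
  also have "\<dots> \<le> (\<integral>\<^sup>+f. ennreal ?c * (ennreal (gdens B \<tau> f) * indicator X f) \<partial>lborelN B)"
  proof (rule nn_integral_mono)
    fix f
    show "indicator X f \<le> ennreal ?c * (ennreal (gdens B \<tau> f) * indicator X f)"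
    proof (cases "f \<in> X")
      case True
      have "exp (T / \<tau>) * exp (- (\<Sum>e\<in>B. (cmod (f e))\<^sup>2) / \<tau>) \<ge> 1"
        using T[OF True] \<tau> by (simp add: exp_add[symmetric] add_divide_distrib[symmetric] divide_right_mono)
      then have "1 \<le> ?c * gdens B \<tau> f" using \<tau> by (simp add: gdens_def)
      then have "ennreal 1 \<le> ennreal ?c * ennreal (gdens B \<tau> f)" using c by (subst ennreal_mult[symmetric]) (auto intro: ennreal_leI gdens_nonneg[OF \<tau>])
      then show ?thesis using True by simp
    qed simp
  qed
  also have "\<dots> = ennreal ?c * emeasure (cgaussN B \<tau>) X"
    unfolding cgaussN_density[OF B \<tau>] using B X by (subst emeasure_density) (auto simp: nn_integral_cmult)
  also have "\<dots> \<le> ennreal ?c * 1" by (intro mult_left_mono P.emeasure_le_1) simp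
  finally show ?thesis by simp
qed

lemma volume_ge_gaussian:
  fixes \<tau> T :: real
  assumes B: "finite B" and \<tau>: "\<tau> > 0" and X: "X \<in> sets (lborelN B)"
    and T: "\<And>f. f \<in> X \<Longrightarrow> T \<le> (\<Sum>e\<in>B. (cmod (f e))\<^sup>2)" and P: "c \<le> measure (cgaussN B \<tau>) X" and c: "c \<ge> 0"
  shows "ennreal (c * (exp (T / \<tau>) * (pi * \<tau>) ^ card B)) \<le> emeasure (lborelN B) X"
proof -
  interpret P: prob_space "cgaussN B \<tau>" using \<tau> by (rule prob_space_cgaussN)
  let ?k = "exp (T / \<tau>) * (pi * \<tau>) ^ card B"
  have k: "?k > 0" using \<tau> by simp
  have "ennreal ?k * ennreal c \<le> ennreal ?k * emeasure (cgaussN B \<tau>) X"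
    unfolding P.emeasure_eq_measure using P by (intro mult_left_mono ennreal_leI) auto
  also have "\<dots> = (\<integral>\<^sup>+f. ennreal ?k * (ennreal (gdens B \<tau> f) * indicator X f) \<partial>lborelN B)"
    unfolding cgaussN_density[OF B \<tau>] using B X by (subst emeasure_density) (auto simp: nn_integral_cmult)
  also have "\<dots> \<le> (\<integral>\<^sup>+f. indicator X f \<partial>lborelN B)"
  proof (rule nn_integral_mono)
    fix f
    show "ennreal ?k * (ennreal (gdens B \<tau> f) * indicator X f) \<le> indicator X f"
    proof (cases "f \<in> X")
      case True
      have "exp (T / \<tau>) * exp (- (\<Sum>e\<in>B. (cmod (f e))\<^sup>2) / \<tau>) \<le> 1"
        using T[OF True] \<tau> by (simp add: exp_add[symmetric] add_divide_distrib[symmetric] divide_right_mono)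
      then have "?k * gdens B \<tau> f \<le> 1" using \<tau> by (simp add: gdens_def)
      then have "ennreal ?k * ennreal (gdens B \<tau> f) \<le> ennreal 1" using k \<tau> by (subst ennreal_mult[symmetric]) (auto intro: ennreal_leI gdens_nonneg[OF \<tau>])
      then show ?thesis using True by simp
    qed simp
  qed
  also have "\<dots> = emeasure (lborelN B) X" using X by simp
  finally show ?thesis using k c by (simp add: ennreal_mult[symmetric] mult.commute)
qed

section \<open>Trace moments are Lipschitz for the Hilbert-Schmidt norm\<close>

definition kdiff :: "kern \<Rightarrow> kern \<Rightarrow> kern" where "kdiff A C i j = A i j - C i j"

lemma kmul_kdiff_left: "kmul n (kdiff A C) D = kdiff (kmul n A D) (kmul n C D)"
  by (auto simp: fun_eq_iff kmul_def kdiff_def left_diff_distrib sum_subtractf)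
lemma kmul_kdiff_right: "kmul n D (kdiff A C) = kdiff (kmul n D A) (kmul n D C)"
  by (auto simp: fun_eq_iff kmul_def kdiff_def right_diff_distrib sum_subtractf)
lemma ktr_kdiff: "ktr n (kdiff A C) = ktr n A - ktr n C"
  by (simp add: ktr_def kdiff_def sum_subtractf)
lemma kadj_kdiff: "kadj (kdiff A C) = kdiff (kadj A) (kadj C)"
  by (auto simp: fun_eq_iff kadj_def kdiff_def)

context blocks
begin

lemma hs2_K: "hs2 n (K f) = (\<Sum>e\<in>I \<times> J. (cmod (f e))\<^sup>2)"
proof -
  have "complex_of_real (hs2 n (K f)) = of_real (\<Sum>e\<in>I \<times> J. (cmod (f (fst e, snd e)))\<^sup>2)"
    unfolding hs2_def of_real_sum sum_block[of "\<lambda>i j. of_real ((cmod (f (i, j)))\<^sup>2)", symmetric]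
    by (intro sum.cong) (auto simp: kern_of_def)
  then show ?thesis by (simp only: of_real_eq_iff prod.collapse)
qed

lemma wtr_one: "Re (wtr n I J (Suc 0) f) = (\<Sum>e\<in>I \<times> J. (cmod (f e))\<^sup>2)"
proof -
  have "wtr n I J (Suc 0) f = of_real (hs2 n (K f))" using hs2_WK[of 0 f] by simp
  then show ?thesis by (simp add: hs2_K)
qed

lemma trace_product_bound:
  assumes U: "hs2 n (kadj U \<odot> U) \<le> M" and V: "hs2 n (V \<odot> kadj V) \<le> M" and "M \<ge> 0"
  shows "cmod (ktr n (D \<odot> (U \<odot> V))) \<le> sqrt (hs2 n D * M)"
proof -
  have "(hs2 n (U \<odot> V))\<^sup>2 \<le> M * M" by (rule order_trans[OF hs2_kmul_sq]) (intro mult_mono U V \<open>M \<ge> 0\<close> hs2_nonneg)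
  then have UV: "hs2 n (U \<odot> V) \<le> M" using \<open>M \<ge> 0\<close> by (metis power2_eq_square power2_le_imp_le)
  have "(cmod (ktr n (D \<odot> (U \<odot> V))))\<^sup>2 \<le> hs2 n D * M"
    by (rule order_trans[OF ktr_cauchy_schwarz]) (intro mult_left_mono UV hs2_nonneg)
  then show ?thesis by (rule real_le_rsqrt)
qed

text \<open>Telescopes through the hybrid traces \<open>X r\<close>, in which the first r powers
  belong to f and the rest to g. Each step exchanges one factor and one adjoint factor, hence 2 m
  summands. The remaining factors are bounded by trace moments up to order 4 m rather than by the
  operator norm, so the constant does not depend on the cutoff R.\<close>

lemma wtr_difference_bound:
  assumes M: "\<And>j. j \<le> 4 * m \<Longrightarrow> Re (wtr n I J j f) \<le> M" "\<And>j. j \<le> 4 * m \<Longrightarrow> Re (wtr n I J j g) \<le> M"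
  shows "cmod (wtr n I J m f - wtr n I J m g) \<le> 2 * real m * sqrt ((\<Sum>e\<in>I \<times> J. (cmod (f e - g e))\<^sup>2) * M)"
proof -
  have M0: "M \<ge> 0" using M(1)[of 0] wtr_real(2)[of 0 f] by linarith
  define D where "D = kdiff (K f) (K g)"
  have hsD: "hs2 n D = (\<Sum>e\<in>I \<times> J. (cmod (f e - g e))\<^sup>2)"
  proof -
    have "D = K (\<lambda>e. f e - g e)" by (auto simp: D_def kdiff_def kern_of_def fun_eq_iff)
    then show ?thesis by (simp add: hs2_K)
  qed
  have hW: "hs2 n (W a h) = Re (wtr n I J (2 * a) h)" for a h using hs2_W[of a h, symmetric] by simp
  define X where "X r = ktr n (W r f \<odot> W (m - r) g)" for r
  have W1: "W (Suc a) h = K h \<odot> (kadj (K h) \<odot> W a h)" for a h by (simp add: kmul_assoc)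
  have W1': "W (Suc a) h = W a h \<odot> (K h \<odot> kadj (K h))" for a h
    using W_add[of a h "Suc 0"] unfolding W_one by simp
  have step: "cmod (X (Suc r) - X r) \<le> 2 * sqrt (hs2 n D * M)" if r: "r < m" for r
  proof -
    define s where "s = m - Suc r"
    have ms: "m - r = Suc s" "m - Suc r = s" using r by (auto simp: s_def)
    \<comment> \<open>The half-way word, where the factor is already taken from f but its adjoint
      still from g.\<close>
    define Y where "Y = ktr n (W r f \<odot> (K f \<odot> (kadj (K g) \<odot> W s g)))"
    have X1: "X (Suc r) = ktr n (W r f \<odot> (K f \<odot> (kadj (K f) \<odot> W s g)))"
      unfolding X_def ms W1' by (simp only: kmul_assoc)
    have X0: "X r = ktr n (W r f \<odot> (K g \<odot> (kadj (K g) \<odot> W s g)))"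
      unfolding X_def ms W1 ..
    have "X (Suc r) - Y = ktr n ((W r f \<odot> K f) \<odot> (kadj D \<odot> W s g))"
      unfolding X1 Y_def D_def kadj_kdiff kmul_kdiff_left kmul_kdiff_right ktr_kdiff by (simp only: kmul_assoc)
    also have "\<dots> = ktr n (kadj D \<odot> (W s g \<odot> (W r f \<odot> K f)))" by (subst ktr_comm) (simp only: kmul_assoc)
    finally have 1: "cmod (X (Suc r) - Y) \<le> sqrt (hs2 n (kadj D) * M)"
    proof (simp only:, intro trace_product_bound M0)
      have "kadj (W s g) \<odot> W s g = W (2 * s) g" by (simp add: W_add mult_2)
      then show "hs2 n (kadj (W s g) \<odot> W s g) \<le> M" unfolding hW using r by (simp add: hW s_def M(2))
      have "(W r f \<odot> K f) \<odot> kadj (W r f \<odot> K f) = W r f \<odot> (W (Suc 0) f \<odot> W r f)"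
        by (simp only: kadj_kmul kmul_assoc kadj_W W_one)
      also have "\<dots> = W (Suc (2 * r)) f" by (simp only: W_add mult_2 add_Suc add_Suc_right add_0)
      finally show "hs2 n ((W r f \<odot> K f) \<odot> kadj (W r f \<odot> K f)) \<le> M" using r by (simp only: hW) (intro M(1), simp)
    qed
    have "Y - X r = ktr n (W r f \<odot> (D \<odot> (kadj (K g) \<odot> W s g)))"
      unfolding X0 Y_def D_def kmul_kdiff_left kmul_kdiff_right ktr_kdiff by (simp only: kmul_assoc)
    also have "\<dots> = ktr n (D \<odot> ((kadj (K g) \<odot> W s g) \<odot> W r f))" by (subst ktr_comm) (simp only: kmul_assoc)
    finally have 2: "cmod (Y - X r) \<le> sqrt (hs2 n D * M)"
    proof (simp only:, intro trace_product_bound M0)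
      have "kadj (kadj (K g) \<odot> W s g) \<odot> (kadj (K g) \<odot> W s g) = W s g \<odot> (W (Suc 0) g \<odot> W s g)"
        by (simp only: kadj_kmul kmul_assoc kadj_W W_one kadj_kadj)
      also have "\<dots> = W (Suc (2 * s)) g" by (simp only: W_add mult_2 add_Suc add_Suc_right add_0)
      finally show "hs2 n (kadj (kadj (K g) \<odot> W s g) \<odot> (kadj (K g) \<odot> W s g)) \<le> M" using r by (simp only: hW) (intro M(2), simp add: s_def)
      have "W r f \<odot> kadj (W r f) = W (2 * r) f" by (simp add: W_add mult_2)
      then show "hs2 n (W r f \<odot> kadj (W r f)) \<le> M" using r by (simp only: hW) (intro M(1), simp)
    qed
    have "cmod (X (Suc r) - X r) \<le> cmod (X (Suc r) - Y) + cmod (Y - X r)" using norm_triangle_ineq[of "X (Suc r) - Y" "Y - X r"] by simp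
    with 1 2 show ?thesis by simp
  qed
  have "W m f \<odot> kid I = W m f"
  proof -
    have "kadj (kid I \<odot> W m f) = kadj (W m f) \<odot> kid I" by (simp only: kadj_kmul kadj_kid)
    then show ?thesis by simp
  qed
  then have "wtr n I J m f - wtr n I J m g = X m - X 0" by (simp add: X_def wtr_def)
  also have "\<dots> = (\<Sum>r<m. X (Suc r) - X r)" by (rule sum_lessThan_telescope[symmetric])
  finally have "cmod (wtr n I J m f - wtr n I J m g) \<le> (\<Sum>r<m. 2 * sqrt (hs2 n D * M))"
    using step by (simp only:) (intro order_trans[OF norm_sum] sum_mono, simp)
  then show ?thesis by (simp add: hsD mult_ac)
qed

end

section \<open>Block matrices and microstates\<close>

context rect_space
begin

text \<open>Rounding down can only lose, so the blocks fit into n coordinates; the few leftover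
  coordinates belong to no block.\<close>

lemma qdim_sum: assumes "i \<in> {1..d}" shows "(\<Sum>j\<in>{1..i}. qdim \<phi> p n j) \<le> n"
proof -
  have "real (\<Sum>j\<in>{1..i}. qdim \<phi> p n j) \<le> (\<Sum>j\<in>{1..i}. rho \<phi> p j * real n)"
    unfolding of_nat_sum
  proof (rule sum_mono)
    fix j assume "j \<in> {1..i}"
    then have "j \<in> {1..d}" using assms by auto
    then have "0 \<le> rho \<phi> p j * real n" using rho_pos[of j] by simp
    then show "real (qdim \<phi> p n j) \<le> rho \<phi> p j * real n" unfolding qdim_def by linarith
  qed
  also have "\<dots> \<le> (\<Sum>j\<in>{1..d}. rho \<phi> p j * real n)"
    using assms rho_pos by (intro sum_mono2) (auto intro!: mult_nonneg_nonneg less_imp_le[OF rho_pos])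
  also have "\<dots> = real n" using sum_rho by (simp add: sum_distrib_right[symmetric])
  finally show ?thesis by linarith
qed

lemma block_subset: "i \<in> {1..d} \<Longrightarrow> block \<phi> p n i \<subseteq> {..<n}"
  using qdim_sum[of i n] by (auto simp: block_def)

lemma card_block: "i \<in> {1..d} \<Longrightarrow> card (block \<phi> p n i) = qdim \<phi> p n i"
proof -
  assume i: "i \<in> {1..d}"
  then have "{1..i} = insert i {1..<i}" by auto
  then show ?thesis by (simp add: block_def)
qed

lemma block_disjoint: assumes "i \<noteq> j" shows "block \<phi> p n i \<inter> block \<phi> p n j = {}"
proof -
  have *: "block \<phi> p n i \<inter> block \<phi> p n j = {}" if "i < j" for i j
  proof -
    have "(\<Sum>t\<in>{1..i}. qdim \<phi> p n t) \<le> (\<Sum>t\<in>{1..<j}. qdim \<phi> p n t)" using that by (intro sum_mono2) auto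
    then show ?thesis by (auto simp: block_def)
  qed
  show ?thesis using *[of i j] *[of j i] assms by (cases "i < j") (auto simp: Int_commute)
qed

end

section \<open>Translation between matrices and kernels\<close>

definition kmat :: "nat \<Rightarrow> kern \<Rightarrow> complex mat" where "kmat n X = Matrix.mat n n (\<lambda>(i, j). X i j)"

lemma kmat_carrier [simp]: "kmat n X \<in> carrier_mat n n" by (simp add: kmat_def)
lemma dim_kmat [simp]: "dim_row (kmat n X) = n" "dim_col (kmat n X) = n" by (simp_all add: kmat_def)
lemma index_kmat [simp]: "i < n \<Longrightarrow> j < n \<Longrightarrow> kmat n X $$ (i, j) = X i j" by (simp add: kmat_def)

lemma kmat_mult: "kmat n X * kmat n Y = kmat n (kmul n X Y)"
  by (rule eq_matI) (auto simp: scalar_prod_def kmul_def atLeast0LessThan intro!: sum.cong)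

lemma kmat_adjoint: "mat_adjoint (kmat n X) = kmat n (kadj X)"
proof (rule eq_matI)
  fix i j assume "i < dim_row (kmat n (kadj X))" "j < dim_col (kmat n (kadj X))"
  then have ij: "i < n" "j < n" by auto
  have "mat_adjoint (kmat n X) $$ (i, j) = conjugate (kmat n X $$ (j, i))"
    unfolding mat_adjoint_def using ij by (simp add: mat_of_rows_index)
  then show "mat_adjoint (kmat n X) $$ (i, j) = kmat n (kadj X) $$ (i, j)" using ij by (simp add: kadj_def)
qed (simp_all add: mat_adjoint_def)

lemma kmat_one: "1\<^sub>m n = kmat n (kid {..<n})"
  by (rule eq_matI) (auto simp: kid_def)

definition kword :: "nat \<Rightarrow> kern \<Rightarrow> bool list \<Rightarrow> kern" where
  "kword n X es = foldr (\<lambda>e Y. kmul n (if e then kadj X else X) Y) es (kid {..<n})"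

lemma kword_Cons: "kword n X (e # es) = kmul n (if e then kadj X else X) (kword n X es)" and kword_Nil: "kword n X [] = kid {..<n}"
  by (simp_all add: kword_def)

lemma mat_word_kmat: "mat_word (kmat n X) es = kmat n (kword n X es)"
proof (induction es)
  case Nil show ?case by (simp add: mat_word_def kword_Nil kmat_one)
next
  case (Cons e es)
  have "mat_word (kmat n X) (e # es) = (if e then mat_adjoint (kmat n X) else kmat n X) * mat_word (kmat n X) es"
    by (simp add: mat_word_def)
  then show ?case by (simp add: Cons kmat_adjoint kmat_mult kword_Cons)
qed

lemma proj_mat_kmat: "proj_mat \<phi> p n i = kmat n (kid (block \<phi> p n i))"
  by (rule eq_matI) (auto simp: proj_mat_def kid_def)

lemma kid_sandwich:
  assumes "S \<subseteq> {..<n}" "T \<subseteq> {..<n}"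
  shows "kmul n (kmul n (kid S) X) (kid T) i j = (if i \<in> S \<and> j \<in> T then X i j else 0)"
proof -
  have L: "kmul n (kid S) Y i j = (if i \<in> S then Y i j else 0)" for Y i j
  proof -
    have "kmul n (kid S) Y i j = (\<Sum>s<n. if i = s then (if i \<in> S then Y i j else 0) else 0)"
      unfolding kmul_def kid_def by (rule sum.cong) auto
    then show ?thesis using assms by (auto simp: sum.delta')
  qed
  have "kmul n (kmul n (kid S) X) (kid T) i j = (\<Sum>s<n. if s = j then (if j \<in> T then kmul n (kid S) X i j else 0) else 0)"
    unfolding kmul_def[of n "kmul n _ _"] kid_def by (rule sum.cong) auto
  then show ?thesis using assms by (auto simp: L)
qed

lemma mat_Tr_proj:
  assumes "block \<phi> p n i \<subseteq> {..<n}"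
  shows "mat_Tr (proj_mat \<phi> p n i * kmat n X * proj_mat \<phi> p n i) = (\<Sum>s\<in>block \<phi> p n i. X s s)"
proof -
  let ?S = "block \<phi> p n i"
  have "mat_Tr (proj_mat \<phi> p n i * kmat n X * proj_mat \<phi> p n i) = (\<Sum>s<n. if s \<in> ?S then X s s else 0)"
    unfolding proj_mat_kmat kmat_mult mat_Tr_def using assms by (simp add: kid_sandwich)
  also have "\<dots> = (\<Sum>s\<in>?S. X s s)"
    using assms by (simp add: sum.inter_restrict[symmetric] Int_absorb1)
  finally show ?thesis .
qed

context blocks
begin

lemma kword_alt_False: "m \<ge> 1 \<Longrightarrow> kword n (K f) (alt_word False m) = W m f"
proof (induction m)
  case (Suc m)
  have Kid: "kadj (K f) \<odot> kid {..<n} = kadj (K f)"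
  proof -
    have "kid {..<n} \<odot> K f = K f" by (rule kid_kmul) (use I in \<open>auto intro: K_row\<close>)
    then have "kadj (kid {..<n} \<odot> K f) = kadj (K f)" by simp
    then show ?thesis by (simp add: kadj_kmul)
  qed
  have step: "kword n (K f) (alt_word False (Suc m)) = K f \<odot> (kadj (K f) \<odot> kword n (K f) (alt_word False m))"
    by (simp add: alt_word_Suc kword_Cons)
  show ?case
  proof (cases m)
    case 0
    then show ?thesis unfolding step by (simp add: alt_word_def[of _ 0] kword_Nil Kid W_one del: wpow.simps)
  next
    case (Suc j)
    then show ?thesis unfolding step using Suc.IH by (simp add: kmul_assoc)
  qed
qed simp

lemma kword_alt_True: "kword n (K f) (alt_word True (Suc m)) = kadj (K f) \<odot> (W m f \<odot> K f)"
proof (induction m)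
  case 0
  have "K f \<odot> kid {..<n} = K f"
  proof -
    have "kid {..<n} \<odot> kadj (K f) = kadj (K f)" by (rule kid_kmul) (use J in \<open>auto simp: kadj_def intro: K_col\<close>)
    then have "kadj (kid {..<n} \<odot> kadj (K f)) = K f" by simp
    then show ?thesis by (simp add: kadj_kmul)
  qed
  then show ?case by (simp add: alt_word_Suc alt_word_def[of _ 0] kword_Cons kword_Nil)
next
  case (Suc m)
  then show ?case by (simp add: alt_word_Suc[of _ "Suc m"] kword_Cons kmul_assoc)
qed

lemma kword_row: "es \<noteq> [] \<Longrightarrow> i \<notin> (if hd es then J else I) \<Longrightarrow> kword n (K f) es i j = 0"
  by (cases es) (auto simp: kword_Cons kmul_def kadj_def K_row K_col split: if_splits)

lemma kword_col: "es \<noteq> [] \<Longrightarrow> j \<notin> (if last es then I else J) \<Longrightarrow> kword n (K f) es i j = 0"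
proof (induction es arbitrary: i)
  case (Cons e es)
  show ?case
  proof (cases "es = []")
    case True
    have "kmul n Y (kid {..<n}) i j = (if j < n then Y i j else 0)" for Y
    proof -
      have "kmul n Y (kid {..<n}) i j = (\<Sum>s<n. if s = j then Y i j else 0)" unfolding kmul_def kid_def by (rule sum.cong) auto
      then show ?thesis by simp
    qed
    then show ?thesis using True Cons.prems by (auto simp: kword_Cons kword_Nil kadj_def K_row K_col split: if_splits)
  next
    case False
    then show ?thesis using Cons by (simp add: kword_Cons kmul_def[of n _ "kword n _ _"])
  qed
qed simp

lemma kword_not_alternating: assumes IJ: "I \<inter> J = {}" shows "\<not> successively (\<noteq>) es \<Longrightarrow> kword n (K f) es i j = 0"
proof (induction es arbitrary: i)
  case (Cons e es)
  show ?case
  proof (cases "successively (\<noteq>) es")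
    case True
    then obtain es' where es: "es = e # es'" using Cons.prems by (cases es) (auto simp: successively_Cons)
    define Y where "Y = (if e then kadj (K f) else K f)"
    have "kmul n Y Y = (\<lambda>i j. 0)"
    proof (intro ext)
      fix i j
      have "Y i s * Y s j = 0" for s using IJ by (auto simp: Y_def kadj_def kern_of_def)
      then show "kmul n Y Y i j = 0" by (simp add: kmul_def)
    qed
    moreover have "kword n (K f) (e # es) = kmul n (kmul n Y Y) (kword n (K f) es')"
      by (simp add: es kword_Cons Y_def kmul_assoc)
    ultimately show ?thesis by (simp add: kmul_def[of n "\<lambda>_ _. 0"])
  next
    case False then show ?thesis using Cons.IH by (simp add: kword_Cons kmul_def[of n _ "kword n _ _"])
  qed
qed simp

lemma cvec_norm_eq: "v \<in> carrier_vec n \<Longrightarrow> cvec_norm v = sqrt (vn2 n (vec_index v))"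
proof -
  assume v: "v \<in> carrier_vec n"
  have "v \<bullet>c v = (\<Sum>i<n. vec_index v i * cnj (vec_index v i))"
    using v by (auto simp: scalar_prod_def atLeast0LessThan intro!: sum.cong)
  also have "\<dots> = of_real (vn2 n (vec_index v))"
    unfolding vn2_def of_real_sum by (rule sum.cong) (simp_all add: complex_norm_square[symmetric])
  finally show ?thesis by (simp add: cvec_norm_def)
qed

lemma kmat_mult_vec: "v \<in> carrier_vec n \<Longrightarrow> cvec_norm (kmat n X *\<^sub>v v) = sqrt (vn2 n (kvec n X (vec_index v)))"
proof -
  assume v: "v \<in> carrier_vec n"
  have "kmat n X *\<^sub>v v \<in> carrier_vec n" by (rule mult_mat_vec_carrier[OF kmat_carrier v])
  moreover have "vec_index (kmat n X *\<^sub>v v) i = kvec n X (vec_index v) i" if "i < n" for i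
    using that v by (auto simp: scalar_prod_def kvec_def atLeast0LessThan intro!: sum.cong)
  ultimately show ?thesis by (simp add: cvec_norm_eq vn2_def)
qed

lemma kmat_opnorm_iff:
  assumes R: "R \<ge> 0"
  shows "mat_opnorm (kmat n (K f)) \<le> R \<longleftrightarrow> opbound R f"
proof -
  let ?V = "{v \<in> carrier_vec n. cvec_norm v \<le> 1}"
  have zero: "0\<^sub>v n \<in> ?V" by (simp add: cvec_norm_eq vn2_def)
  have unit: "vn2 n (vec_index v) \<le> 1" if "v \<in> ?V" for v using that cvec_norm_eq[of v] by simp
  have opn: "mat_opnorm (kmat n (K f)) = (SUP v\<in>?V. sqrt (vn2 n (kvec n (K f) (vec_index v))))"
    unfolding mat_opnorm_def dim_kmat by (rule SUP_cong) (auto simp: kmat_mult_vec)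
  \<comment> \<open>A real supremum can be compared with its members only for a bounded set; the
    Hilbert-Schmidt norm provides the bound.\<close>
  have bdd: "bdd_above ((\<lambda>v. sqrt (vn2 n (kvec n (K f) (vec_index v)))) ` ?V)"
  proof (rule bdd_aboveI2)
    fix v assume "v \<in> ?V"
    then have "hs2 n (K f) * vn2 n (vec_index v) \<le> hs2 n (K f) * 1" by (intro mult_left_mono unit) auto
    then show "sqrt (vn2 n (kvec n (K f) (vec_index v))) \<le> sqrt (hs2 n (K f))"
      using vn2_kvec_le[of n "K f" "vec_index v"] by simp
  qed
  show ?thesis
  proof
    assume o: "opbound R f"
    show "mat_opnorm (kmat n (K f)) \<le> R"
      unfolding opn
    proof (rule cSUP_least)
      fix v assume v: "v \<in> ?V"
      have "vn2 n (kvec n (K f) (vec_index v)) \<le> R\<^sup>2 * vn2 n (vec_index v)" using o by (simp add: opbound_def)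
      also have "\<dots> \<le> R\<^sup>2 * 1" by (intro mult_left_mono unit v) auto
      finally show "sqrt (vn2 n (kvec n (K f) (vec_index v))) \<le> R" using R by (simp add: real_le_lsqrt)
    qed (use zero in blast)
  next
    assume le: "mat_opnorm (kmat n (K f)) \<le> R"
    show "opbound R f" unfolding opbound_def
    proof
      fix v
      show "vn2 n (kvec n (K f) v) \<le> R\<^sup>2 * vn2 n v"
      proof (cases "vn2 n v = 0")
        case True
        then show ?thesis using vn2_kvec_le[of n "K f" v] by simp
      next
        case False
        then have pos: "vn2 n v > 0" using vn2_nonneg[of n v] by linarith
        define c where "c = 1 / sqrt (vn2 n v)"
        have c: "c\<^sup>2 * vn2 n v = 1" using pos by (simp add: c_def power_divide)
        define w where "w = Matrix.vec n (\<lambda>i. of_real c * v i)"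
        have scale: "vn2 n (\<lambda>i. of_real c * u i) = c\<^sup>2 * vn2 n u" for u
          by (simp add: vn2_def norm_mult power_mult_distrib sum_distrib_left)
        have "vn2 n (vec_index w) = vn2 n (\<lambda>i. of_real c * v i)" by (simp add: vn2_def w_def)
        then have w: "w \<in> ?V" using c by (simp add: cvec_norm_eq w_def scale)
        have "kvec n (K f) (vec_index w) = (\<lambda>i. of_real c * kvec n (K f) v i)"
          by (auto simp: fun_eq_iff kvec_def w_def sum_distrib_left mult_ac intro!: sum.cong)
        then have "sqrt (c\<^sup>2 * vn2 n (kvec n (K f) v)) = sqrt (vn2 n (kvec n (K f) (vec_index w)))" by (simp only: scale)
        also have "\<dots> \<le> mat_opnorm (kmat n (K f))" unfolding opn by (rule cSUP_upper[OF w bdd])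
        also have "\<dots> \<le> R" by (rule le)
        finally have "c\<^sup>2 * vn2 n (kvec n (K f) v) \<le> R\<^sup>2" by (rule sqrt_le_D)
        then have "c\<^sup>2 * vn2 n (kvec n (K f) v) * vn2 n v \<le> R\<^sup>2 * vn2 n v" by (intro mult_right_mono) auto
        moreover have "c\<^sup>2 * vn2 n (kvec n (K f) v) * vn2 n v = (c\<^sup>2 * vn2 n v) * vn2 n (kvec n (K f) v)" by (simp only: mult_ac)
        ultimately show ?thesis unfolding c by simp
      qed
    qed
  qed
qed

end

lemma op_scale_diff: "op_scale c T - op_scale c' T = op_scale (c - c') T"
proof (rule blinfun_eqI)
  fix v
  have "scaleC (c - c') x + scaleC c' x = scaleC c x" for x :: 'a using scaleC_add_left[of "c - c'" c' x] by simp
  then show "blinfun_apply (op_scale c T - op_scale c' T) v = blinfun_apply (op_scale (c - c') T) v"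
    by (simp add: op_scale.rep_eq blinfun.diff_left algebra_simps)
qed

context rect_element
begin

definition "vI n = block \<phi> p n k"
definition "vJ n = block \<phi> p n l"

lemma blocks_IJ: "blocks n (vI n) (vJ n)"
  by unfold_locales (use block_subset k l in \<open>auto simp: vI_def vJ_def\<close>)

lemma IJ_disjoint: "vI n \<inter> vJ n = {}" using block_disjoint[OF kl] by (simp add: vI_def vJ_def)

lemma card_IJ: "card (vI n) = qdim \<phi> p n k" "card (vJ n) = qdim \<phi> p n l"
  by (simp_all add: vI_def vJ_def card_block[OF k] card_block[OF l])

definition "Mf n f = kmat n (kern_of (vI n) (vJ n) f)"

lemma Mf_eq: "Mf n f = Matrix.mat n n (\<lambda>ij. if ij \<in> block \<phi> p n k \<times> block \<phi> p n l then f ij else 0)"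
  unfolding Mf_def kmat_def by (rule arg_cong[where f = "Matrix.mat n n"]) (auto simp: kern_of_def vI_def vJ_def)

lemma Mf_block: "Mf n f \<in> block_mats \<phi> p n k l"
proof -
  have "Mf n f = proj_mat \<phi> p n k * Mf n f * proj_mat \<phi> p n l"
    unfolding Mf_def proj_mat_kmat kmat_mult
    by (rule arg_cong[where f = "kmat n"]) (use block_subset[OF k] block_subset[OF l] in \<open>auto simp: fun_eq_iff kid_sandwich kern_of_def vI_def vJ_def\<close>)
  then show ?thesis unfolding block_mats_def by (rule image_eqI) (simp add: Mf_def)
qed

definition "mcoef n f i es = 1 / of_nat (qdim \<phi> p n i) * (\<Sum>s\<in>block \<phi> p n i. kword n (kern_of (vI n) (vJ n) f) es s s)"

lemma cond_exp_difference:
  "mat_cond_exp \<phi> d p n (mat_word (Mf n f) es) - cond_exp_D \<phi> d p (op_word b es) = (\<Sum>i=1..d. op_scale (mcoef n f i es - coef i es) (p i))"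
  unfolding mat_cond_exp_def cond_exp_D_def sum_subtractf[symmetric] Mf_def mat_word_kmat
  by (rule sum.cong[OF refl]) (use block_subset in \<open>simp add: mat_Tr_proj op_scale_diff mcoef_def coef_def\<close>)

lemma mcoef_alt_False: assumes "m \<ge> 1" "i \<in> {1..d}"
  shows "mcoef n f i (alt_word False m) = (if i = k then wtr n (vI n) (vJ n) m f / of_nat (qdim \<phi> p n k) else 0)"
proof -
  interpret blocks n "vI n" "vJ n" by (rule blocks_IJ)
  show ?thesis
  proof (cases "i = k")
    case True
    then show ?thesis using sum_diag_I[of m f] by (simp add: mcoef_def kword_alt_False[OF assms(1)] vI_def[symmetric])
  next
    case False
    then have "s \<notin> vI n" if "s \<in> block \<phi> p n i" for s using that block_disjoint[of i k n] by (auto simp: vI_def)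
    then show ?thesis using False by (simp add: mcoef_def kword_alt_False[OF assms(1)] W_row)
  qed
qed

lemma mcoef_alt_True: assumes "m \<ge> 1" "i \<in> {1..d}"
  shows "mcoef n f i (alt_word True m) = (if i = l then wtr n (vI n) (vJ n) m f / of_nat (qdim \<phi> p n l) else 0)"
proof -
  interpret blocks n "vI n" "vJ n" by (rule blocks_IJ)
  obtain j where m: "m = Suc j" using assms by (cases m) auto
  show ?thesis
  proof (cases "i = l")
    case True
    then show ?thesis using sum_diag_J[of f j] by (simp add: mcoef_def m kword_alt_True vJ_def[symmetric])
  next
    case False
    then have "s \<notin> vJ n" if "s \<in> block \<phi> p n i" for s using that block_disjoint[of i l n] by (auto simp: vJ_def)
    then have "kword n (kern_of (vI n) (vJ n) f) (alt_word True m) s s = 0" if "s \<in> block \<phi> p n i" for s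
      using that by (intro kword_row) (auto simp: m alt_word_Suc)
    then show ?thesis using False by (simp add: mcoef_def)
  qed
qed

lemma mcoef_other:
  assumes "es \<noteq> []" "i \<in> {1..d}" "\<And>h m. m \<ge> 1 \<Longrightarrow> es \<noteq> alt_word h m"
  shows "mcoef n f i es = 0"
proof -
  interpret blocks n "vI n" "vJ n" by (rule blocks_IJ)
  have "kword n (kern_of (vI n) (vJ n) f) es s s = 0" for s
  proof (cases "successively (\<noteq>) es")
    case True
    then have e: "hd es = last es" using successively_neq_classification[OF assms(1) True] assms(3) by blast
    then have "s \<notin> (if hd es then vJ n else vI n) \<or> s \<notin> (if last es then vI n else vJ n)" using IJ_disjoint[of n] by auto
    then show ?thesis using kword_row[OF assms(1)] kword_col[OF assms(1)] by blast
  qed (rule kword_not_alternating[OF IJ_disjoint])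
  then show ?thesis by (simp add: mcoef_def)
qed

lemma norm_single_coef:
  assumes j: "j \<in> {1..d}" and c: "\<And>i. i \<in> {1..d} \<Longrightarrow> c i = (if i = j then x else 0)"
  shows "norm (\<Sum>i=1..d. op_scale (c i) (p i)) = cmod x"
proof (rule antisym)
  have "(\<Sum>i=1..d. cmod (c i)) = (\<Sum>i=1..d. if i = j then cmod x else 0)" by (rule sum.cong) (auto simp: c)
  also have "\<dots> = cmod x" using j by simp
  finally show "norm (\<Sum>i=1..d. op_scale (c i) (p i)) \<le> cmod x" using norm_diag_le[of c] by simp
  show "cmod x \<le> norm (\<Sum>i=1..d. op_scale (c i) (p i))" using coeff_le_norm_diag[OF j, of c] c[OF j] by simp
qed

text \<open>For every word both conditional expectations are multiples of one common projection, or
  both are 0. The operator norm in the diagonal algebra is then the modulus of a single coefficient,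
  and the microstate condition reduces to trace moments in the two corners.\<close>

theorem microstates_iff:
  assumes R: "R \<ge> 0" and \<epsilon>: "\<epsilon> \<ge> 0"
  shows "Mf n f \<in> microstates \<phi> d p k l R b n r \<epsilon> \<longleftrightarrow>
    blocks.opbound n (vI n) (vJ n) R f \<and>
    (\<forall>m. 1 \<le> m \<and> 2 * m \<le> r \<longrightarrow> cmod (wtr n (vI n) (vJ n) m f / of_nat (qdim \<phi> p n k) - mom m) \<le> \<epsilon> \<and>
       cmod (wtr n (vI n) (vJ n) m f / of_nat (qdim \<phi> p n l) - of_real (rho \<phi> p k / rho \<phi> p l) * mom m) \<le> \<epsilon>)"
proof -
  interpret blocks n "vI n" "vJ n" by (rule blocks_IJ)
  let ?N = "\<lambda>es. norm (mat_cond_exp \<phi> d p n (mat_word (Mf n f) es) - cond_exp_D \<phi> d p (op_word b es))"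
  have F: "?N (alt_word False m) = cmod (wtr n (vI n) (vJ n) m f / of_nat (qdim \<phi> p n k) - mom m)" if "m \<ge> 1" for m
    unfolding cond_exp_difference by (rule norm_single_coef[OF k]) (auto simp: coef_alt_False[OF that] mcoef_alt_False[OF that])
  have T: "?N (alt_word True m) = cmod (wtr n (vI n) (vJ n) m f / of_nat (qdim \<phi> p n l) - of_real (rho \<phi> p k / rho \<phi> p l) * mom m)" if "m \<ge> 1" for m
    unfolding cond_exp_difference by (rule norm_single_coef[OF l]) (auto simp: coef_alt_True[OF that] mcoef_alt_True[OF that])
  have O: "?N es = 0" if "es \<noteq> []" and alt: "\<And>h m. m \<ge> 1 \<Longrightarrow> es \<noteq> alt_word h m" for es
  proof -
    have "mcoef n f i es - coef i es = (if i = k then 0 else 0)" if i: "i \<in> {1..d}" for i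
      using coef_other[OF \<open>es \<noteq> []\<close> i alt] mcoef_other[OF \<open>es \<noteq> []\<close> i alt] by simp
    from norm_single_coef[OF k this] show ?thesis unfolding cond_exp_difference by simp
  qed
  have "(\<forall>es. 1 \<le> length es \<and> length es \<le> r \<longrightarrow> ?N es \<le> \<epsilon>) \<longleftrightarrow>
    (\<forall>m. 1 \<le> m \<and> 2 * m \<le> r \<longrightarrow> ?N (alt_word False m) \<le> \<epsilon> \<and> ?N (alt_word True m) \<le> \<epsilon>)" (is "?L \<longleftrightarrow> ?Rr")
  proof
    assume L: ?L
    show ?Rr
    proof (intro allI impI)
      fix m assume "1 \<le> m \<and> 2 * m \<le> r"
      then have "1 \<le> length (alt_word h m) \<and> length (alt_word h m) \<le> r" for h by simp
      then show "?N (alt_word False m) \<le> \<epsilon> \<and> ?N (alt_word True m) \<le> \<epsilon>" using L by blast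
    qed
  next
    assume Rr: ?Rr
    show ?L
    proof (intro allI impI)
      fix es :: "bool list" assume es: "1 \<le> length es \<and> length es \<le> r"
      show "?N es \<le> \<epsilon>"
      proof (cases "\<exists>h m. m \<ge> 1 \<and> es = alt_word h m")
        case True
        then obtain h m where hm: "m \<ge> 1" "es = alt_word h m" by blast
        then have "2 * m \<le> r" using es by simp
        then show ?thesis using Rr hm by (cases h) auto
      next
        case False
        have "?N es = 0"
        proof (rule O)
          show "es \<noteq> []" using es by auto
          show "es \<noteq> alt_word h m" if "m \<ge> 1" for h m using False that by blast
        qed
        then show ?thesis using \<epsilon> by simp
      qed
    qed
  qed
  moreover have "mat_opnorm (Mf n f) \<le> R \<longleftrightarrow> opbound R f" unfolding Mf_def by (rule kmat_opnorm_iff[OF R])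
  ultimately show ?thesis unfolding microstates_def using Mf_block F T by auto
qed

end

section \<open>Asymptotics of the volumes\<close>

lemma ln_ennreal_le: assumes "x \<le> ennreal c" "c > 0" shows "ln_ennreal x \<le> ereal (ln c)"
proof (cases "x = 0")
  case False
  obtain r where r: "x = ennreal r" "r \<ge> 0" using assms(1) by (cases x) (auto simp: top_unique)
  then have "r > 0" "r \<le> c" using False assms by auto
  then show ?thesis using r by (simp add: ln_ennreal_def)
qed (simp add: ln_ennreal_def)

lemma ln_ennreal_ge: assumes "ennreal c \<le> x" "c > 0" shows "ereal (ln c) \<le> ln_ennreal x"
proof (cases "x = \<infinity>")
  case False
  then obtain r where r: "x = ennreal r" "r \<ge> 0" by (cases x) auto
  then have "r \<ge> c" using assms by auto
  then show ?thesis using r assms by (simp add: ln_ennreal_def)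
qed (simp add: ln_ennreal_def)

context rect_element
begin

abbreviation "rk \<equiv> rho \<phi> p k"
abbreviation "rl \<equiv> rho \<phi> p l"
abbreviation "q n \<equiv> qdim \<phi> p n k"
abbreviation "ql n \<equiv> qdim \<phi> p n l"
abbreviation "B n \<equiv> vI n \<times> vJ n"
abbreviation "hsq n f \<equiv> (\<Sum>e\<in>B n. (cmod (f e))\<^sup>2)"
abbreviation "T n m f \<equiv> wtr n (vI n) (vJ n) m f"

lemma r_pos: "rk > 0" "rl > 0" using rho_pos k l by auto

lemma finite_B [simp]: "finite (B n)" using blocks.finite_IJ[OF blocks_IJ] by simp

lemma card_B: "card (B n) = q n * ql n" by (simp add: card_cartesian_product card_IJ)

lemma q_bounds: "real (q n) \<le> rk * real n" "rk * real n - 1 \<le> real (q n)"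
  "real (ql n) \<le> rl * real n" "rl * real n - 1 \<le> real (ql n)"
proof -
  have "0 \<le> rk * real n" "0 \<le> rl * real n" using r_pos by auto
  then show "real (q n) \<le> rk * real n" "rk * real n - 1 \<le> real (q n)" "real (ql n) \<le> rl * real n" "rl * real n - 1 \<le> real (ql n)"
    unfolding qdim_def by linarith+
qed

lemma floor_ratio_limit:
  assumes "\<And>n. real (f n) \<le> x * real n" "\<And>n. x * real n - 1 \<le> real (f n)"
  shows "(\<lambda>n. real (f n) / real n) \<longlonglongrightarrow> x"
proof (rule tendsto_sandwich[of "\<lambda>n. x - 1 / real n" _ _ "\<lambda>_. x"])
  show "\<forall>\<^sub>F n in sequentially. x - 1 / real n \<le> real (f n) / real n"
    using eventually_gt_at_top[of 0]
  proof eventually_elim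
    case (elim n)
    have "x - 1 / real n = (x * real n - 1) / real n" using elim by (simp add: diff_divide_distrib)
    also have "\<dots> \<le> real (f n) / real n" by (intro divide_right_mono assms) simp
    finally show ?case .
  qed
  show "\<forall>\<^sub>F n in sequentially. real (f n) / real n \<le> x"
    using eventually_gt_at_top[of 0] by eventually_elim (simp add: divide_le_eq assms)
  have "(\<lambda>n. x - 1 / real n) \<longlonglongrightarrow> x - 0" by (intro tendsto_diff tendsto_const lim_const_over_n)
  then show "(\<lambda>n. x - 1 / real n) \<longlonglongrightarrow> x" by simp
qed simp

lemma q_limits: "(\<lambda>n. real (q n) / real n) \<longlonglongrightarrow> rk" "(\<lambda>n. real (ql n) / real n) \<longlonglongrightarrow> rl"
  using floor_ratio_limit[of q rk] floor_ratio_limit[of ql rl] q_bounds by auto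

lemma q_at_top: "filterlim q at_top sequentially"
proof -
  have "filterlim (\<lambda>n. x * real n - 1) at_top sequentially" if "x > 0" for x using that by real_asymp
  from this[OF r_pos(1)] have "filterlim (\<lambda>n. real (q n)) at_top sequentially"
    by (rule filterlim_at_top_mono) (simp add: q_bounds)
  then show ?thesis by (simp add: filterlim_sequentially_iff_filterlim_real)
qed

text \<open>The normalized logarithm of the Gaussian volume \<open>gvol s n C\<close>, as
  \<open>ln_gvol\<close> shows; \<open>V s C\<close> is its limit.\<close>

definition "U s n C = real (q n) / real n * (C / s) + real (q n) / real n * (real (ql n) / real n) * ln (pi * s)
   - real (q n) / real n * (real (ql n) / real n) * ln (real n) + rk * rl * ln (real n)"
definition "V s C = rk * (C / s) + rk * rl * ln (pi * s)"


text \<open>The terms in ln n cancel only up to rounding of the block sizes. Rounding changes the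
  product of the two proportions by O(1/n), so the surviving error is O(ln n / n).\<close>

lemma U_limit: "(\<lambda>n. U s n C) \<longlonglongrightarrow> V s C"
proof -
  have err: "(\<lambda>n. (rk * rl - real (q n) / real n * (real (ql n) / real n)) * ln (real n)) \<longlonglongrightarrow> 0"
  proof (rule tendsto_rabs_zero_cancel, rule tendsto_sandwich[of "\<lambda>_. 0" _ _ "\<lambda>n. (rk + rl) * (ln (real n) / real n)"])
    show "\<forall>\<^sub>F n in sequentially. 0 \<le> \<bar>(rk * rl - real (q n) / real n * (real (ql n) / real n)) * ln (real n)\<bar>" by simp
    show "\<forall>\<^sub>F n in sequentially. \<bar>(rk * rl - real (q n) / real n * (real (ql n) / real n)) * ln (real n)\<bar> \<le> (rk + rl) * (ln (real n) / real n)"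
      using eventually_ge_at_top[of 1]
    proof eventually_elim
      case (elim n)
      define x y where "x = real (q n) / real n" and "y = real (ql n) / real n"
      have n: "real n > 0" using elim by simp
      have xy: "x \<le> rk" "rk - x \<le> 1 / real n" "y \<le> rl" "rl - y \<le> 1 / real n" "x \<ge> 0" "y \<ge> 0"
      proof -
        have le: "t - a / real n \<le> 1 / real n" if "t * real n - 1 \<le> a" for t a
        proof -
          have "(t * real n - 1) / real n \<le> a / real n" using that by (rule divide_right_mono) simp
          then show ?thesis using n by (simp add: diff_divide_distrib)
        qed
        show "rk - x \<le> 1 / real n" "rl - y \<le> 1 / real n" unfolding x_def y_def by (rule le, rule q_bounds)+
        show "x \<le> rk" "y \<le> rl" using q_bounds[of n] n by (simp_all add: x_def y_def divide_le_eq)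
      qed (simp_all add: x_def y_def)
      have "rk * rl - x * y = rk * (rl - y) + y * (rk - x)" by (simp add: algebra_simps)
      also have "\<dots> \<le> rk * (1 / real n) + rl * (1 / real n)"
        using xy r_pos by (intro add_mono mult_mono) auto
      finally have 1: "rk * rl - x * y \<le> (rk + rl) / real n" by (simp add: add_divide_distrib)
      have 2: "0 \<le> rk * rl - x * y" using xy r_pos by (simp add: mult_mono)
      have ln: "0 \<le> ln (real n)" using elim by simp
      have "\<bar>(rk * rl - x * y) * ln (real n)\<bar> = (rk * rl - x * y) * ln (real n)" using 2 ln by simp
      also have "\<dots> \<le> (rk + rl) / real n * ln (real n)" using 1 ln by (intro mult_right_mono)
      finally show ?case by (simp add: x_def y_def)
    qed
    have "(\<lambda>n. ln (real n) / real n) \<longlonglongrightarrow> 0" by real_asymp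
    from tendsto_mult[OF tendsto_const[of "rk + rl"] this] show "(\<lambda>n. (rk + rl) * (ln (real n) / real n)) \<longlonglongrightarrow> 0" by simp
  qed simp
  have "(\<lambda>n. real (q n) / real n * (C / s) + real (q n) / real n * (real (ql n) / real n) * ln (pi * s)
     + (rk * rl - real (q n) / real n * (real (ql n) / real n)) * ln (real n)) \<longlonglongrightarrow> rk * (C / s) + rk * rl * ln (pi * s) + 0"
    by (intro tendsto_add tendsto_mult q_limits tendsto_const err)
  then show ?thesis by (simp add: U_def[abs_def] V_def algebra_simps)
qed

definition "xval n v = ereal (1 / (real n)\<^sup>2) * ln_ennreal v + ereal (rk * rl * ln (real n))"

text \<open>The reciprocal of the Gaussian density with \<tau> = s / n on the sphere where the
  squared Hilbert-Schmidt norm equals \<open>q n\<close> times C.\<close>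

definition "gvol s n C = exp (real (q n) * C / (s / real n)) * (pi * (s / real n)) ^ card (B n)"

lemma gvol_pos: "s > 0 \<Longrightarrow> n > 0 \<Longrightarrow> gvol s n C > 0" by (simp add: gvol_def)

lemma ln_gvol:
  assumes "s > 0" "n > 0"
  shows "1 / (real n)\<^sup>2 * ln (gvol s n C) + rk * rl * ln (real n) = U s n C"
proof -
  have "ln (gvol s n C) = real (q n) * C / (s / real n) + real (q n * ql n) * (ln (pi * s) - ln (real n))"
    unfolding gvol_def using assms by (simp add: ln_mult ln_realpow ln_div card_B)
  then show ?thesis using assms by (simp add: U_def power2_eq_square) (simp add: field_simps)
qed

lemma xval_le:
  assumes s: "s > 0" and n: "n > 0" and v: "v \<le> ennreal c" "c > 0"
  shows "xval n v \<le> ereal (1 / (real n)\<^sup>2 * ln c + rk * rl * ln (real n))"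
proof -
  have "ereal (1 / (real n)\<^sup>2) * ln_ennreal v \<le> ereal (1 / (real n)\<^sup>2) * ereal (ln c)"
    by (intro ereal_mult_left_mono ln_ennreal_le v) simp
  then show ?thesis unfolding xval_def plus_ereal.simps(1)[symmetric] by (intro add_right_mono) simp
qed

lemma xval_ge:
  assumes s: "s > 0" and n: "n > 0" and v: "ennreal c \<le> v" "c > 0"
  shows "ereal (1 / (real n)\<^sup>2 * ln c + rk * rl * ln (real n)) \<le> xval n v"
proof -
  have "ereal (1 / (real n)\<^sup>2) * ereal (ln c) \<le> ereal (1 / (real n)\<^sup>2) * ln_ennreal v"
    by (intro ereal_mult_left_mono ln_ennreal_ge v) simp
  then show ?thesis unfolding xval_def plus_ereal.simps(1)[symmetric] by (intro add_right_mono) simp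
qed

definition "Gam R n r \<epsilon> = {f \<in> space (lborelN (B n)). Mf n f \<in> microstates \<phi> d p k l R b n r \<epsilon>}"

lemma block_volume_eq: "block_volume \<phi> p n k l (microstates \<phi> d p k l R b n r \<epsilon>) = emeasure (lborelN (B n)) (Gam R n r \<epsilon>)"
  unfolding block_volume_def Let_def Gam_def Mf_eq vI_def vJ_def ..

lemma free_entropy_eq: "free_entropy_D \<phi> d p k l b =
   (SUP R\<in>{0<..}. INF r\<in>{1..}. INF \<epsilon>\<in>{0<..}. limsup (\<lambda>n. xval n (emeasure (lborelN (B n)) (Gam R n r \<epsilon>))))"
  unfolding free_entropy_D_def block_volume_eq xval_def ..

lemma wtr_lborel_measurable [measurable]: "wtr n (vI n) (vJ n) m \<in> borel_measurable (lborelN (B n))"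
  using polyfun_measurable[OF blocks.wtr_polyfun[OF blocks_IJ]] by (simp add: measurable_cong_sets[OF sets_lborelN refl])

lemma opbound_sets: "{f \<in> space (lborelN (B n)). blocks.opbound n (vI n) (vJ n) R f} \<in> sets (lborelN (B n))"
  unfolding blocks.opbound_iff[OF blocks_IJ] by measurable

lemma Gam_sets: assumes "R \<ge> 0" "\<epsilon> \<ge> 0" shows "Gam R n r \<epsilon> \<in> sets (lborelN (B n))"
proof -
  note [measurable] = opbound_sets
  have "Gam R n r \<epsilon> = {f \<in> space (lborelN (B n)). blocks.opbound n (vI n) (vJ n) R f \<and>
    (\<forall>m. 1 \<le> m \<and> 2 * m \<le> r \<longrightarrow> cmod (T n m f / of_nat (q n) - mom m) \<le> \<epsilon> \<and>
       cmod (T n m f / of_nat (ql n) - of_real (rk / rl) * mom m) \<le> \<epsilon>)}"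
    unfolding Gam_def microstates_iff[OF assms] ..
  then show ?thesis by simp
qed

lemma wtr_one_hsq: "Re (T n 1 f) = hsq n f"
  using blocks.wtr_one[OF blocks_IJ] by simp

lemma Gam_moment:
  assumes f: "f \<in> Gam R n r \<epsilon>" and R: "R \<ge> 0" "\<epsilon> \<ge> 0" and m: "1 \<le> m" "2 * m \<le> r" and q: "q n > 0"
  shows "cmod (T n m f / of_nat (q n) - mom m) \<le> \<epsilon>" "Re (T n m f) \<le> real (q n) * (Re (mom m) + \<epsilon>)"
proof -
  show c: "cmod (T n m f / of_nat (q n) - mom m) \<le> \<epsilon>" using f microstates_iff[OF R] m by (simp add: Gam_def)
  have "Re (T n m f / of_nat (q n) - mom m) \<le> \<epsilon>" by (rule order_trans[OF complex_Re_le_cmod c])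
  then show "Re (T n m f) \<le> real (q n) * (Re (mom m) + \<epsilon>)" using q by (simp add: field_simps)
qed

lemma ev_q: "\<forall>\<^sub>F n in sequentially. n > 0 \<and> q n > 0"
  using eventually_gt_at_top[of 0] q_at_top[unfolded filterlim_at_top, rule_format, of 1] by eventually_elim simp

lemma free_entropy_le_if:
  assumes "\<And>R. R > 0 \<Longrightarrow> \<exists>r\<ge>1. \<exists>\<epsilon>>0. limsup (\<lambda>n. xval n (emeasure (lborelN (B n)) (Gam R n r \<epsilon>))) \<le> v"
  shows "free_entropy_D \<phi> d p k l b \<le> v"
  unfolding free_entropy_eq
proof (rule SUP_least)
  fix R :: real assume "R \<in> {0<..}"
  then obtain r \<epsilon> where r: "r \<ge> 1" "\<epsilon> > 0" "limsup (\<lambda>n. xval n (emeasure (lborelN (B n)) (Gam R n r \<epsilon>))) \<le> v" using assms[of R] by auto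
  then show "(INF r\<in>{1..}. INF \<epsilon>\<in>{0<..}. limsup (\<lambda>n. xval n (emeasure (lborelN (B n)) (Gam R n r \<epsilon>)))) \<le> v"
    by (intro INF_lower2[of r] INF_lower2[of \<epsilon>]) auto
qed

lemma limsup_le_real:
  fixes y :: "nat \<Rightarrow> real"
  assumes "\<forall>\<^sub>F n in sequentially. x n \<le> ereal (y n)" "y \<longlonglongrightarrow> L"
  shows "limsup x \<le> ereal L"
proof -
  have "limsup x \<le> limsup (\<lambda>n. ereal (y n))" using assms(1) by (rule Limsup_mono)
  also have "\<dots> = ereal L" using assms(2) by (intro lim_imp_Limsup) auto
  finally show ?thesis .
qed

lemma limsup_ge_real:
  fixes y :: "nat \<Rightarrow> real"
  assumes "\<forall>\<^sub>F n in sequentially. ereal (y n) \<le> x n" "y \<longlonglongrightarrow> L"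
  shows "ereal L \<le> limsup x"
proof -
  have "limsup (\<lambda>n. ereal (y n)) \<le> limsup x" using assms(1) by (rule Limsup_mono)
  moreover have "limsup (\<lambda>n. ereal (y n)) = ereal L" using assms(2) by (intro lim_imp_Limsup) auto
  ultimately show ?thesis by simp
qed

theorem free_entropy_upper_bound:
  assumes s: "s > 0" and c: "Re (mom 1) \<le> c"
  shows "free_entropy_D \<phi> d p k l b \<le> ereal (V s c)"
proof (rule ereal_le_epsilon2)
  fix e :: real assume e: "0 < e"
  \<comment> \<open>Chosen so that \<open>V s (c + \<epsilon>)\<close> exceeds \<open>V s c\<close>
    by exactly e.\<close>
  define \<epsilon> where "\<epsilon> = e * s / rk"
  have \<epsilon>: "\<epsilon> > 0" using e s r_pos by (simp add: \<epsilon>_def)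
  have "free_entropy_D \<phi> d p k l b \<le> ereal (V s (c + \<epsilon>))"
  proof (rule free_entropy_le_if)
    fix R :: real assume R: "R > 0"
    \<comment> \<open>Words of length at most 2 suffice: the bound uses the first moment
      only.\<close>
    have "limsup (\<lambda>n. xval n (emeasure (lborelN (B n)) (Gam R n 2 \<epsilon>))) \<le> ereal (V s (c + \<epsilon>))"
    proof (rule limsup_le_real[OF _ U_limit])
      show "\<forall>\<^sub>F n in sequentially. xval n (emeasure (lborelN (B n)) (Gam R n 2 \<epsilon>)) \<le> ereal (U s n (c + \<epsilon>))"
        using ev_q
      proof eventually_elim
        case (elim n)
        then have n: "n > 0" and q: "q n > 0" by auto
        have "emeasure (lborelN (B n)) (Gam R n 2 \<epsilon>) \<le> ennreal (gvol s n (c + \<epsilon>))"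
          unfolding gvol_def
        proof (rule volume_le_gaussian)
          fix f assume f: "f \<in> Gam R n 2 \<epsilon>"
          have "hsq n f \<le> real (q n) * (Re (mom 1) + \<epsilon>)"
            using Gam_moment(2)[OF f, of 1] R \<epsilon> q by (simp add: wtr_one_hsq[symmetric])
          also have "\<dots> \<le> real (q n) * (c + \<epsilon>)" using c by (intro mult_left_mono) auto
          finally show "hsq n f \<le> real (q n) * (c + \<epsilon>)" .
        qed (use s n R \<epsilon> in \<open>auto intro: Gam_sets\<close>)
        from xval_le[OF s n this gvol_pos[OF s n]] show ?case unfolding ln_gvol[OF s n] .
      qed
    qed
    then show "\<exists>r\<ge>1. \<exists>\<epsilon>'>0. limsup (\<lambda>n. xval n (emeasure (lborelN (B n)) (Gam R n r \<epsilon>'))) \<le> ereal (V s (c + \<epsilon>))"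
      using \<epsilon> by (intro exI[of _ 2] exI[of _ \<epsilon>]) auto
  qed
  also have "V s (c + \<epsilon>) = V s c + e" using s r_pos by (simp add: V_def \<epsilon>_def field_simps)
  finally show "free_entropy_D \<phi> d p k l b \<le> ereal (V s c) + ereal e" by simp
qed

text \<open>What the law of large numbers provides: moments in the corner of k only, normalized by
  \<open>q n\<close>, together with a norm bound. The conditions in the other corner follow from the
  convergence of \<open>q n / ql n\<close>.\<close>

definition "good M R n r \<epsilon> = {f \<in> space (lborelN (B n)). (\<forall>m\<le>r. \<bar>Re (T n m f) / q n - M m\<bar> \<le> \<epsilon>) \<and> blocks.opbound n (vI n) (vJ n) R f}"

lemma good_sets: "good M R n r \<epsilon> \<in> sets (lborelN (B n))"
proof -
  note [measurable] = opbound_sets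
  show ?thesis unfolding good_def by measurable
qed

lemma good_moment: "f \<in> good M R n r \<epsilon> \<Longrightarrow> m \<le> r \<Longrightarrow> cmod (T n m f / of_nat (q n) - of_real (M m)) \<le> \<epsilon>"
proof -
  assume f: "f \<in> good M R n r \<epsilon>" "m \<le> r"
  have "T n m f / of_nat (q n) - of_real (M m) = of_real (Re (T n m f) / q n - M m)"
    by (subst blocks.wtr_real(1)[OF blocks_IJ]) simp
  then have "cmod (T n m f / of_nat (q n) - of_real (M m)) = \<bar>Re (T n m f) / q n - M m\<bar>" by (simp only: norm_of_real)
  then show ?thesis using f by (simp add: good_def)
qed

end

text \<open>The sequence M satisfies the limiting Wishart recursion but is not tied to the element.
  The locale can thus be used for the element with these moments and for a competitor that is
  compared with the same Gaussian matrices.\<close>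

locale extremal = rect_element A \<phi> d p k l b for A :: "('h :: chilbert_space) bop set" and \<phi> d p k l b +
  fixes c :: real and M :: "nat \<Rightarrow> real"
  assumes c: "c > 0" and rkl: "rho \<phi> p k \<le> rho \<phi> p l" and M0: "M 0 = 1"
    and Mrec: "\<And>m. M (Suc m) = c * M m + c * rho \<phi> p k / rho \<phi> p l * (\<Sum>r<m. M (Suc r) * M (m - 1 - r))"
begin

text \<open>The zero of the derivative of \<open>V s c\<close> with respect to s. With this s the
  Gaussian matrices also have limiting first moment c, so the Gaussian weight is spent exactly where
  the upper bound is tight.\<close>

definition "s = c / rl"
text \<open>One more than the threshold 4 \<alpha> + 6 \<beta> + 4 of the law of large numbers for
  \<alpha> = c and \<beta> = c rk / rl.\<close>

definition "Q = 4 * c + 6 * (c * rk / rl) + 5"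
definition "R0 = sqrt (2 * Q)"

lemma s_pos: "s > 0" using c r_pos by (simp add: s_def)
lemma Q_pos: "Q > 0" using c r_pos by (simp add: Q_def add_pos_pos)
lemma R0_pos: "R0 > 0" using Q_pos by (simp add: R0_def)
lemma M1: "M 1 = c" using Mrec[of 0] M0 by simp

lemma good_probability:
  assumes "\<epsilon> > 0"
  shows "\<forall>\<^sub>F n in sequentially. 1 / 2 \<le> measure (cgaussN (B n) (s / n)) (good M R0 n r \<epsilon>)"
proof -
  have "\<forall>\<^sub>F n in sequentially. 1 / 2 \<le> measure (cgaussN (vI n \<times> vJ n) (s / real n)) {f \<in> space (cgaussN (vI n \<times> vJ n) (s / real n)).
     (\<forall>m\<le>r. \<bar>Re (wtr n (vI n) (vJ n) m f) / card (vI n) - M m\<bar> \<le> \<epsilon>) \<and> blocks.opbound n (vI n) (vJ n) (sqrt (2 * Q)) f}"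
  proof (rule wishart_law_of_large_numbers[where \<alpha> = c and \<beta> = "c * rk / rl"])
    show "\<forall>\<^sub>F n in sequentially. blocks n (vI n) (vJ n)" by (simp add: blocks_IJ)
    show "\<forall>\<^sub>F n in sequentially. 0 < s / real n" using eventually_gt_at_top[of 0] by eventually_elim (simp add: s_pos)
    show "filterlim (\<lambda>n. card (vI n)) at_top sequentially" using q_at_top by (simp add: card_IJ)
    have "(\<lambda>n. s * (real (ql n) / real n)) \<longlonglongrightarrow> s * rl" by (intro tendsto_mult tendsto_const q_limits)
    then show "(\<lambda>n. s / real n * real (card (vJ n))) \<longlonglongrightarrow> c" using r_pos by (simp add: card_IJ s_def)
    have "(\<lambda>n. s * (real (q n) / real n)) \<longlonglongrightarrow> s * rk" by (intro tendsto_mult tendsto_const q_limits)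
    then show "(\<lambda>n. s / real n * real (card (vI n))) \<longlonglongrightarrow> c * rk / rl" by (simp add: card_IJ s_def)
    show "4 * c + 6 * (c * rk / rl) + 4 < Q" by (simp add: Q_def)
  qed (rule M0 Mrec assms)+
  moreover have "space (cgaussN (B n) t) = space (lborelN (B n))" for n t by (simp add: space_PiM)
  ultimately show ?thesis unfolding good_def R0_def card_IJ by (simp only:)
qed

lemma good_volume:
  assumes \<epsilon>: "\<epsilon> > 0" and r: "r \<ge> 1"
  shows "\<forall>\<^sub>F n in sequentially. ennreal (1 / 2 * gvol s n (c - \<epsilon>)) \<le> emeasure (lborelN (B n)) (good M R0 n r \<epsilon>)"
  using good_probability[OF \<epsilon>, of r] ev_q
proof eventually_elim
  case (elim n)
  then have n: "n > 0" and q: "q n > 0" by auto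
  show ?case unfolding gvol_def
  proof (rule volume_ge_gaussian)
    fix f assume f: "f \<in> good M R0 n r \<epsilon>"
    then have "\<bar>Re (T n 1 f) / q n - M 1\<bar> \<le> \<epsilon>" using r by (simp add: good_def)
    then have "c - \<epsilon> \<le> hsq n f / q n" unfolding wtr_one_hsq M1 by linarith
    then show "real (q n) * (c - \<epsilon>) \<le> hsq n f" using q by (simp add: field_simps)
  qed (use elim s_pos n in \<open>auto intro: good_sets\<close>)
qed

text \<open>In the corner of l the normalized trace is multiplied by \<open>q n / ql n\<close>,
  which converges to rk / rl \<le> 1 and is eventually at most 2. The error is then at most 2
  (\<epsilon> / 4) from the moment and \<epsilon> / 2 from the ratio.\<close>

lemma good_subset_Gam:
  assumes mom: "\<And>m. mom m = of_real (M m)" and \<epsilon>: "\<epsilon> > 0" "\<epsilon>' > 0" "\<epsilon>' \<le> \<epsilon> / 4"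
  shows "\<forall>\<^sub>F n in sequentially. good M R0 n r \<epsilon>' \<subseteq> Gam R0 n r \<epsilon>"
proof -
  define C where "C = (\<Sum>m\<le>r. \<bar>M m\<bar>) + 1"
  have C: "C > 0" "m \<le> r \<Longrightarrow> \<bar>M m\<bar> \<le> C" for m
  proof -
    show "C > 0" unfolding C_def by (intro add_nonneg_pos sum_nonneg) auto
    show "\<bar>M m\<bar> \<le> C" if "m \<le> r" using member_le_sum[of m "{..r}" "\<lambda>m. \<bar>M m\<bar>"] that by (simp add: C_def)
  qed
  have lim: "(\<lambda>n. (real (q n) / real n) / (real (ql n) / real n)) \<longlonglongrightarrow> rk / rl"
    by (intro tendsto_divide q_limits) (use r_pos in simp)
  have lim': "(\<lambda>n. real (q n) / real (ql n)) \<longlonglongrightarrow> rk / rl"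
    by (rule Lim_transform_eventually[OF lim]) (use eventually_gt_at_top[of 0] in eventually_elim, simp)
  \<comment> \<open>The bound 1 keeps the ratio below 2; the other bound makes the error of the
    ratio times a moment of size at most C no larger than \<epsilon> / 2.\<close>
  define \<delta> where "\<delta> = min 1 (\<epsilon> / (2 * C))"
  have \<delta>: "\<delta> > 0" using \<epsilon> C by (simp add: \<delta>_def)
  have rat: "rk / rl \<le> 1" using rkl r_pos by simp
  from tendstoD[OF lim' \<delta>] ev_q show ?thesis
  proof eventually_elim
    case (elim n)
    then have q: "q n > 0" and d: "\<bar>real (q n) / real (ql n) - rk / rl\<bar> < \<delta>" by (auto simp: dist_real_def)
    show ?case
    proof
      fix f assume f: "f \<in> good M R0 n r \<epsilon>'"
      have "cmod (T n m f / of_nat (q n) - mom m) \<le> \<epsilon> \<and> cmod (T n m f / of_nat (ql n) - of_real (rk / rl) * mom m) \<le> \<epsilon>"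
        if m: "1 \<le> m \<and> 2 * m \<le> r" for m
      proof
        have 1: "cmod (T n m f / of_nat (q n) - of_real (M m)) \<le> \<epsilon>'" by (rule good_moment[OF f]) (use m in simp)
        then show "cmod (T n m f / of_nat (q n) - mom m) \<le> \<epsilon>" using \<epsilon> by (simp add: mom)
        define x where "x = real (q n) / real (ql n)"
        have x: "\<bar>x - rk / rl\<bar> < \<delta>" "0 \<le> x" using d by (auto simp: x_def)
        have "\<delta> \<le> 1" unfolding \<delta>_def by (rule min.cobounded1)
        then have x2: "x \<le> 2" using x(1) rat by linarith
        have "T n m f / of_nat (ql n) = of_real x * (T n m f / of_nat (q n))" using q by (simp add: x_def)
        then have "T n m f / of_nat (ql n) - of_real (rk / rl) * mom m = of_real x * (T n m f / of_nat (q n) - of_real (M m)) + of_real ((x - rk / rl) * M m)"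
          by (simp add: mom algebra_simps)
        also have "cmod \<dots> \<le> x * \<epsilon>' + \<delta> * C"
        proof (rule order_trans[OF norm_triangle_ineq], rule add_mono)
          show "cmod (of_real x * (T n m f / of_nat (q n) - of_real (M m))) \<le> x * \<epsilon>'"
            using 1 x(2) by (simp add: norm_mult mult_left_mono)
          have "\<bar>x - rk / rl\<bar> * \<bar>M m\<bar> \<le> \<delta> * C" using x C(2)[of m] m \<delta> by (intro mult_mono) auto
          then show "cmod (of_real ((x - rk / rl) * M m)) \<le> \<delta> * C" by (simp only: norm_of_real abs_mult)
        qed
        also have "\<dots> \<le> 2 * (\<epsilon> / 4) + \<epsilon> / (2 * C) * C" using x2 x(2) \<epsilon> C(1) by (intro add_mono mult_mono) (auto simp: \<delta>_def)
        also have "\<dots> = \<epsilon>" using C(1) by simp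
        finally show "cmod (T n m f / of_nat (ql n) - of_real (rk / rl) * mom m) \<le> \<epsilon>" .
      qed
      then show "f \<in> Gam R0 n r \<epsilon>" using f R0_pos \<epsilon>(1) unfolding Gam_def by (simp add: microstates_iff good_def)
    qed
  qed
qed

text \<open>The probability 1/2 contributes ln (1/2) / n^2 and is invisible in the limit.\<close>

lemma inverse_square_limit: "(\<lambda>n. U s n C + 1 / (real n)\<^sup>2 * ln (1 / 2)) \<longlonglongrightarrow> V s C"
proof -
  have "(\<lambda>n. 1 / (real n)\<^sup>2 * ln (1 / 2 :: real)) \<longlonglongrightarrow> 0" by real_asymp
  from tendsto_add[OF U_limit this] show ?thesis by simp
qed

theorem free_entropy_lower_bound:
  assumes mom: "\<And>m. mom m = of_real (M m)"
  shows "ereal (V s c) \<le> free_entropy_D \<phi> d p k l b"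
proof -
  \<comment> \<open>One cutoff R0 works for all r and \<epsilon>, which is what a supremum over R
    outside the infima asks for.\<close>
  have "ereal (V s c) \<le> (INF r\<in>{1..}. INF \<epsilon>\<in>{0<..}. limsup (\<lambda>n. xval n (emeasure (lborelN (B n)) (Gam R0 n r \<epsilon>))))"
  proof (intro INF_greatest)
    fix r :: nat and \<epsilon> :: real assume "r \<in> {1..}" "\<epsilon> \<in> {0<..}"
    then have r: "r \<ge> 1" and \<epsilon>: "\<epsilon> > 0" by auto
    show "ereal (V s c) \<le> limsup (\<lambda>n. xval n (emeasure (lborelN (B n)) (Gam R0 n r \<epsilon>)))" (is "_ \<le> ?L")
    proof (rule ereal_le_epsilon2)
      fix e :: real assume e: "0 < e"
      \<comment> \<open>The first bound is the one demanded by \<open>good_subset_Gam\<close>; the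
        second keeps the loss in \<open>V s (c - \<epsilon>')\<close> below e.\<close>
      define \<epsilon>' where "\<epsilon>' = min (\<epsilon> / 4) (e * s / rk)"
      have \<epsilon>': "\<epsilon>' > 0" "\<epsilon>' \<le> \<epsilon> / 4" "\<epsilon>' \<le> e * s / rk"
      proof -
        show "\<epsilon>' > 0" using \<epsilon> e s_pos r_pos by (simp add: \<epsilon>'_def)
        show "\<epsilon>' \<le> \<epsilon> / 4" unfolding \<epsilon>'_def by (rule min.cobounded1)
        show "\<epsilon>' \<le> e * s / rk" unfolding \<epsilon>'_def by (rule min.cobounded2)
      qed
      have "ereal (V s (c - \<epsilon>')) \<le> ?L"
      proof (rule limsup_ge_real[OF _ inverse_square_limit])
        show "\<forall>\<^sub>F n in sequentially. ereal (U s n (c - \<epsilon>') + 1 / (real n)\<^sup>2 * ln (1 / 2)) \<le> xval n (emeasure (lborelN (B n)) (Gam R0 n r \<epsilon>))"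
          using good_volume[OF \<epsilon>'(1) r] good_subset_Gam[OF mom \<epsilon> \<epsilon>'(1,2), of r] ev_q
        proof eventually_elim
          case (elim n)
          then have n: "n > 0" by simp
          have "emeasure (lborelN (B n)) (good M R0 n r \<epsilon>') \<le> emeasure (lborelN (B n)) (Gam R0 n r \<epsilon>)"
            by (intro emeasure_mono elim Gam_sets) (use R0_pos \<epsilon> in auto)
          with elim(1) have v: "ennreal (1 / 2 * gvol s n (c - \<epsilon>')) \<le> emeasure (lborelN (B n)) (Gam R0 n r \<epsilon>)" by (rule order_trans)
          have g: "gvol s n (c - \<epsilon>') > 0" by (rule gvol_pos[OF s_pos n])
          have "1 / (real n)\<^sup>2 * ln (1 / 2 * gvol s n (c - \<epsilon>')) + rk * rl * ln (real n) = U s n (c - \<epsilon>') + 1 / (real n)\<^sup>2 * ln (1 / 2)"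
            unfolding ln_gvol[OF s_pos n, symmetric] using g by (subst ln_mult) (auto simp: algebra_simps)
          then show ?case using xval_ge[OF s_pos n v] g by simp
        qed
      qed
      moreover have "V s c \<le> V s (c - \<epsilon>') + e"
      proof -
        have "rk * (\<epsilon>' / s) \<le> e" using \<epsilon>'(3) r_pos s_pos by (simp add: field_simps)
        then show ?thesis by (simp add: V_def diff_divide_distrib right_diff_distrib)
      qed
      ultimately show "ereal (V s c) \<le> ?L + ereal e"
      proof -
        have "ereal (V s c) \<le> ereal (V s (c - \<epsilon>')) + ereal e" using \<open>V s c \<le> V s (c - \<epsilon>') + e\<close> by simp
        also have "\<dots> \<le> ?L + ereal e" using \<open>ereal (V s (c - \<epsilon>')) \<le> ?L\<close> by (rule add_right_mono)
        finally show ?thesis .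
      qed
    qed
  qed
  also have "\<dots> \<le> free_entropy_D \<phi> d p k l b"
    unfolding free_entropy_eq by (rule SUP_upper) (use R0_pos in simp)
  finally show ?thesis .
qed

lemma midpoint_norm:
  fixes f g :: "'i \<Rightarrow> complex"
  shows "(\<Sum>e\<in>S. (cmod ((f e + g e) / 2))\<^sup>2) = ((\<Sum>e\<in>S. (cmod (f e))\<^sup>2) + (\<Sum>e\<in>S. (cmod (g e))\<^sup>2)) / 2 - (\<Sum>e\<in>S. (cmod (f e - g e))\<^sup>2) / 4"
proof -
  have *: "(cmod ((z + w) / 2))\<^sup>2 = ((cmod z)\<^sup>2 + (cmod w)\<^sup>2) / 2 - (cmod (z - w))\<^sup>2 / 4" for z w
    unfolding cmod_power2 by (simp add: power2_eq_square field_simps)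
  show ?thesis unfolding * by (simp only: sum_subtractf sum_divide_distrib[symmetric] sum.distrib)
qed

text \<open>All parameters, and the bound L, are fixed before R is introduced, so that the strict
  inequality survives the supremum over R.\<close>

theorem free_entropy_strict:
  assumes c1: "Re (mom 1) \<le> c" and m: "m \<ge> 1" and ne: "mom m \<noteq> of_real (M m)"
  shows "free_entropy_D \<phi> d p k l b < ereal (V s c)"
proof -
  define \<eta> where "\<eta> = cmod (mom m - of_real (M m))"
  have \<eta>: "\<eta> > 0" using ne by (simp add: \<eta>_def)
  \<comment> \<open>Bounds the normalized moments up to order 4 m of both families of matrices; the
    summand 1 covers the tolerance \<epsilon> \<le> 1 and the zeroth moment.\<close>
  define C where "C = (\<Sum>j\<le>4 * m. cmod (mom j) + \<bar>M j\<bar>) + 1"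
  have Cj: "cmod (mom j) + 1 \<le> C" "\<bar>M j\<bar> + 1 \<le> C" if "j \<le> 4 * m" for j
  proof -
    have "cmod (mom j) + \<bar>M j\<bar> \<le> (\<Sum>j\<le>4 * m. cmod (mom j) + \<bar>M j\<bar>)" by (rule member_le_sum) (use that in auto)
    then show "cmod (mom j) + 1 \<le> C" "\<bar>M j\<bar> + 1 \<le> C"
      using norm_ge_zero[of "mom j"] abs_ge_zero[of "M j"] unfolding C_def by linarith+
  qed
  have C: "C \<ge> 1" unfolding C_def by (simp add: sum_nonneg)
  \<comment> \<open>Solves (\<eta> / 2) q = 2 m times the square root of D q C for the squared
    distance D: the difference bound then reads D \<ge> q \<delta>.\<close>
  define \<delta> where "\<delta> = \<eta>\<^sup>2 / (16 * (real m)\<^sup>2 * C)"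
  have \<delta>: "\<delta> > 0" using \<eta> m C by (simp add: \<delta>_def)
  \<comment> \<open>The bound \<eta> / 4 leaves a moment gap of at least \<eta> / 2 between the two
    families; the bound \<delta> / 12 makes 3 \<epsilon> smaller than the gain \<delta> / 2.\<close>
  define \<epsilon> where "\<epsilon> = min 1 (min (\<eta> / 4) (\<delta> / 12))"
  have \<epsilon>: "\<epsilon> > 0" "\<epsilon> \<le> 1" "\<epsilon> \<le> \<eta> / 4" "\<epsilon> \<le> \<delta> / 12" using \<eta> \<delta> by (auto simp: \<epsilon>_def)
  \<comment> \<open>Twice 4 m, so that all moments up to order 4 m are constrained by words of
    length at most r.\<close>
  define r where "r = 8 * m"
  have r: "r \<ge> 1" "r \<ge> 2" using m by (auto simp: r_def)
  define C' where "C' = c + \<epsilon> - \<delta> / 4"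
  \<comment> \<open>The logarithmic form of dividing the squared volume of the midpoints by the
    volume of the good matrices. As V is affine in its second argument, L exceeds
    \<open>V s c\<close> by rk / s times 3 \<epsilon> - \<delta> / 2, which is negative.\<close>
  define L where "L = 2 * V s C' - V s (c - \<epsilon>)"
  have "free_entropy_D \<phi> d p k l b \<le> ereal L"
  proof (rule free_entropy_le_if)
    fix R :: real assume R: "R > 0"
    have "limsup (\<lambda>n. xval n (emeasure (lborelN (B n)) (Gam R n r \<epsilon>))) \<le> ereal L"
    proof (rule limsup_le_real)
      show "(\<lambda>n. 2 * U s n C' - (U s n (c - \<epsilon>) + 1 / (real n)\<^sup>2 * ln (1 / 2))) \<longlonglongrightarrow> L"
        unfolding L_def by (intro tendsto_diff tendsto_mult tendsto_const U_limit inverse_square_limit)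
      show "\<forall>\<^sub>F n in sequentially. xval n (emeasure (lborelN (B n)) (Gam R n r \<epsilon>)) \<le> ereal (2 * U s n C' - (U s n (c - \<epsilon>) + 1 / (real n)\<^sup>2 * ln (1 / 2)))"
        using good_volume[OF \<epsilon>(1) r(1)] ev_q
      proof eventually_elim
        case (elim n)
        then have n: "n > 0" and q: "q n > 0" by auto
        let ?L = "lborelN (B n)"
        \<comment> \<open>A Hilbert-Schmidt ball containing all midpoints. By the parallelogram law
          its normalized squared radius C' lies a quarter of \<delta> below c + \<epsilon>.\<close>
        define X where "X = {h \<in> space ?L. hsq n h \<le> real (q n) * C'}"
        have Xs: "X \<in> sets ?L" unfolding X_def by measurable
        have GX: "(\<lambda>e\<in>B n. (f e + g e) / 2) \<in> X" if f: "f \<in> Gam R n r \<epsilon>" and g: "g \<in> good M R0 n r \<epsilon>" for f g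
        proof -
          interpret blocks n "vI n" "vJ n" by (rule blocks_IJ)
          have T0: "Re (T n 0 h) = real (q n)" for h by (simp add: K_wtr0 card_IJ)
          have bf: "Re (T n j f) \<le> real (q n) * C" if j: "j \<le> 4 * m" for j
          proof (cases "j = 0")
            case True then show ?thesis using mult_left_mono[OF C, of "real (q n)"] T0 by simp
          next
            case False
            have "Re (T n j f) \<le> real (q n) * (Re (mom j) + \<epsilon>)"
              by (rule Gam_moment(2)[OF f]) (use False j R \<epsilon> q in \<open>auto simp: r_def\<close>)
            also have "\<dots> \<le> real (q n) * C" using Cj(1)[OF j] complex_Re_le_cmod[of "mom j"] \<epsilon> by (intro mult_left_mono) auto
            finally show ?thesis .
          qed
          have bg: "Re (T n j g) \<le> real (q n) * C" if j: "j \<le> 4 * m" for j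
          proof -
            have "\<bar>Re (T n j g) / q n - M j\<bar> \<le> \<epsilon>" using g j by (simp add: good_def r_def)
            then have "Re (T n j g) / q n \<le> C" using Cj(2)[OF j] \<epsilon> by linarith
            then show ?thesis using q by (simp add: field_simps)
          qed
          let ?D = "\<Sum>e\<in>B n. (cmod (f e - g e))\<^sup>2"
          have D0: "?D \<ge> 0" by (simp add: sum_nonneg)
          have "\<eta> \<le> cmod (T n m f / of_nat (q n) - T n m g / of_nat (q n)) + 2 * \<epsilon>"
          proof -
            have "cmod (T n m f / of_nat (q n) - mom m) \<le> \<epsilon>" by (rule Gam_moment(1)[OF f]) (use m R \<epsilon> q in \<open>auto simp: r_def\<close>)
            moreover have "cmod (T n m g / of_nat (q n) - of_real (M m)) \<le> \<epsilon>" by (rule good_moment[OF g]) (simp add: r_def)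
            moreover have "mom m - of_real (M m) = (T n m f / of_nat (q n) - T n m g / of_nat (q n)) + ((T n m g / of_nat (q n) - of_real (M m)) - (T n m f / of_nat (q n) - mom m))" by simp
            then have "\<eta> \<le> cmod (T n m f / of_nat (q n) - T n m g / of_nat (q n)) + cmod ((T n m g / of_nat (q n) - of_real (M m)) - (T n m f / of_nat (q n) - mom m))"
              unfolding \<eta>_def by (simp only: norm_triangle_ineq)
            moreover have "cmod ((T n m g / of_nat (q n) - of_real (M m)) - (T n m f / of_nat (q n) - mom m)) \<le> cmod (T n m g / of_nat (q n) - of_real (M m)) + cmod (T n m f / of_nat (q n) - mom m)"
              by (rule norm_triangle_ineq4)
            ultimately show ?thesis by linarith
          qed
          moreover have "cmod (T n m f / of_nat (q n) - T n m g / of_nat (q n)) = cmod (T n m f - T n m g) / real (q n)"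
            by (simp add: diff_divide_distrib[symmetric] norm_divide)
          ultimately have "\<eta> / 2 \<le> cmod (T n m f - T n m g) / real (q n)" using \<epsilon>(3) by linarith
          then have "\<eta> / 2 * real (q n) \<le> cmod (T n m f - T n m g)" using q by (simp add: field_simps)
          also have "\<dots> \<le> 2 * real m * sqrt (?D * (real (q n) * C))" by (rule wtr_difference_bound[OF bf bg])
          finally have "(\<eta> / 2 * real (q n))\<^sup>2 \<le> (2 * real m * sqrt (?D * (real (q n) * C)))\<^sup>2" using \<eta> by (intro power_mono) auto
          also have "\<dots> = 4 * (real m)\<^sup>2 * C * real (q n) * ?D" using D0 C by (simp add: power_mult_distrib mult_ac)
          finally have "real (q n) * (\<eta>\<^sup>2 * real (q n)) \<le> real (q n) * (16 * (real m)\<^sup>2 * C * ?D)"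
            by (simp add: power_mult_distrib power_divide power2_eq_square[of "real (q n)"] mult_ac)
          then have "\<eta>\<^sup>2 * real (q n) \<le> 16 * (real m)\<^sup>2 * C * ?D" using q by (simp only: mult_le_cancel_left_pos of_nat_0_less_iff)
          then have D: "real (q n) * \<delta> \<le> ?D" using m C by (simp add: \<delta>_def field_simps)
          have hf: "hsq n f \<le> real (q n) * (c + \<epsilon>)"
          proof -
            have "hsq n f \<le> real (q n) * (Re (mom 1) + \<epsilon>)"
              unfolding wtr_one_hsq[symmetric] by (rule Gam_moment(2)[OF f]) (use r R \<epsilon> q in auto)
            also have "\<dots> \<le> real (q n) * (c + \<epsilon>)" using c1 by (intro mult_left_mono) auto
            finally show ?thesis .
          qed
          have hg: "hsq n g \<le> real (q n) * (c + \<epsilon>)"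
          proof -
            have "\<bar>Re (T n 1 g) / q n - M 1\<bar> \<le> \<epsilon>" using g r by (simp add: good_def)
            then have "hsq n g / q n \<le> c + \<epsilon>" unfolding wtr_one_hsq M1 by linarith
            then show ?thesis using q by (simp add: field_simps)
          qed
          have "hsq n (\<lambda>e\<in>B n. (f e + g e) / 2) = (\<Sum>e\<in>B n. (cmod ((f e + g e) / 2))\<^sup>2)" by (rule sum.cong) auto
          also have "\<dots> = (hsq n f + hsq n g) / 2 - ?D / 4" by (rule midpoint_norm)
          also have "\<dots> \<le> real (q n) * (c + \<epsilon>) - real (q n) * \<delta> / 4"
          proof -
            have "(F + G) / 2 - E / 4 \<le> P - S / 4" if "F \<le> P" "G \<le> P" "S \<le> E" for F G E P S :: real
              using that by argo
            from this[OF hf hg D] show ?thesis .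
          qed
          also have "\<dots> = real (q n) * C'" by (simp add: C'_def algebra_simps)
          finally show ?thesis by (simp add: X_def space_PiM)
        qed
        have "emeasure ?L (Gam R n r \<epsilon>) * emeasure ?L (good M R0 n r \<epsilon>) \<le> (emeasure ?L X)\<^sup>2"
          by (rule brunn_minkowski_complex_PiM[OF finite_B _ good_sets Xs GX]) (use R \<epsilon> in \<open>auto intro: Gam_sets\<close>)
        also have "emeasure ?L X \<le> ennreal (gvol s n C')"
          unfolding gvol_def by (rule volume_le_gaussian) (use s_pos n Xs in \<open>auto simp: X_def\<close>)
        then have "(emeasure ?L X)\<^sup>2 \<le> (ennreal (gvol s n C'))\<^sup>2" by (intro power_mono) auto
        finally have 1: "emeasure ?L (Gam R n r \<epsilon>) * emeasure ?L (good M R0 n r \<epsilon>) \<le> (ennreal (gvol s n C'))\<^sup>2" .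
        define v0 w where "v0 = 1 / 2 * gvol s n (c - \<epsilon>)" and "w = gvol s n C'"
        have pos: "v0 > 0" "w > 0" using gvol_pos[OF s_pos n] by (auto simp: v0_def w_def)
        have "emeasure ?L (Gam R n r \<epsilon>) * ennreal v0 \<le> emeasure ?L (Gam R n r \<epsilon>) * emeasure ?L (good M R0 n r \<epsilon>)"
          unfolding v0_def by (intro mult_left_mono elim) simp
        then have 2: "emeasure ?L (Gam R n r \<epsilon>) * ennreal v0 \<le> ennreal (w\<^sup>2)"
          using 1 pos by (simp add: w_def[symmetric] ennreal_power)
        have "emeasure ?L (Gam R n r \<epsilon>) \<le> ennreal (w\<^sup>2 / v0)"
        proof -
          have "emeasure ?L (Gam R n r \<epsilon>) * ennreal v0 * ennreal (1 / v0) \<le> ennreal (w\<^sup>2) * ennreal (1 / v0)"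
            by (intro mult_right_mono 2) simp
          moreover have "ennreal v0 * ennreal (1 / v0) = 1" using pos by (simp add: ennreal_mult[symmetric])
          moreover have "ennreal (w\<^sup>2) * ennreal (1 / v0) = ennreal (w\<^sup>2 / v0)" using pos by (simp add: ennreal_mult[symmetric])
          ultimately show ?thesis by (simp add: mult.assoc)
        qed
        moreover have "w\<^sup>2 / v0 > 0" using pos by simp
        ultimately have "xval n (emeasure ?L (Gam R n r \<epsilon>)) \<le> ereal (1 / (real n)\<^sup>2 * ln (w\<^sup>2 / v0) + rk * rl * ln (real n))"
          by (rule xval_le[OF s_pos n])
        also have "1 / (real n)\<^sup>2 * ln (w\<^sup>2 / v0) + rk * rl * ln (real n) = 2 * U s n C' - (U s n (c - \<epsilon>) + 1 / (real n)\<^sup>2 * ln (1 / 2))"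
        proof -
          have g: "gvol s n (c - \<epsilon>) > 0" by (rule gvol_pos[OF s_pos n])
          have v0: "ln v0 = ln (1 / 2) + ln (gvol s n (c - \<epsilon>))" unfolding v0_def using g by (subst ln_mult) auto
          have L: "ln (w\<^sup>2 / v0) = 2 * ln w - ln v0" using pos by (simp add: ln_div ln_realpow)
          show ?thesis unfolding ln_gvol[OF s_pos n, symmetric] L v0 unfolding w_def by (simp add: algebra_simps)
        qed
        finally show ?case .
      qed
    qed
    then show "\<exists>r\<ge>1. \<exists>\<epsilon>>0. limsup (\<lambda>n. xval n (emeasure (lborelN (B n)) (Gam R n r \<epsilon>))) \<le> ereal L"
      using r \<epsilon> by blast
  qed
  also have "ereal L < ereal (V s c)"
  proof -
    have "L = V s c + rk / s * (3 * \<epsilon> - \<delta> / 2)" using s_pos by (simp add: L_def V_def C'_def field_simps)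
    moreover have "rk / s * (3 * \<epsilon> - \<delta> / 2) < 0" using r_pos s_pos \<epsilon> \<delta> by (intro mult_pos_neg) auto
    ultimately show ?thesis by simp
  qed
  finally show ?thesis .
qed

end

theorem proposition5p13:
  fixes A :: "('h :: chilbert_space) bop set"
    and \<phi> :: "'h bop \<Rightarrow> complex"
    and p :: "nat \<Rightarrow> 'h bop"
    and a b :: "'h bop"
    and d k l :: nat
    and c :: real
    and \<mu> :: "real measure"
  assumes "rectangular_prob_space A \<phi> d p"
    and "k \<in> {1..d}" and "l \<in> {1..d}" and "k \<noteq> l"
    and "rho \<phi> p k \<le> rho \<phi> p l"
    and "c > 0"
    and "\<mu> = distr (marchenko_pastur (rho \<phi> p l / rho \<phi> p k)) borel
              (\<lambda>t. c * rho \<phi> p k / rho \<phi> p l * t)"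
    and "has_type A p k l b"
    and "has_distribution (corner_state \<phi> p k) (p k) (b o\<^sub>L op_adj b) \<mu>"
    and "has_type A p k l a"
    and "Re (corner_state \<phi> p k (a o\<^sub>L op_adj a)) \<le> c"
  shows "free_entropy_D \<phi> d p k l a \<le> free_entropy_D \<phi> d p k l b \<and>
    (free_entropy_D \<phi> d p k l a = free_entropy_D \<phi> d p k l b \<longleftrightarrow>
       has_distribution (corner_state \<phi> p k) (p k) (a o\<^sub>L op_adj a) \<mu>)"
proof -
  interpret b: rect_element A \<phi> d p k l b using assms by unfold_locales auto
  interpret a: rect_element A \<phi> d p k l a using assms by unfold_locales auto
  let ?rk = "rho \<phi> p k" and ?rl = "rho \<phi> p l"
  have r: "?rk > 0" "?rl > 0" by (rule b.r_pos)+
  have ratio: "?rl / ?rk \<ge> 1" using assms(5) r by simp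
  define M where "M m = (\<integral>t. t ^ m \<partial>\<mu>)" for m
  have dist_b: "prob_space \<mu>" "\<And>m. b.mom m = of_real (M m)"
    using assms(9) by (auto simp: has_distribution_def b.mom_def M_def)
  \<comment> \<open>Compact support and total mass of \<mu> are inherited from the hypothesis on b,
    so for a only the equality of moments remains.\<close>
  have dist_a: "has_distribution (corner_state \<phi> p k) (p k) (a o\<^sub>L op_adj a) \<mu> \<longleftrightarrow> (\<forall>m. a.mom m = of_real (M m))"
    using assms(9) by (auto simp: has_distribution_def a.mom_def M_def)
  note moments = scaled_marchenko_pastur_moments[OF ratio assms(7) dist_b(1), folded M_def]
  have Mrec: "M (Suc m) = c * M m + c * ?rk / ?rl * (\<Sum>r<m. M (Suc r) * M (m - 1 - r))" for m
    using moments(2)[of m] r by simp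
  \<comment> \<open>Both elements share the moments M of \<mu>; for b they are its own moments, for
    a only the target of comparison.\<close>
  interpret b: extremal A \<phi> d p k l b c M
    by unfold_locales (rule assms(6) assms(5) moments(1) Mrec)+
  interpret a: extremal A \<phi> d p k l a c M
    by unfold_locales (rule assms(6) assms(5) moments(1) Mrec)+
  let ?V = "ereal (b.V b.s c)"
  \<comment> \<open>The power iteration starts at the corner unit \<open>p k\<close>, which the
    adjoint of a absorbs.\<close>
  have mom1: "a.mom 1 = corner_state \<phi> p k (a o\<^sub>L op_adj a)"
  proof -
    have "(a o\<^sub>L op_adj a) o\<^sub>L p k = a o\<^sub>L op_adj a" using a.bs_pk by (simp add: a.bs_def bop_assoc)
    then show ?thesis by (simp add: a.mom_def)
  qed
  have a_le: "free_entropy_D \<phi> d p k l a \<le> ?V"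
    by (rule a.free_entropy_upper_bound[OF a.s_pos]) (use assms(11) mom1 in simp)
  have "Re (b.mom 1) = c" using dist_b(2)[of 1] b.M1 by simp
  then have b_le: "free_entropy_D \<phi> d p k l b \<le> ?V"
    by (intro b.free_entropy_upper_bound[OF b.s_pos]) simp
  have b_ge: "?V \<le> free_entropy_D \<phi> d p k l b" by (rule b.free_entropy_lower_bound) (rule dist_b(2))
  have b_eq: "free_entropy_D \<phi> d p k l b = ?V" using b_le b_ge by (rule antisym)
  have "free_entropy_D \<phi> d p k l a = ?V \<longleftrightarrow> (\<forall>m. a.mom m = of_real (M m))"
  proof
    assume eq: "\<forall>m. a.mom m = of_real (M m)"
    then have "ereal (a.V a.s c) \<le> free_entropy_D \<phi> d p k l a" by (intro a.free_entropy_lower_bound) blast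
    with a_le show "free_entropy_D \<phi> d p k l a = ?V" by (rule antisym)
  next
    assume V: "free_entropy_D \<phi> d p k l a = ?V"
    show "\<forall>m. a.mom m = of_real (M m)"
    proof (rule ccontr)
      assume "\<not> (\<forall>m. a.mom m = of_real (M m))"
      then obtain m where m: "a.mom m \<noteq> of_real (M m)" by blast
      \<comment> \<open>The zeroth moment is that of the corner unit, the same for both elements, so
        a discrepancy occurs at m \<ge> 1.\<close>
      have "a.mom 0 = b.mom 0" by (simp add: a.mom_def b.mom_def)
      with m dist_b(2) have "m \<ge> 1" by (cases m) auto
      have "free_entropy_D \<phi> d p k l a < ?V"
        by (rule a.free_entropy_strict[OF _ \<open>m \<ge> 1\<close> m]) (use assms(11) mom1 in simp)
      with V show False by simp
    qed
  qed
  with a_le b_eq dist_a show ?thesis by simp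
qed

end
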